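(* Let $A_i:\mathbb{R}_{\ge0}\to\mathbb{R}^{n\times n}$, $i=0,\ldots,N$, and $\mu:\mathbb{R}_{\ge0}\to\mathbb{R}$ be piecewise continuous and uniformly bounded, let $J_i:\mathbb{Z}_{\ge0}\to\mathbb{R}^{n\times n}$, $i=0,\ldots,N$, be uniformly bounded, and let $\{t_k\}_{k\ge1}\subset(0,\infty)$ be strictly increasing with $t_k\to\infty$. Consider the impulsive system $$\begin{aligned}\dot X(t)&=A_0(t)X(t)+X(t)A_0(t)^T+\sum_{i=1}^NA_i(t)X(t)A_i(t)^T+\mu(t)X(t),&&t\ne t_k,\ t\ge t^0,\\ X(t_k^+)&=\sum_{i=0}^NJ_i(k)X(t_k)J_i(k)^T,&&t_k\ge t^0,\\ X(t^0)&=X_0\in\mathbb{S}^n_{\succeq0},\end{aligned}\qquad(\ast)$$ and set $\mathcal{C}_t^*(P)=A_0(t)^TP+PA_0(t)+\sum_{i=1}^NA_i(t)^TPA_i(t)+\mu(t)P$, $\mathcal{D}_k^*(P)=\sum_{i=0}^NJ_i(k)^TPJ_i(k)$. The following statements are equivalent: (a) The system $(\ast)$ is globally uniformly exponentially stable with hybrid rate $(\alpha,\rho)$ for some $\alpha>0$ and $\rho\in(0,1)$. (b) There exist a piecewise differentiable $P:\mathbb{R}_{\ge0}\to\mathbb{S}^n_{\succ0}$, a piecewise continuous $Q:\mathbb{R}_{\ge0}\to\mathbb{S}^n_{\succ0}$, a function $R:\mathbb{Z}_{\ge0}\to\mathbb{S}^n_{\succ0}$ and scalars $\alpha_1,\alpha_2,\beta_1,\beta_2,\gamma_1,\gamma_2>0$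 such that $\alpha_1I\preceq P(t)\preceq\alpha_2I$, $\beta_1I\preceq Q(t)\preceq\beta_2I$, $\gamma_1I\preceq R(k)\preceq\gamma_2I$ and $$\dot P(t)+\mathcal{C}_t^*(P(t))=-Q(t),\quad t\ne t_k,\ t\ge0;\qquad \mathcal{D}_k^*(P(t_k^+))-P(t_k)=-R(k),\quad k\ge1.$$ (c) There exist a piecewise differentiable $P:\mathbb{R}_{\ge0}\to\mathbb{S}^n_{\succ0}$ and scalars $\alpha_1,\alpha_2,\alpha_3,\alpha_4>0$ such that $\alpha_1I\preceq P(t)\preceq\alpha_2I$ and $$\dot P(t)+\mathcal{C}_t^*(P(t))\preceq-\alpha_3I,\quad t\ne t_k,\ t\ge0;\qquad \mathcal{D}_k^*(P(t_k^+))-P(t_k)\preceq-\alpha_4I,\quad k\ge1.$$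
   Context: $\mathbb{S}^n$, $\mathbb{S}^n_{\succeq0}$, $\mathbb{S}^n_{\succ0}$ denote the real symmetric, positive semidefinite and positive definite $n\times n$ matrices; $\preceq$ is the Loewner order. Solutions $X$ are left-continuous, with $X(t_k)$ the value before the jump and $X(t_k^+)$ the right limit. Piecewise continuous means finitely many discontinuities on each compact interval, with finite one-sided limits. A piecewise differentiable $P$ is left-continuous, continuous except possibly at the impulse instants $t_k$ where it has right limits $P(t_k^+)$, and differentiable at every $t\neq t_k$ at which the coefficients (and $Q$) are continuous; differential relations are required at such $t$. The system is globally uniformly exponentially stable with hybrid rate $(\alpha,\rho)$ if there exists $\beta\ge1$ such that $\|X(t)\|\le\beta\rho^{\kappa(t,t^0)}e^{-\alpha(t-t^0)}\|X_0\|$ for all $t\ge t^0$, all $t^0\ge0$ and all $X_0\in\mathbb{S}^n_{\succeq0}$, where $\kappa(t,t^0)$ is the number of jumps in $[t^0,t]$. *)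

theory Defs
  imports "HOL-Analysis.Analysis"
begin

section \<open>Definiteness and the Loewner order\<close>

definition symmetric_matrix :: "real^'n^'n \<Rightarrow> bool" where
  "symmetric_matrix M \<longleftrightarrow> transpose M = M"

definition pos_semidefinite :: "real^'n^'n \<Rightarrow> bool" where
  "pos_semidefinite M \<longleftrightarrow> symmetric_matrix M \<and> (\<forall>x. 0 \<le> x \<bullet> (M *v x))"

definition pos_definite :: "real^'n^'n \<Rightarrow> bool" where
  "pos_definite M \<longleftrightarrow> symmetric_matrix M \<and> (\<forall>x. x \<noteq> 0 \<longrightarrow> 0 < x \<bullet> (M *v x))"

definition loewner_le :: "real^'n^'n \<Rightarrow> real^'n^'n \<Rightarrow> bool"  (infix \<open>\<preceq>\<^sub>L\<close> 50) where
  "M \<preceq>\<^sub>L M' \<longleftrightarrow> pos_semidefinite (M' - M)"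

abbreviation scaled_identity :: "real \<Rightarrow> real^'n^'n" where
  "scaled_identity c \<equiv> c *\<^sub>R mat 1"


section \<open>Piecewise regularity on half-lines\<close>

text \<open>Functions on the nonnegative half-line are total functions on the reals whose values at
  negative arguments play no role: all continuity and differentiability statements are relative
  to the half-line, hence one-sided at its left endpoint.\<close>

definition piecewise_continuous :: "(real \<Rightarrow> 'a::topological_space) \<Rightarrow> bool" where
  "piecewise_continuous f \<longleftrightarrow>
     (\<forall>a\<ge>0. \<forall>b. finite {t \<in> {a..b}. \<not> continuous (at t within {0..}) f}) \<and>
     (\<forall>t>0. \<exists>l. (f \<longlongrightarrow> l) (at_left t)) \<and>
     (\<forall>t\<ge>0. \<exists>l. (f \<longlongrightarrow> l) (at_right t))"

text \<open>\<open>T\<close> is the set of impulse instants and \<open>C\<close> the set of instants at which the data entering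
  the differential relation are continuous.\<close>

definition piecewise_differentiable ::
    "real \<Rightarrow> real set \<Rightarrow> real set \<Rightarrow> (real \<Rightarrow> 'a::real_normed_vector) \<Rightarrow> bool" where
  "piecewise_differentiable a T C f \<longleftrightarrow>
     (\<forall>t>a. (f \<longlongrightarrow> f t) (at_left t)) \<and>
     (\<forall>t\<in>{a..} - T. continuous (at t within {a..}) f) \<and>
     (\<forall>t\<in>{a..} \<inter> T. \<exists>l. (f \<longlongrightarrow> l) (at_right t)) \<and>
     (\<forall>t\<in>({a..} \<inter> C) - T. f differentiable (at t within {a..}))"


section \<open>The impulsive system\<close>

text \<open>The impulse instants are \<open>\<tau> k\<close> with \<open>k \<ge> 1\<close>; the value \<open>\<tau> 0\<close> is never used.\<close>

definition impulse_instants :: "(nat \<Rightarrow> real) \<Rightarrow> real set" where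
  "impulse_instants \<tau> = \<tau> ` {1..}"

definition continuity_times ::
    "nat \<Rightarrow> (nat \<Rightarrow> real \<Rightarrow> real^'n^'n) \<Rightarrow> (real \<Rightarrow> real) \<Rightarrow> real set" where
  "continuity_times N A \<mu> =
     {t. 0 \<le> t \<and> (\<forall>i\<le>N. continuous (at t within {0..}) (A i)) \<and> continuous (at t within {0..}) \<mu>}"

definition flow_op ::
    "nat \<Rightarrow> (nat \<Rightarrow> real \<Rightarrow> real^'n^'n) \<Rightarrow> (real \<Rightarrow> real) \<Rightarrow> real \<Rightarrow> real^'n^'n \<Rightarrow> real^'n^'n" where
  "flow_op N A \<mu> t X =
     A 0 t ** X + X ** transpose (A 0 t) + (\<Sum>i=1..N. A i t ** X ** transpose (A i t)) + \<mu> t *\<^sub>R X"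

definition jump_op ::
    "nat \<Rightarrow> (nat \<Rightarrow> nat \<Rightarrow> real^'n^'n) \<Rightarrow> nat \<Rightarrow> real^'n^'n \<Rightarrow> real^'n^'n" where
  "jump_op N J k X = (\<Sum>i=0..N. J i k ** X ** transpose (J i k))"

definition flow_adj ::
    "nat \<Rightarrow> (nat \<Rightarrow> real \<Rightarrow> real^'n^'n) \<Rightarrow> (real \<Rightarrow> real) \<Rightarrow> real \<Rightarrow> real^'n^'n \<Rightarrow> real^'n^'n" where
  "flow_adj N A \<mu> t P =
     transpose (A 0 t) ** P + P ** A 0 t + (\<Sum>i=1..N. transpose (A i t) ** P ** A i t) + \<mu> t *\<^sub>R P"

definition jump_adj ::
    "nat \<Rightarrow> (nat \<Rightarrow> nat \<Rightarrow> real^'n^'n) \<Rightarrow> nat \<Rightarrow> real^'n^'n \<Rightarrow> real^'n^'n" where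
  "jump_adj N J k P = (\<Sum>i=0..N. transpose (J i k) ** P ** J i k)"

text \<open>If the initial time is itself an impulse instant, the jump at that instant is performed.\<close>

definition is_solution ::
    "nat \<Rightarrow> (nat \<Rightarrow> real \<Rightarrow> real^'n^'n) \<Rightarrow> (real \<Rightarrow> real) \<Rightarrow> (nat \<Rightarrow> nat \<Rightarrow> real^'n^'n) \<Rightarrow>
     (nat \<Rightarrow> real) \<Rightarrow> real \<Rightarrow> real^'n^'n \<Rightarrow> (real \<Rightarrow> real^'n^'n) \<Rightarrow> bool" where
  "is_solution N A \<mu> J \<tau> t0 X0 X \<longleftrightarrow>
     piecewise_differentiable t0 (impulse_instants \<tau>) (continuity_times N A \<mu>) X \<and>
     X t0 = X0 \<and>
     (\<forall>t\<in>({t0..} \<inter> continuity_times N A \<mu>) - impulse_instants \<tau>.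
        (X has_vector_derivative flow_op N A \<mu> t (X t)) (at t within {t0..})) \<and>
     (\<forall>k\<ge>1. t0 \<le> \<tau> k \<longrightarrow> (X \<longlongrightarrow> jump_op N J k (X (\<tau> k))) (at_right (\<tau> k)))"

definition num_jumps :: "(nat \<Rightarrow> real) \<Rightarrow> real \<Rightarrow> real \<Rightarrow> nat" where
  "num_jumps \<tau> t t0 = card {k. 1 \<le> k \<and> \<tau> k \<in> {t0..t}}"

text \<open>The matrix norm is the Euclidean (Frobenius) norm; by equivalence of norms the choice only
  affects the constant \<open>\<beta>\<close>.\<close>

definition gues ::
    "nat \<Rightarrow> (nat \<Rightarrow> real \<Rightarrow> real^'n^'n) \<Rightarrow> (real \<Rightarrow> real) \<Rightarrow> (nat \<Rightarrow> nat \<Rightarrow> real^'n^'n) \<Rightarrow>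
     (nat \<Rightarrow> real) \<Rightarrow> real \<Rightarrow> real \<Rightarrow> bool" where
  "gues N A \<mu> J \<tau> \<alpha> \<rho> \<longleftrightarrow>
     (\<exists>\<beta>\<ge>1. \<forall>t0\<ge>0. \<forall>X0 X. pos_semidefinite X0 \<longrightarrow> is_solution N A \<mu> J \<tau> t0 X0 X \<longrightarrow>
        (\<forall>t\<ge>t0. norm (X t) \<le> \<beta> * \<rho> ^ num_jumps \<tau> t t0 * exp (- \<alpha> * (t - t0)) * norm X0))"


section \<open>Lyapunov conditions\<close>

definition lyapunov_equation_solvable ::
    "nat \<Rightarrow> (nat \<Rightarrow> real \<Rightarrow> real^'n^'n) \<Rightarrow> (real \<Rightarrow> real) \<Rightarrow> (nat \<Rightarrow> nat \<Rightarrow> real^'n^'n) \<Rightarrow>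
     (nat \<Rightarrow> real) \<Rightarrow> bool" where
  "lyapunov_equation_solvable N A \<mu> J \<tau> \<longleftrightarrow>
     (\<exists>(P :: real \<Rightarrow> real^'n^'n) (Q :: real \<Rightarrow> real^'n^'n) (R :: nat \<Rightarrow> real^'n^'n)
       \<alpha>1 \<alpha>2 \<beta>1 \<beta>2 \<gamma>1 \<gamma>2.
       piecewise_differentiable 0 (impulse_instants \<tau>)
         (continuity_times N A \<mu> \<inter> {t. continuous (at t within {0..}) Q}) P \<and>
       piecewise_continuous Q \<and>
       (\<forall>t\<ge>0. pos_definite (P t)) \<and> (\<forall>t\<ge>0. pos_definite (Q t)) \<and> (\<forall>k. pos_definite (R k)) \<and>
       0 < \<alpha>1 \<and> 0 < \<alpha>2 \<and> 0 < \<beta>1 \<and> 0 < \<beta>2 \<and> 0 < \<gamma>1 \<and> 0 < \<gamma>2 \<and>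
       (\<forall>t\<ge>0. scaled_identity \<alpha>1 \<preceq>\<^sub>L P t \<and> P t \<preceq>\<^sub>L scaled_identity \<alpha>2) \<and>
       (\<forall>t\<ge>0. scaled_identity \<beta>1 \<preceq>\<^sub>L Q t \<and> Q t \<preceq>\<^sub>L scaled_identity \<beta>2) \<and>
       (\<forall>k. scaled_identity \<gamma>1 \<preceq>\<^sub>L R k \<and> R k \<preceq>\<^sub>L scaled_identity \<gamma>2) \<and>
       (\<forall>t\<in>(continuity_times N A \<mu> \<inter> {t. continuous (at t within {0..}) Q}) - impulse_instants \<tau>.
          vector_derivative P (at t within {0..}) + flow_adj N A \<mu> t (P t) = - Q t) \<and>
       (\<forall>k\<ge>1. jump_adj N J k (Lim (at_right (\<tau> k)) P) - P (\<tau> k) = - R k))"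

text \<open>Without \<open>Q\<close>, differentiability is required wherever the coefficients are continuous.\<close>

definition lyapunov_inequality_solvable ::
    "nat \<Rightarrow> (nat \<Rightarrow> real \<Rightarrow> real^'n^'n) \<Rightarrow> (real \<Rightarrow> real) \<Rightarrow> (nat \<Rightarrow> nat \<Rightarrow> real^'n^'n) \<Rightarrow>
     (nat \<Rightarrow> real) \<Rightarrow> bool" where
  "lyapunov_inequality_solvable N A \<mu> J \<tau> \<longleftrightarrow>
     (\<exists>(P :: real \<Rightarrow> real^'n^'n) \<alpha>1 \<alpha>2 \<alpha>3 \<alpha>4.
       piecewise_differentiable 0 (impulse_instants \<tau>) (continuity_times N A \<mu>) P \<and>
       (\<forall>t\<ge>0. pos_definite (P t)) \<and>
       0 < \<alpha>1 \<and> 0 < \<alpha>2 \<and> 0 < \<alpha>3 \<and> 0 < \<alpha>4 \<and>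
       (\<forall>t\<ge>0. scaled_identity \<alpha>1 \<preceq>\<^sub>L P t \<and> P t \<preceq>\<^sub>L scaled_identity \<alpha>2) \<and>
       (\<forall>t\<in>continuity_times N A \<mu> - impulse_instants \<tau>.
          vector_derivative P (at t within {0..}) + flow_adj N A \<mu> t (P t)
            \<preceq>\<^sub>L scaled_identity (- \<alpha>3)) \<and>
       (\<forall>k\<ge>1. jump_adj N J k (Lim (at_right (\<tau> k)) P) - P (\<tau> k)
            \<preceq>\<^sub>L scaled_identity (- \<alpha>4)))"

end

theory Submission
  imports Defs
begin

text \<open>The flow and jump operators preserve semidefiniteness, so that for a function \<open>P\<close> as in (b) or (c)
  the trace \<open>tr (P X)\<close> is comparable to the norm of \<open>X\<close> along semidefinite solutions; it decreases
  exponentially along the flow and by a fixed factor at every jump. Conversely, under stability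
  \<open>tr (P t X) = \<integral> tr (X s) ds + \<Sum> tr (X (\<tau> k))\<close>, over the times \<open>s \<ge> t\<close> and \<open>\<tau> k \<ge> t\<close> along the solution with
  \<open>X t = X\<close>, defines a \<open>P\<close> that satisfies (b) and (c) with \<open>Q = R = I\<close>. Stability is needed as a link between
  (b) and (c): a \<open>P\<close> as in (b) need not be differentiable where only \<open>Q\<close> is discontinuous.\<close>


section \<open>Semidefinite matrices and the trace inner product\<close>

text \<open>Three obstacles shape the proof. The coefficients are only piecewise continuous, so that
  derivatives are known off finitely many points of a compact interval; every differential
  inequality therefore goes through the fundamental theorem of calculus with a finite exceptional
  set. The jump maps need not be invertible, so that the whole evolution cannot be run backwards;
  the flow between impulses can, and in coordinates moved back to time 0 the system becomes a
  forward product of jump factors. Finally, nothing bounds the gaps between impulses from below or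
  above. This is why \<open>P\<close> contains both an integral and a sum: ahead of a long gap only
  the integral keeps \<open>P\<close> away from 0, ahead of a short one only the sum does.
  Conversely \<rho> < 1 makes the sum converge however dense the impulses are, and \<alpha> > 0
  bounds the integrals however long the gaps are. Since (a) speaks only of given solutions with
  semidefinite initial values, its use requires explicit solutions and an extension of the bound to
  all initial matrices.\<close>

definition rank_one :: "real^'n \<Rightarrow> real^'n^'n" where
  "rank_one x = (\<chi> i j. x $ i * x $ j)"

text \<open>With the Frobenius inner product a quadratic form becomes a linear function of the
  matrix, so that linearity, bounds and derivatives of \<open>x \<bullet> (M *v x)\<close> are read
  off from inner products with \<open>x x^T\<close>.\<close>

lemma inner_rank_one: "M \<bullet> rank_one x = x \<bullet> (M *v x)"
  unfolding inner_vec_def rank_one_def matrix_vector_mult_def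
  by (simp add: sum_distrib_left mult_ac)

lemma rank_one_vec_mult: "rank_one x *v y = (x \<bullet> y) *\<^sub>R x"
  by (simp add: vec_eq_iff rank_one_def matrix_vector_mult_def inner_vec_def sum_distrib_left mult_ac)

lemma symmetric_rank_one: "symmetric_matrix (rank_one x)"
  by (simp add: symmetric_matrix_def rank_one_def transpose_def vec_eq_iff mult.commute)

lemma psd_rank_one: "pos_semidefinite (rank_one x)"
  by (simp add: pos_semidefinite_def symmetric_rank_one rank_one_vec_mult inner_commute[of _ x])

lemma norm_rank_one: "norm (rank_one x) = (norm x)\<^sup>2"
proof -
  have "(norm (rank_one x))\<^sup>2 = ((norm x)\<^sup>2)\<^sup>2"
    unfolding power2_norm_eq_inner inner_rank_one rank_one_vec_mult
    by (simp add: power2_eq_square)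
  then show ?thesis by (rule power2_eq_imp_eq) simp_all
qed

section \<open>Transposition and the Frobenius inner product\<close>

lemma transpose_add: "transpose (X + Y) = transpose X + transpose (Y :: real^'n^'m)"
  by (simp add: transpose_def vec_eq_iff)

lemma transpose_diff: "transpose (X - Y) = transpose X - transpose (Y :: real^'n^'m)"
  by (simp add: transpose_def vec_eq_iff)

lemma transpose_sum: "transpose (\<Sum>i\<in>I. f i) = (\<Sum>i\<in>I. transpose (f i :: real^'n^'m))"
  by (simp add: transpose_def vec_eq_iff)

lemma linear_transpose: "linear (transpose :: real^'n^'m \<Rightarrow> real^'m^'n)"
  by (rule linearI) (simp_all add: transpose_add transpose_scalar)

lemma inner_transpose: "transpose X \<bullet> transpose Y = X \<bullet> (Y :: real^'n^'m)"
  unfolding inner_vec_def transpose_def by (simp, rule sum.swap)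

lemma norm_transpose: "norm (transpose X) = norm (X :: real^'n^'m)"
  by (simp add: norm_eq_sqrt_inner inner_transpose)

lemma inner_matrix_mult_left: "(A ** X) \<bullet> P = X \<bullet> (transpose A ** (P :: real^'n^'m))"
  for A :: "real^'k^'m"
proof -
  have "(A ** X) \<bullet> P = (\<Sum>i\<in>UNIV. \<Sum>j\<in>UNIV. \<Sum>k\<in>UNIV. A$i$k * X$k$j * P$i$j)"
    by (simp add: inner_vec_def matrix_matrix_mult_def sum_distrib_right)
  also have "\<dots> = (\<Sum>j\<in>UNIV. \<Sum>i\<in>UNIV. \<Sum>k\<in>UNIV. A$i$k * X$k$j * P$i$j)"
    by (rule sum.swap)
  also have "\<dots> = (\<Sum>j\<in>UNIV. \<Sum>k\<in>UNIV. \<Sum>i\<in>UNIV. A$i$k * X$k$j * P$i$j)"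
    by (intro sum.cong refl, rule sum.swap)
  also have "\<dots> = (\<Sum>k\<in>UNIV. \<Sum>j\<in>UNIV. \<Sum>i\<in>UNIV. A$i$k * X$k$j * P$i$j)"
    by (rule sum.swap)
  also have "\<dots> = X \<bullet> (transpose A ** P)"
    by (simp add: inner_vec_def matrix_matrix_mult_def transpose_def sum_distrib_left mult_ac)
  finally show ?thesis .
qed

lemma inner_matrix_mult_right: "(X ** A) \<bullet> P = X \<bullet> (P ** transpose A)"
  for A :: "real^'k^'m" and X :: "real^'m^'n"
proof -
  have "(X ** A) \<bullet> P = transpose (X ** A) \<bullet> transpose P" by (simp only: inner_transpose)
  also have "\<dots> = transpose X \<bullet> (A ** transpose P)"
    by (simp add: matrix_transpose_mul inner_matrix_mult_left)
  also have "\<dots> = transpose X \<bullet> transpose (P ** transpose A)"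
    by (simp add: matrix_transpose_mul)
  finally show ?thesis by (simp only: inner_transpose)
qed

lemma inner_symmetric_matrix:
  "symmetric_matrix M \<Longrightarrow> x \<bullet> (M *v y) = (M *v x) \<bullet> y"
  using dot_lmul_matrix[of x M y] transpose_matrix_vector[of M x] by (simp add: symmetric_matrix_def)

section \<open>Semidefinite forms\<close>

lemma psdD: "pos_semidefinite M \<Longrightarrow> symmetric_matrix M" "pos_semidefinite M \<Longrightarrow> 0 \<le> x \<bullet> (M *v x)"
  by (auto simp: pos_semidefinite_def)

text \<open>A quadratic polynomial in \<open>s\<close> that is nowhere negative has nonpositive
  discriminant. The form may be degenerate, so that the leading coefficient can vanish and needs its
  own case.\<close>

lemma psd_Cauchy_Schwarz:
  assumes "pos_semidefinite M"
  shows "(x \<bullet> (M *v y))\<^sup>2 \<le> (x \<bullet> (M *v x)) * (y \<bullet> (M *v y))"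
proof -
  define a b c where "a = y \<bullet> (M *v y)" and "b = x \<bullet> (M *v y)" and "c = x \<bullet> (M *v x)"
  have *: "0 \<le> c + 2 * s * b + s\<^sup>2 * a" for s
  proof -
    have "y \<bullet> (M *v x) = b"
      using inner_symmetric_matrix[OF psdD(1)[OF assms], of x y] by (simp add: b_def inner_commute)
    then have "(x + s *\<^sub>R y) \<bullet> (M *v (x + s *\<^sub>R y)) = c + 2 * s * b + s\<^sup>2 * a"
      by (simp add: matrix_vector_right_distrib matrix_vector_mult_scaleR inner_add_left inner_add_right
          a_def b_def c_def power2_eq_square algebra_simps)
    then show ?thesis using psdD(2)[OF assms, of "x + s *\<^sub>R y"] by simp
  qed
  have a: "0 \<le> a" unfolding a_def by (rule psdD(2)[OF assms])
  show ?thesis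
  proof (cases "a = 0")
    case True
    have "b = 0"
    proof (rule ccontr)
      assume "b \<noteq> 0"
      \<comment> \<open>With leading coefficient 0 the polynomial is affine, and at this
        \<open>s\<close> it takes the value -1.\<close>
      then show False using *[of "- (c + 1) / (2 * b)"] True by (simp add: field_simps)
    qed
    then show ?thesis using True by (simp add: a_def b_def c_def)
  next
    case False
    then have "0 < a" using a by simp
    \<comment> \<open>The minimizer of the polynomial.\<close>
    moreover have "0 \<le> c + 2 * (- b / a) * b + (- b / a)\<^sup>2 * a" by (rule *)
    moreover have "c + 2 * (- b / a) * b + (- b / a)\<^sup>2 * a = (c * a - b\<^sup>2) / a"
      using False by (simp add: field_simps power2_eq_square)
    ultimately have "b\<^sup>2 \<le> c * a" by (simp add: zero_le_divide_iff)
    then show ?thesis by (simp add: a_def b_def c_def)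
  qed
qed

text \<open>Cauchy-Schwarz between \<open>M *v x\<close> and \<open>x\<close> bounds the fourth
  power of the norm of \<open>M *v x\<close> by a multiple of \<open>x \<bullet> (M *v x)\<close>.
  It serves the Schur complement and, later, the first zero of a form along the flow.\<close>

lemma psd_null_vector:
  assumes "pos_semidefinite M" "x \<bullet> (M *v x) = 0"
  shows "M *v x = 0"
proof -
  have "((M *v x) \<bullet> (M *v x))\<^sup>2 \<le> 0"
    using psd_Cauchy_Schwarz[OF assms(1), of "M *v x" x] assms(2) by simp
  then show ?thesis by simp
qed

lemma matrix_vec_axis: "(M *v axis i 1) $ j = M $ j $ i" for M :: "real^'n^'m"
  by (simp add: matrix_vector_mul_component inner_axis)

lemma inner_axis_quadratic: "axis i 1 \<bullet> (M *v axis i 1) = M $ i $ i" for M :: "real^'n^'n"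
  by (simp add: inner_axis' matrix_vec_axis)

text \<open>A semidefinite matrix is a sum of rank-one ones: splitting off a column leaves the Schur
  complement, which has fewer nonzero diagonal entries.\<close>

lemma psd_inner_nonneg:
  fixes M X :: "real^'n^'n"
  assumes M: "pos_semidefinite M" and X: "pos_semidefinite X"
  shows "0 \<le> M \<bullet> X"
  using X
proof (induction "card {i. X $ i $ i \<noteq> 0}" arbitrary: X rule: less_induct)
  case less
  note X = less.prems
  \<comment> \<open>A zero on the diagonal annihilates its column, so that a zero diagonal ends the
    induction with \<open>X = 0\<close>, and such zeros survive in the Schur complement.\<close>
  have col: "X $ j $ i = 0" if "X $ i $ i = 0" for i j
  proof -
    have "X *v axis i 1 = 0" by (rule psd_null_vector[OF X]) (simp add: inner_axis_quadratic that)
    then show ?thesis by (metis matrix_vec_axis zero_index)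
  qed
  show ?case
  proof (cases "\<forall>i. X $ i $ i = 0")
    case True
    then have "X = 0" using col by (simp add: vec_eq_iff)
    then show ?thesis by simp
  next
    case False
    then obtain i where i: "X $ i $ i \<noteq> 0" by blast
    define d v where "d = X $ i $ i" and "v = X *v axis i 1"
    have d: "0 < d" using i psdD(2)[OF X, of "axis i 1"] by (simp add: d_def inner_axis_quadratic)
    define Y where "Y = X - (1 / d) *\<^sub>R rank_one v"
    have v: "v $ j = X $ j $ i" for j by (simp add: v_def matrix_vec_axis)
    have Y_entry: "Y $ j $ j = X $ j $ j - (X $ j $ i)\<^sup>2 / d" for j
      by (simp add: Y_def rank_one_def v power2_eq_square)
    have "pos_semidefinite Y"
      unfolding pos_semidefinite_def
    proof (intro conjI allI)
      show "symmetric_matrix Y"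
        using psdD(1)[OF X] symmetric_rank_one[of v]
        by (simp add: symmetric_matrix_def Y_def transpose_diff transpose_scalar)
      fix x
      \<comment> \<open>Semidefiniteness of the Schur complement is Cauchy-Schwarz for
        \<open>X\<close> between \<open>x\<close> and the \<open>i\<close>-th unit vector.\<close>
      have "(x \<bullet> v)\<^sup>2 \<le> (x \<bullet> (X *v x)) * d"
        using psd_Cauchy_Schwarz[OF X, of x "axis i 1"] by (simp add: v_def d_def inner_axis_quadratic)
      then have "(x \<bullet> v)\<^sup>2 / d \<le> x \<bullet> (X *v x)" using d by (simp add: divide_le_eq)
      moreover have "x \<bullet> (Y *v x) = x \<bullet> (X *v x) - (x \<bullet> v)\<^sup>2 / d"
        unfolding inner_rank_one[symmetric] Y_def
        by (simp add: inner_diff_left) (simp add: inner_rank_one rank_one_vec_mult power2_eq_square inner_commute)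
      ultimately show "0 \<le> x \<bullet> (Y *v x)" by simp
    qed
    moreover have "card {j. Y $ j $ j \<noteq> 0} < card {j. X $ j $ j \<noteq> 0}"
    proof (rule psubset_card_mono)
      have "Y $ i $ i = 0" using d by (simp add: Y_entry power2_eq_square d_def)
      moreover have "Y $ j $ j = 0" if "X $ j $ j = 0" for j
      proof -
        have "X $ j $ i = X $ i $ j"
          using arg_cong[OF psdD(1)[OF X, unfolded symmetric_matrix_def], of "\<lambda>M. M $ i $ j"]
          by (simp add: transpose_def)
        then show ?thesis using col[OF that] that by (simp add: Y_entry)
      qed
      ultimately show "{j. Y $ j $ j \<noteq> 0} \<subset> {j. X $ j $ j \<noteq> 0}" using i by blast
    qed simp
    ultimately have "0 \<le> M \<bullet> Y" using less.hyps by blast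
    moreover have "M \<bullet> X = M \<bullet> Y + (1 / d) * (v \<bullet> (M *v v))"
      by (simp add: Y_def inner_diff_right inner_rank_one)
    ultimately show ?thesis using psdD(2)[OF M, of v] d by simp
  qed
qed

section \<open>Loewner order and trace bounds\<close>

lemma symmetric_mat: "symmetric_matrix (mat c)"
  by (simp add: symmetric_matrix_def)

lemma identity_inner_rank_one: "mat 1 \<bullet> rank_one x = (norm x)\<^sup>2"
  by (simp add: inner_rank_one power2_norm_eq_inner)

lemma inner_scaled_identity: "x \<bullet> (scaled_identity c *v x) = c * (norm x)\<^sup>2"
  by (simp only: inner_rank_one[symmetric] inner_scaleR_left identity_inner_rank_one)

lemma symmetric_diff: "symmetric_matrix M \<Longrightarrow> symmetric_matrix M' \<Longrightarrow> symmetric_matrix (M - M')"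
  by (simp add: symmetric_matrix_def transpose_diff)

lemma symmetric_add: "symmetric_matrix M \<Longrightarrow> symmetric_matrix M' \<Longrightarrow> symmetric_matrix (M + M')"
  by (simp add: symmetric_matrix_def transpose_add)

lemma symmetric_scaleR: "symmetric_matrix M \<Longrightarrow> symmetric_matrix (c *\<^sub>R M)"
  by (simp add: symmetric_matrix_def transpose_scalar)

lemma quadratic_diff: "x \<bullet> ((M - M') *v x) = x \<bullet> (M *v x) - x \<bullet> (M' *v x)" for M :: "real^'n^'n"
  by (simp add: inner_rank_one[symmetric] inner_diff_left)

lemma quadratic_add: "x \<bullet> ((M + M') *v x) = x \<bullet> (M *v x) + x \<bullet> (M' *v x)" for M :: "real^'n^'n"
  by (simp add: inner_rank_one[symmetric] inner_add_left)

lemma quadratic_scaleR: "x \<bullet> ((c *\<^sub>R M) *v x) = c * (x \<bullet> (M *v x))" for M :: "real^'n^'n"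
  by (simp add: inner_rank_one[symmetric])

lemma quadratic_le_norm: "\<bar>x \<bullet> (M *v x)\<bar> \<le> norm M * (norm x)\<^sup>2" for M :: "real^'n^'n"
  using Cauchy_Schwarz_ineq2[of M "rank_one x"] by (simp add: inner_rank_one norm_rank_one)

lemma loewner_le_scaled_identity_iff:
  "symmetric_matrix M \<Longrightarrow> M \<preceq>\<^sub>L scaled_identity c \<longleftrightarrow> (\<forall>x. x \<bullet> (M *v x) \<le> c * (norm x)\<^sup>2)"
  by (simp add: loewner_le_def pos_semidefinite_def symmetric_diff symmetric_scaleR symmetric_mat
      quadratic_diff inner_scaled_identity)

lemma scaled_identity_loewner_le_iff:
  "symmetric_matrix M \<Longrightarrow> scaled_identity c \<preceq>\<^sub>L M \<longleftrightarrow> (\<forall>x. c * (norm x)\<^sup>2 \<le> x \<bullet> (M *v x))"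
  by (simp add: loewner_le_def pos_semidefinite_def symmetric_diff symmetric_scaleR symmetric_mat
      quadratic_diff inner_scaled_identity)

lemma loewner_le_norm:
  assumes "symmetric_matrix M" "norm M \<le> c"
  shows "M \<preceq>\<^sub>L scaled_identity c"
  unfolding loewner_le_scaled_identity_iff[OF assms(1)]
proof
  fix x
  have "x \<bullet> (M *v x) \<le> norm M * (norm x)\<^sup>2" using quadratic_le_norm[of x M] by linarith
  also have "\<dots> \<le> c * (norm x)\<^sup>2" using assms(2) by (rule mult_right_mono) simp
  finally show "x \<bullet> (M *v x) \<le> c * (norm x)\<^sup>2" .
qed

text \<open>The form in which matrix inequalities for \<open>P\<close> are applied to a semidefinite
  state.\<close>

lemma loewner_le_inner:
  "M \<preceq>\<^sub>L M' \<Longrightarrow> pos_semidefinite X \<Longrightarrow> M \<bullet> X \<le> M' \<bullet> X"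
  using psd_inner_nonneg[of "M' - M" X] by (simp add: loewner_le_def inner_diff_left)

lemma psd_scaled_identity: "0 \<le> c \<Longrightarrow> pos_semidefinite (scaled_identity c)"
  by (simp add: pos_semidefinite_def symmetric_scaleR symmetric_mat inner_scaled_identity)

lemma psd_identity: "pos_semidefinite (mat 1)"
  using psd_scaled_identity[of 1] by simp

lemma psd_trace_nonneg: "pos_semidefinite X \<Longrightarrow> 0 \<le> mat 1 \<bullet> X"
  by (rule psd_inner_nonneg[OF psd_identity])

lemma psd_quadratic_le_trace:
  assumes "pos_semidefinite X"
  shows "x \<bullet> (X *v x) \<le> (mat 1 \<bullet> X) * (norm x)\<^sup>2"
proof -
  have "rank_one x \<preceq>\<^sub>L scaled_identity ((norm x)\<^sup>2)"
    by (rule loewner_le_norm) (simp_all add: symmetric_rank_one norm_rank_one)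
  from loewner_le_inner[OF this assms] show ?thesis
    by (simp add: inner_commute[of _ X] inner_rank_one mult.commute)
qed

text \<open>Pair \<open>X \<preceq>\<^sub>L scaled_identity (mat 1 \<bullet> X)\<close> with
  \<open>X\<close> itself. Together with Cauchy-Schwarz the trace is thus equivalent to the norm on
  the semidefinite cone.\<close>

lemma psd_norm_le_trace:
  assumes "pos_semidefinite X"
  shows "norm X \<le> mat 1 \<bullet> X"
proof -
  have "X \<preceq>\<^sub>L scaled_identity (mat 1 \<bullet> X)"
    using psd_quadratic_le_trace[OF assms] by (simp add: loewner_le_scaled_identity_iff psdD(1)[OF assms])
  from loewner_le_inner[OF this assms] have "(norm X)\<^sup>2 \<le> (mat 1 \<bullet> X) * (mat 1 \<bullet> X)"
    by (simp only: power2_norm_eq_inner inner_scaleR_left)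
  then have "(norm X)\<^sup>2 \<le> (mat 1 \<bullet> X)\<^sup>2"
    by (simp only: power2_eq_square[of "mat 1 \<bullet> X"])
  then show ?thesis using psd_trace_nonneg[OF assms] by (rule power2_le_imp_le)
qed

text \<open>It exhibits a symmetric \<open>M\<close> as a difference of two semidefinite matrices,
  \<open>norm M *\<^sub>R mat 1\<close> and this one, with norms controlled by
  \<open>norm M\<close>.\<close>

lemma psd_norm_diff:
  assumes "symmetric_matrix M"
  shows "pos_semidefinite (norm M *\<^sub>R mat 1 - M)"
  using loewner_le_norm[OF assms order.refl] by (simp add: loewner_le_def)

section \<open>Piecewise continuous functions\<close>

lemma at_within_atLeast: "a < t \<Longrightarrow> at t within {a..} = at (t :: real)"
  by (rule at_within_interior) simp

lemma at_within_atLeast_Icc: "0 \<le> t \<Longrightarrow> at t within {0..} = at t within {0..t + 1 :: real}"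
  by (rule at_within_nhd[of t "{..<t + 1}"]) auto

text \<open>All clauses of the definition concern limits, so that \<open>lim\<close> alone yields
  them; sums, products and linear images are instances.\<close>

lemma piecewise_continuous_combine:
  assumes f: "piecewise_continuous f" and g: "piecewise_continuous g"
    and lim: "\<And>F l m. (f \<longlongrightarrow> l) F \<Longrightarrow> (g \<longlongrightarrow> m) F \<Longrightarrow> (h \<longlongrightarrow> c l m) F"
    and h: "\<And>t. h t = c (f t) (g t)"
  shows "piecewise_continuous h"
  unfolding piecewise_continuous_def
proof (intro conjI allI impI)
  fix a b :: real assume a: "0 \<le> a"
  have "continuous (at t within {0..}) h"
    if "continuous (at t within {0..}) f" "continuous (at t within {0..}) g" for t
    using lim that unfolding continuous_within h by blast
  then have "{t \<in> {a..b}. \<not> continuous (at t within {0..}) h} \<subseteq>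
      {t \<in> {a..b}. \<not> continuous (at t within {0..}) f} \<union> {t \<in> {a..b}. \<not> continuous (at t within {0..}) g}"
    by blast
  then show "finite {t \<in> {a..b}. \<not> continuous (at t within {0..}) h}"
    using f g a unfolding piecewise_continuous_def by (meson finite_UnI finite_subset)
next
  fix t :: real assume "0 < t"
  then show "\<exists>l. (h \<longlongrightarrow> l) (at_left t)"
    using f g lim unfolding piecewise_continuous_def by meson
next
  fix t :: real assume "0 \<le> t"
  then show "\<exists>l. (h \<longlongrightarrow> l) (at_right t)"
    using f g lim unfolding piecewise_continuous_def by meson
qed

lemma piecewise_continuous_bilinear:
  assumes "bounded_bilinear p" "piecewise_continuous f" "piecewise_continuous g"
  shows "piecewise_continuous (\<lambda>t. p (f t) (g t))"
  by (rule piecewise_continuous_combine[OF assms(2,3)]) (auto intro: bounded_bilinear.tendsto[OF assms(1)])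

lemma piecewise_continuous_linear:
  assumes "bounded_linear h" "piecewise_continuous g"
  shows "piecewise_continuous (\<lambda>t. h (g t))"
  by (rule piecewise_continuous_combine[OF assms(2,2), where c = "\<lambda>x y. h x"])
    (auto intro: bounded_linear.tendsto[OF assms(1)])

lemma piecewise_continuous_add:
  fixes f g :: "real \<Rightarrow> 'a::real_normed_vector"
  shows "piecewise_continuous f \<Longrightarrow> piecewise_continuous g \<Longrightarrow> piecewise_continuous (\<lambda>t. f t + g t)"
  by (rule piecewise_continuous_combine[where f = f and g = g]) (auto intro: tendsto_add)

lemma piecewise_continuous_on:
  assumes "continuous_on {0..} f"
  shows "piecewise_continuous f"
proof -
  have c: "continuous (at t within {0..}) f" if "0 \<le> t" for t
    using assms that by (simp add: continuous_on_eq_continuous_within)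
  have "(f \<longlongrightarrow> f t) (at_left t)" if "0 < t" for t
    using c[of t] that by (simp add: at_within_atLeast continuous_within filterlim_at_split)
  moreover have "(f \<longlongrightarrow> f t) (at_right t)" if "0 \<le> t" for t
    using c[OF that] that unfolding continuous_within
    by (rule_tac tendsto_within_subset) auto
  moreover
  have "{t \<in> {a..b}. \<not> continuous (at t within {0..}) f} = {}" if "0 \<le> a" for a b
    using c that by auto
  then have "finite {t \<in> {a..b}. \<not> continuous (at t within {0..}) f}" if "0 \<le> a" for a b
    using that by (metis finite.emptyI)
  ultimately show ?thesis unfolding piecewise_continuous_def by blast
qed

lemma piecewise_continuous_sum:
  fixes f :: "'i \<Rightarrow> real \<Rightarrow> 'a::real_normed_vector"
  assumes "finite I" "\<And>i. i \<in> I \<Longrightarrow> piecewise_continuous (f i)"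
  shows "piecewise_continuous (\<lambda>t. \<Sum>i\<in>I. f i t)"
  using assms
proof (induction I)
  case empty
  then show ?case by (simp add: piecewise_continuous_on)
next
  case (insert i I)
  then show ?case using piecewise_continuous_add[of "f i" "\<lambda>t. \<Sum>i\<in>I. f i t"] by simp
qed

text \<open>The values of \<open>f\<close> at the two ends are irrelevant once the one-sided limits
  exist. Both integrability and the passage across a jump rest on this.\<close>

lemma continuous_on_Icc_patch:
  fixes f :: "real \<Rightarrow> 'a::topological_space"
  assumes "a < b" "(f \<longlongrightarrow> l) (at_right a)" "(f \<longlongrightarrow> m) (at_left b)"
    and "\<And>t. a < t \<Longrightarrow> t < b \<Longrightarrow> isCont f t"
  shows "continuous_on {a..b} (f(a := l, b := m))"
proof (rule continuous_on_IccI)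
  let ?g = "f(a := l, b := m)"
  have "eventually (\<lambda>t. ?g t = f t) (at_right a)" "eventually (\<lambda>t. ?g t = f t) (at_left b)"
    using assms(1) by (auto simp: eventually_at_right eventually_at_left)
  then show "(?g \<longlongrightarrow> ?g a) (at_right a)" "(?g \<longlongrightarrow> ?g b) (at_left b)"
    using tendsto_cong assms(1-3) by fastforce+
  fix t assume t: "a < t" "t < b"
  have "eventually (\<lambda>s. s \<in> {a<..<b}) (at t)"
    using t by (intro eventually_at_in_open') auto
  then have "eventually (\<lambda>s. ?g s = f s) (at t)" by eventually_elim auto
  then show "?g \<midarrow>t\<rightarrow> ?g t"
    using assms(4)[OF t] t tendsto_cong[of "?g" f "at t" "f t"] by (auto simp: isCont_def)
qed (use assms in auto)

section \<open>Integration and monotonicity with finitely many exceptions\<close>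

lemma integrable_on_Icc_limits:
  fixes f :: "real \<Rightarrow> 'a::banach"
  assumes "a < b" "(f \<longlongrightarrow> l) (at_right a)" "(f \<longlongrightarrow> m) (at_left b)"
    and "\<And>t. a < t \<Longrightarrow> t < b \<Longrightarrow> isCont f t"
  shows "f integrable_on {a..b}"
  by (rule integrable_spike_finite[OF _ _ integrable_continuous_interval[OF continuous_on_Icc_patch[OF assms]],
        of "{a, b}"]) auto

text \<open>The discontinuities need not be enumerated: around each point some neighbourhood
  contains no other one, so that a cut at that point leaves two integrable pieces, and bisection
  extends this to \<open>{a..b}\<close>.\<close>

lemma piecewise_continuous_integrable:
  fixes f :: "real \<Rightarrow> 'a::banach"
  assumes f: "piecewise_continuous f" and "0 \<le> a"
  shows "f integrable_on {a..b}"
proof (cases "a \<le> b")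
  case False
  then show ?thesis by (simp add: integrable_on_empty)
next
  case True
  \<comment> \<open>The small intervals that the bisection asks about may reach below 0, where
    nothing is known of \<open>f\<close>; the guard makes the claim vacuous there.\<close>
  define I where "I u v \<longleftrightarrow> (0 \<le> u \<and> u \<le> v \<longrightarrow> f integrable_on {u..v})" for u v
  have "I a b"
    using True
  proof (induction rule: Bolzano)
    case (trans u v w)
    then show ?case unfolding I_def using Henstock_Kurzweil_Integration.integrable_combine[of u v w f] by auto
  next
    case (local x)
    then have x: "0 \<le> x" using \<open>0 \<le> a\<close> by simp
    define D where "D = {t \<in> {0..x + 1}. \<not> continuous (at t within {0..}) f}"
    have "finite D" unfolding D_def using f by (auto simp: piecewise_continuous_def)
    from finite_set_avoid[OF this, of x] obtain d
      where d: "0 < d" "\<And>t. t \<in> D \<Longrightarrow> t \<noteq> x \<Longrightarrow> d \<le> dist x t" by blast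
    have cont: "isCont f t" if "0 < t" "t \<noteq> x" "dist x t < min d 1" for t
    proof -
      have "t \<notin> D" using d(2)[of t] that by auto
      moreover have "t \<le> x + 1" using that by (auto simp: dist_real_def)
      ultimately show ?thesis using that at_within_atLeast[of 0 t] by (simp add: D_def)
    qed
    have left: "\<exists>l. (f \<longlongrightarrow> l) (at_left t)" if "0 < t" for t
      using f that by (auto simp: piecewise_continuous_def)
    have right: "\<exists>l. (f \<longlongrightarrow> l) (at_right t)" if "0 \<le> t" for t
      using f that by (auto simp: piecewise_continuous_def)
    have piece: "f integrable_on {u..v}"
      if "0 \<le> u" "u \<le> v" "v - u < min d 1" "u = x \<or> v = x" for u v
    proof (cases "u = v")
      case True
      then show ?thesis using integrable_on_refl[of f u] by simp
    next
      case False
      then have "0 < v" using that by simp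
      then obtain l m where "(f \<longlongrightarrow> l) (at_right u)" "(f \<longlongrightarrow> m) (at_left v)"
        using left[of v] right[of u] \<open>0 \<le> u\<close> by blast
      moreover have "isCont f t" if "u < t" "t < v" for t
        using \<open>0 \<le> u\<close> \<open>v - u < min d 1\<close> \<open>u = x \<or> v = x\<close> that
        by (intro cont) (auto simp: dist_real_def)
      ultimately show ?thesis using False \<open>u \<le> v\<close> by (intro integrable_on_Icc_limits) auto
    qed
    show ?case
    proof (intro exI[of _ "min d 1"] conjI allI impI)
      fix u v assume uv: "u \<le> x \<and> x \<le> v \<and> v - u < min d 1"
      show "I u v" unfolding I_def
      proof
        assume "0 \<le> u \<and> u \<le> v"
        then show "f integrable_on {u..v}"
          using uv x by (intro Henstock_Kurzweil_Integration.integrable_combine[of u x v f] piece) auto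
      qed
    qed (use d in auto)
  qed
  then show ?thesis using True \<open>0 \<le> a\<close> by (simp add: I_def)
qed

lemma integral_from_0:
  fixes f :: "real \<Rightarrow> 'a::banach"
  assumes "piecewise_continuous f" "0 \<le> t" "t \<le> u"
  shows "integral {t..u} f = integral {0..u} f - integral {0..t} f"
  using Henstock_Kurzweil_Integration.integral_combine[OF assms(2,3) piecewise_continuous_integrable[OF assms(1) order.refl]]
  by (simp add: algebra_simps)

lemma continuous_on_indefinite_integral:
  fixes f :: "real \<Rightarrow> 'a::banach"
  assumes "piecewise_continuous f"
  shows "continuous_on {0..} (\<lambda>t. integral {0..t} f)"
  unfolding continuous_on_eq_continuous_within
proof
  fix t :: real assume "t \<in> {0..}"
  then show "continuous (at t within {0..}) (\<lambda>t. integral {0..t} f)"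
    using indefinite_integral_continuous_1[OF piecewise_continuous_integrable[OF assms order.refl], of "t + 1"]
    by (simp add: continuous_on_eq_continuous_within at_within_atLeast_Icc)
qed

lemma indefinite_integral_derivative:
  fixes f :: "real \<Rightarrow> 'a::banach"
  assumes "piecewise_continuous f" "0 \<le> t" "continuous (at t within {0..}) f"
  shows "((\<lambda>t. integral {0..t} f) has_vector_derivative f t) (at t within {0..})"
  using integral_has_vector_derivative_continuous_at
    [OF piecewise_continuous_integrable[OF assms(1) order.refl], of t "t + 1" "{}"] assms(2,3)
  by (simp add: at_within_atLeast_Icc)

lemma constant_finite_exceptions:
  fixes f :: "real \<Rightarrow> 'a::banach"
  assumes "finite S" "a \<le> b" "continuous_on {a..b} f"
    and "\<And>t. t \<in> {a<..<b} - S \<Longrightarrow> (f has_vector_derivative 0) (at t)"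
  shows "f b = f a"
  using fundamental_theorem_of_calculus_interior_strong[OF assms(1,2,4,3)]
  by (simp add: has_integral_0_eq)

text \<open>The increment is the integral of a nonnegative function, so that nothing has to be split
  at the exceptional points. The differential inequalities below are reduced to this form.\<close>

lemma nondecreasing_finite_exceptions:
  fixes f :: "real \<Rightarrow> real"
  assumes "finite S" "a \<le> b" "continuous_on {a..b} f"
    and deriv: "\<And>t. t \<in> {a<..<b} - S \<Longrightarrow> \<exists>d\<ge>0. (f has_vector_derivative d) (at t)"
  shows "f a \<le> f b"
proof -
  \<comment> \<open>The value 0 at the ends and exceptional points makes the integrand nonnegative
    everywhere.\<close>
  define f' where "f' t = (if t \<in> {a<..<b} - S then vector_derivative f (at t) else 0)" for t
  have *: "(f has_vector_derivative f' t) (at t)" "0 \<le> f' t" if "t \<in> {a<..<b} - S" for t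
    using deriv[OF that] that by (auto simp: f'_def vector_derivative_at)
  have "(f' has_integral (f b - f a)) {a..b}"
    by (rule fundamental_theorem_of_calculus_interior_strong[OF assms(1,2) _ assms(3)]) (rule *(1))
  moreover have "0 \<le> f' t" for t using *(2)[of t] by (cases "t \<in> {a<..<b} - S") (auto simp: f'_def)
  ultimately have "0 \<le> f b - f a" by (rule has_integral_nonneg)
  then show ?thesis by simp
qed

section \<open>Linear differential equations\<close>

lemma exp_has_integral:
  fixes c :: real
  assumes "c \<noteq> 0" "a \<le> b"
  shows "((\<lambda>s. exp (c * s)) has_integral (exp (c * b) - exp (c * a)) / c) {a..b}"
proof -
  have "((\<lambda>s. exp (c * s)) has_integral (exp (c * b) / c - exp (c * a) / c)) {a..b}"
    using assms
    by (intro fundamental_theorem_of_calculus)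
      (auto intro!: derivative_eq_intros simp: has_real_derivative_iff_has_vector_derivative[symmetric])
  then show ?thesis by (simp add: diff_divide_distrib)
qed

text \<open>The Picard operator is a contraction for the weighted supremum norm
  \<open>sup exp (- c t) |y t|\<close> on the whole half-line; the weight is absorbed into the unknown.\<close>

lemma linear_ode_exists:
  fixes p :: "'a::real_normed_vector \<Rightarrow> 'b::banach \<Rightarrow> 'b"
  assumes p: "bounded_bilinear p"
    and m: "piecewise_continuous m" and m_bound: "\<And>t. 0 \<le> t \<Longrightarrow> norm (m t) \<le> M"
  obtains y where "y 0 = y0" "continuous_on {0..} y"
    "\<And>t. 0 \<le> t \<Longrightarrow> continuous (at t within {0..}) m \<Longrightarrow>
      (y has_vector_derivative p (m t) (y t)) (at t within {0..})"
proof -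
  interpret p: bounded_bilinear p by (rule p)
  obtain K where K: "0 < K" "\<And>a b. norm (p a b) \<le> norm a * norm b * K"
    using p.pos_bounded by blast
  \<comment> \<open>\<open>M * K\<close> bounds the operator norm of \<open>p (m t)\<close>; the
    added 1 keeps the rate positive.\<close>
  define B where "B = M * K + 1"
  have "0 \<le> M" using m_bound[of 0] norm_ge_zero[of "m 0"] by linarith
  then have B: "0 < B" using K(1) by (simp add: B_def add_nonneg_pos)
  have p_bound: "norm (p (m t) x) \<le> B * norm x" if "0 \<le> t" for t x
  proof -
    have "norm (p (m t) x) \<le> norm (m t) * norm x * K" by (rule K(2))
    also have "\<dots> \<le> M * norm x * K"
      using m_bound[OF that] K(1) by (intro mult_right_mono) auto
    also have "\<dots> \<le> B * norm x" by (simp add: B_def algebra_simps)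
    finally show ?thesis .
  qed
  \<comment> \<open>The integral of \<open>B * exp (c * s)\<close> over \<open>{0..t}\<close> is at
    most \<open>B / c\<close> times \<open>exp (c * t)\<close>, so that twice \<open>B\<close> gives
    the contraction factor 1/2.\<close>
  define c where "c = 2 * B"
  have c: "0 < c" using B by (simp add: c_def)
  define f where "f z s = exp (c * s) *\<^sub>R p (m s) (z s)" for z s
  define G where "G z t = exp (- c * t) *\<^sub>R integral {0..t} (f z)" for z t
  have f_pc: "piecewise_continuous (f z)" if "continuous_on {0..} z" for z
    unfolding f_def
    by (intro piecewise_continuous_bilinear[OF bounded_bilinear_scaleR] piecewise_continuous_bilinear[OF p]
        m piecewise_continuous_on that continuous_intros)
  have f_int: "f z integrable_on {0..t}" if "continuous_on {0..} z" for z t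
    by (rule piecewise_continuous_integrable[OF f_pc[OF that] order.refl])
  have G_cont: "continuous_on {0..} (G z)" if "continuous_on {0..} z" for z
    unfolding G_def by (intro continuous_intros continuous_on_indefinite_integral f_pc that)
  have G_bound: "norm (G z t) \<le> D / 2"
    if "continuous_on {0..} z" "\<And>s. norm (z s) \<le> D" "0 \<le> t" for z t D
  proof -
    have D: "0 \<le> D" using that(2)[of 0] norm_ge_zero[of "z 0"] by linarith
    have "norm (integral {0..t} (f z)) \<le> integral {0..t} (\<lambda>s. B * D * exp (c * s))"
    proof (rule integral_norm_bound_integral[OF f_int[OF that(1)]])
      show "(\<lambda>s. B * D * exp (c * s)) integrable_on {0..t}"
        by (intro integrable_continuous_interval continuous_intros)
      fix s assume "s \<in> {0..t}"
      then have "norm (p (m s) (z s)) \<le> B * D"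
        using order_trans[OF p_bound mult_left_mono[OF that(2)]] B by simp
      then show "norm (f z s) \<le> B * D * exp (c * s)" by (simp add: f_def mult.commute)
    qed
    also have "\<dots> = B * D * ((exp (c * t) - 1) / c)"
      using integral_unique[OF exp_has_integral[of c 0 t]] c that(3) by simp
    also have "\<dots> \<le> D / 2 * exp (c * t)"
    proof -
      have "B * D * ((exp (c * t) - 1) / c) = D / 2 * (exp (c * t) - 1)"
        using B by (simp add: c_def)
      also have "\<dots> \<le> D / 2 * exp (c * t)" using D by (intro mult_left_mono) auto
      finally show ?thesis .
    qed
    finally have "exp (- c * t) * norm (integral {0..t} (f z)) \<le> exp (- c * t) * (D / 2 * exp (c * t))"
      by (intro mult_left_mono) auto
    also have "\<dots> = D / 2" by (simp add: exp_minus field_simps)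
    finally show ?thesis by (simp add: G_def)
  qed
  \<comment> \<open>Bounded continuous functions live on the whole real line here;
    \<open>max 0 t\<close> freezes the operator at negative times.\<close>
  define H where "H z t = exp (- c * max 0 t) *\<^sub>R y0 + G z (max 0 t)" for z t
  have H_bcont: "H (apply_bcontfun z) \<in> bcontfun" for z :: "real \<Rightarrow>\<^sub>C 'b"
  proof (rule bcontfun_normI)
    have z: "continuous_on {0..} (apply_bcontfun z)" by simp
    show "continuous_on UNIV (H (apply_bcontfun z))"
      unfolding H_def
      by (intro continuous_intros continuous_on_compose2[OF G_cont[OF z]]) auto
    fix t
    have "norm (H (apply_bcontfun z) t) \<le> norm (exp (- c * max 0 t) *\<^sub>R y0) + norm (G z (max 0 t))"
      unfolding H_def by (rule norm_triangle_ineq)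
    also have "\<dots> \<le> norm y0 + norm z / 2"
    proof (rule add_mono)
      have "exp (- c * max 0 t) \<le> 1" using c by simp
      then show "norm (exp (- c * max 0 t) *\<^sub>R y0) \<le> norm y0"
        by (simp add: mult_left_le_one_le)
      show "norm (G z (max 0 t)) \<le> norm z / 2"
        by (rule G_bound[OF z norm_bounded]) simp
    qed
    finally show "norm (H (apply_bcontfun z) t) \<le> norm y0 + norm z / 2" .
  qed
  define \<Phi> where "\<Phi> z = Bcontfun (H (apply_bcontfun z))" for z :: "real \<Rightarrow>\<^sub>C 'b"
  have \<Phi>: "apply_bcontfun (\<Phi> z) = H (apply_bcontfun z)" for z
    unfolding \<Phi>_def by (rule Bcontfun_inverse[OF H_bcont])
  have "\<exists>!z. \<Phi> z = z"
  proof (rule banach_fix_type[of "1/2"])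
    show "\<forall>z w. dist (\<Phi> z) (\<Phi> w) \<le> 1 / 2 * dist z w"
    proof (intro allI dist_bound)
      fix z w :: "real \<Rightarrow>\<^sub>C 'b" and t
      have z: "continuous_on {0..} (apply_bcontfun z)" "continuous_on {0..} (apply_bcontfun w)" by simp_all
      have f_diff: "f (\<lambda>s. z s - w s) s = f z s - f w s" for s
        by (simp add: f_def p.diff_right scaleR_diff_right)
      have "G (\<lambda>s. z s - w s) s = G z s - G w s" for s
        unfolding G_def f_diff by (simp add: integral_diff f_int z scaleR_diff_right)
      then have "dist (\<Phi> z t) (\<Phi> w t) = norm (G (\<lambda>s. z s - w s) (max 0 t))"
        by (simp add: \<Phi> H_def dist_norm)
      also have "\<dots> \<le> dist z w / 2"
        by (rule G_bound) (use dist_bounded[of z _ w] in \<open>auto simp: dist_norm intro!: continuous_intros\<close>)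
      finally show "dist (\<Phi> z t) (\<Phi> w t) \<le> 1 / 2 * dist z w" by simp
    qed
  qed simp_all
  then obtain z where z: "\<Phi> z = z" by blast
  have z_cont: "continuous_on {0..} (apply_bcontfun z)" by simp
  define y where "y t = exp (c * t) *\<^sub>R z t" for t
  have y_cont: "continuous_on {0..} y" unfolding y_def by (intro continuous_intros z_cont)
  have f_y: "f z = (\<lambda>s. p (m s) (y s))" by (rule ext) (simp add: f_def y_def p.scaleR_right)
  have y_eq: "y t = y0 + integral {0..t} (f z)" if "0 \<le> t" for t
  proof -
    have "z t = exp (- c * t) *\<^sub>R y0 + exp (- c * t) *\<^sub>R integral {0..t} (f z)"
      using fun_cong[OF \<Phi>[of z], of t] that by (simp add: z H_def G_def)
    then show ?thesis by (simp add: y_def scaleR_add_right exp_add[symmetric])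
  qed
  show ?thesis
  proof
    show "y 0 = y0" using y_eq[of 0] by simp
    show "continuous_on {0..} y" by (rule y_cont)
    fix t :: real assume t: "0 \<le> t" "continuous (at t within {0..}) m"
    have "continuous (at t within {0..}) (f z)"
      unfolding f_y using t y_cont
      by (intro p.continuous) (auto simp: continuous_on_eq_continuous_within)
    then have "((\<lambda>t. y0 + integral {0..t} (f z)) has_vector_derivative f z t) (at t within {0..})"
      using indefinite_integral_derivative[OF f_pc[OF z_cont] t(1)]
      by (auto intro!: derivative_eq_intros)
    then show "(y has_vector_derivative p (m t) (y t)) (at t within {0..})"
      unfolding f_y by (rule has_vector_derivative_transform[rotated 2]) (use t y_eq f_y in auto)
  qed
qed

text \<open>The inverse is obtained from an equation of its own, \<open>V' = - V L\<close>: the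
  derivative of the product \<open>V U\<close> is then 0 off a finite set, and the product stays at
  its initial value.\<close>

lemma fundamental_solution_exists:
  fixes L :: "real \<Rightarrow> 'e::euclidean_space \<Rightarrow>\<^sub>L 'e"
  assumes L: "piecewise_continuous L" "\<And>t. 0 \<le> t \<Longrightarrow> norm (L t) \<le> M"
  obtains U V where "continuous_on {0..} U" "continuous_on {0..} V"
    "\<And>t. 0 \<le> t \<Longrightarrow> continuous (at t within {0..}) L \<Longrightarrow>
      (U has_vector_derivative L t o\<^sub>L U t) (at t within {0..})"
    "\<And>t. 0 \<le> t \<Longrightarrow> continuous (at t within {0..}) L \<Longrightarrow>
      (V has_vector_derivative - (V t o\<^sub>L L t)) (at t within {0..})"
    "\<And>t x. 0 \<le> t \<Longrightarrow> V t (U t x) = x" "\<And>t x. 0 \<le> t \<Longrightarrow> U t (V t x) = x"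
    "U 0 = id_blinfun" "V 0 = id_blinfun"
proof -
  have c1: "bounded_bilinear ((o\<^sub>L) :: ('e \<Rightarrow>\<^sub>L 'e) \<Rightarrow> ('e \<Rightarrow>\<^sub>L 'e) \<Rightarrow> ('e \<Rightarrow>\<^sub>L 'e))"
    by (rule bounded_bilinear_blinfun_compose)
  have c2: "bounded_bilinear (\<lambda>m y :: 'e \<Rightarrow>\<^sub>L 'e. - (y o\<^sub>L m) :: 'e \<Rightarrow>\<^sub>L 'e)"
    using bounded_bilinear.comp1[OF bounded_bilinear.flip[OF c1], of uminus]
      bounded_bilinear.minus_left[OF bounded_bilinear.flip[OF c1]]
    by (simp add: bounded_linear_minus bounded_linear_ident
        bounded_bilinear.minus_right[OF c1])
  obtain U where U: "U 0 = id_blinfun" "continuous_on {0..} U"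
    "\<And>t. 0 \<le> t \<Longrightarrow> continuous (at t within {0..}) L \<Longrightarrow>
      (U has_vector_derivative L t o\<^sub>L U t) (at t within {0..})"
    using linear_ode_exists[OF c1 L] by metis
  obtain V where V: "V 0 = id_blinfun" "continuous_on {0..} V"
    "\<And>t. 0 \<le> t \<Longrightarrow> continuous (at t within {0..}) L \<Longrightarrow>
      (V has_vector_derivative - (V t o\<^sub>L L t)) (at t within {0..})"
    using linear_ode_exists[OF c2 L] by metis
  have VU: "V t o\<^sub>L U t = id_blinfun" if t: "0 \<le> t" for t
  proof -
    have "V t o\<^sub>L U t = V 0 o\<^sub>L U 0"
    proof (rule constant_finite_exceptions[OF _ t])
      show "finite {s \<in> {0..t}. \<not> continuous (at s within {0..}) L}"
        using L(1) by (auto simp: piecewise_continuous_def)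
      show "continuous_on {0..t} (\<lambda>s. V s o\<^sub>L U s)"
        by (intro bounded_bilinear.continuous_on[OF c1] continuous_on_subset[OF U(2)]
            continuous_on_subset[OF V(2)]) auto
      fix s assume "s \<in> {0<..<t} - {s \<in> {0..t}. \<not> continuous (at s within {0..}) L}"
      then have s: "0 < s" "continuous (at s within {0..}) L" by auto
      have "((\<lambda>s. V s o\<^sub>L U s) has_vector_derivative (V s o\<^sub>L (L s o\<^sub>L U s)) + ((- (V s o\<^sub>L L s)) o\<^sub>L U s)) (at s within {0..})"
        using s by (intro bounded_bilinear.has_vector_derivative[OF c1] U(3) V(3)) auto
      moreover have "(V s o\<^sub>L (L s o\<^sub>L U s)) + ((- (V s o\<^sub>L L s)) o\<^sub>L U s) = 0"
        by (rule blinfun_eqI) (simp add: blinfun.bilinear_simps)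
      ultimately show "((\<lambda>s. V s o\<^sub>L U s) has_vector_derivative 0) (at s)"
        using s by (simp add: at_within_atLeast)
    qed
    also have "\<dots> = id_blinfun" by (rule blinfun_eqI) (simp add: U(1) V(1))
    finally show ?thesis .
  qed
  have VU': "V t (U t x) = x" if "0 \<le> t" for t x
    using arg_cong[OF VU[OF that], of "\<lambda>f. f x"] by simp
  \<comment> \<open>In this order the product has derivative \<open>L U V - U V L\<close>, which is
    not visibly 0. Instead \<open>U t\<close> is injective by the first identity, hence surjective
    in finite dimension.\<close>
  have UV': "U t (V t x) = x" if "0 \<le> t" for t x
  proof -
    have "inj (blinfun_apply (U t))" using VU'[OF that] by (metis injI)
    then have "surj (blinfun_apply (U t))"
      using linear_injective_imp_surjective[OF bounded_linear.linear[OF blinfun.bounded_linear_right]] by blast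
    then obtain y where "x = U t y" by blast
    then show ?thesis using VU'[OF that] by simp
  qed
  show ?thesis using that[OF U(2) V(2) U(3) V(3) VU' UV' U(1) V(1)] .
qed


section \<open>The flow and jump operators\<close>

lemma bounded_bilinear_matrix_mult:
  "bounded_bilinear ((**) :: real^'k^'m \<Rightarrow> real^'n^'k \<Rightarrow> real^'n^'m)"
  unfolding bilinear_conv_bounded_bilinear[symmetric] bilinear_def
  by (auto intro!: linearI simp: vec_eq_iff matrix_matrix_mult_def sum.distrib sum_distrib_left algebra_simps)

lemma bounded_bilinear_matrix_vector_mult:
  "bounded_bilinear ((*v) :: real^'n^'m \<Rightarrow> real^'n \<Rightarrow> real^'m)"
  unfolding bilinear_conv_bounded_bilinear[symmetric] bilinear_def
  by (auto intro!: linearI simp: vec_eq_iff matrix_vector_mult_def sum.distrib sum_distrib_left algebra_simps)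

lemma bounded_linear_transpose: "bounded_linear (transpose :: real^'n^'m \<Rightarrow> real^'m^'n)"
  using linear_transpose by (simp add: linear_conv_bounded_linear)

lemma bounded_bilinear_image:
  assumes "bounded_bilinear p" "bounded (f ` S)" "bounded (g ` S)"
  shows "bounded ((\<lambda>t. p (f t) (g t)) ` S)"
proof -
  interpret bounded_bilinear p by fact
  obtain K where K: "0 < K" "\<And>a b. norm (p a b) \<le> norm a * norm b * K"
    using pos_bounded by blast
  obtain a b where ab: "\<And>t. t \<in> S \<Longrightarrow> norm (f t) \<le> a" "\<And>t. t \<in> S \<Longrightarrow> norm (g t) \<le> b"
    using assms(2,3) by (auto simp: bounded_iff)
  have "norm (p (f t) (g t)) \<le> a * b * K" if "t \<in> S" for t
  proof -
    have "0 \<le> a" using order_trans[OF norm_ge_zero ab(1)[OF that]] .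
    then have "norm (f t) * norm (g t) * K \<le> a * b * K"
      using ab that K(1) by (intro mult_right_mono mult_mono) auto
    then show ?thesis using K(2) order_trans by blast
  qed
  then show ?thesis by (auto simp: bounded_iff)
qed

lemma bounded_linear_image_comp:
  "bounded_linear h \<Longrightarrow> bounded (f ` S) \<Longrightarrow> bounded ((\<lambda>t. h (f t)) ` S)"
  using bounded_linear_image[of "f ` S" h] by (simp add: image_image)

lemma bounded_sum_image:
  fixes f :: "'i \<Rightarrow> 'a \<Rightarrow> 'b::real_normed_vector"
  assumes "finite I" "\<And>i. i \<in> I \<Longrightarrow> bounded (f i ` S)"
  shows "bounded ((\<lambda>t. \<Sum>i\<in>I. f i t) ` S)"
  using assms
proof (induction I)
  case empty
  then show ?case by (simp add: image_constant_conv)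
next
  case (insert i I)
  then show ?case using bounded_plus_comp[of "f i" S "\<lambda>t. \<Sum>i\<in>I. f i t"] by simp
qed

definition mult_left :: "real^'n^'n \<Rightarrow> (real^'n^'n) \<Rightarrow>\<^sub>L (real^'n^'n)" where
  "mult_left = bounded_bilinear.prod_right (**)"

definition mult_right :: "real^'n^'n \<Rightarrow> (real^'n^'n) \<Rightarrow>\<^sub>L (real^'n^'n)" where
  "mult_right = bounded_bilinear.prod_left (**)"

lemma mult_left_apply [simp]: "mult_left B X = B ** X"
  unfolding mult_left_def by (simp add: bounded_bilinear.prod_right.rep_eq[OF bounded_bilinear_matrix_mult])

lemma mult_right_apply [simp]: "mult_right B X = X ** B"
  unfolding mult_right_def by (simp add: bounded_bilinear.prod_left.rep_eq[OF bounded_bilinear_matrix_mult])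

lemma bounded_linear_mult_left: "bounded_linear mult_left"
  unfolding mult_left_def by (rule bounded_bilinear.bounded_linear_prod_right[OF bounded_bilinear_matrix_mult])

lemma bounded_linear_mult_right: "bounded_linear mult_right"
  unfolding mult_right_def by (rule bounded_bilinear.bounded_linear_prod_left[OF bounded_bilinear_matrix_mult])

text \<open>The map \<open>flow_op\<close> as a point of the Banach space of bounded linear maps:
  the fundamental solution is a curve in that space, and continuity and boundedness of the
  coefficients carry over by structural rules.\<close>

definition flow_blinfun ::
    "nat \<Rightarrow> (nat \<Rightarrow> real \<Rightarrow> real^'n^'n) \<Rightarrow> (real \<Rightarrow> real) \<Rightarrow> real \<Rightarrow> (real^'n^'n) \<Rightarrow>\<^sub>L (real^'n^'n)" where
  "flow_blinfun N A \<mu> t = mult_left (A 0 t) + mult_right (transpose (A 0 t)) +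
     (\<Sum>i=1..N. mult_left (A i t) o\<^sub>L mult_right (transpose (A i t))) + \<mu> t *\<^sub>R id_blinfun"

definition jump_blinfun ::
    "nat \<Rightarrow> (nat \<Rightarrow> nat \<Rightarrow> real^'n^'n) \<Rightarrow> nat \<Rightarrow> (real^'n^'n) \<Rightarrow>\<^sub>L (real^'n^'n)" where
  "jump_blinfun N J k = (\<Sum>i=0..N. mult_left (J i k) o\<^sub>L mult_right (transpose (J i k)))"

lemma flow_blinfun_apply [simp]: "flow_blinfun N A \<mu> t X = flow_op N A \<mu> t X"
  by (simp add: flow_blinfun_def flow_op_def blinfun.add_left blinfun.scaleR_left blinfun.sum_left
      matrix_mul_assoc)

lemma jump_blinfun_apply [simp]: "jump_blinfun N J k X = jump_op N J k X"
  by (simp add: jump_blinfun_def jump_op_def blinfun.sum_left matrix_mul_assoc)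

lemma inner_congruence: "(B ** X ** C) \<bullet> P = X \<bullet> (transpose B ** P ** transpose C)"
  for B X C P :: "real^'n^'n"
proof -
  have "(B ** X ** C) \<bullet> P = (B ** X) \<bullet> (P ** transpose C)" by (rule inner_matrix_mult_right)
  also have "\<dots> = X \<bullet> (transpose B ** (P ** transpose C))" by (rule inner_matrix_mult_left)
  finally show ?thesis by (simp only: matrix_mul_assoc)
qed

text \<open>Along a solution the derivative of \<open>P \<bullet> X\<close> is therefore the inner
  product of \<open>X\<close> with the derivative of \<open>P\<close> plus
  \<open>flow_adj P\<close>; this is how the Lyapunov conditions enter.\<close>

lemma inner_flow_op: "flow_op N A \<mu> t X \<bullet> P = X \<bullet> flow_adj N A \<mu> t P"
  by (simp add: flow_op_def flow_adj_def inner_add_left inner_add_right inner_sum_left inner_sum_right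
      inner_congruence inner_matrix_mult_left[of "A 0 t" X] inner_matrix_mult_right[of X "transpose (A 0 t)"])

lemma inner_jump_op: "jump_op N J k X \<bullet> P = X \<bullet> jump_adj N J k P"
  by (simp add: jump_op_def jump_adj_def inner_sum_left inner_sum_right inner_congruence)

lemma transpose_flow_op: "transpose (flow_op N A \<mu> t X) = flow_op N A \<mu> t (transpose X)"
  by (simp add: flow_op_def transpose_add transpose_sum matrix_transpose_mul matrix_mul_assoc transpose_scalar)

lemma transpose_jump_op: "transpose (jump_op N J k X) = jump_op N J k (transpose X)"
  by (simp add: jump_op_def transpose_sum matrix_transpose_mul matrix_mul_assoc)

lemma quadratic_congruence:
  "x \<bullet> ((B ** X ** transpose B) *v x) = (transpose B *v x) \<bullet> (X *v (transpose B *v x))"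
  for B X :: "real^'n^'n"
proof -
  have "x \<bullet> (B *v y) = (transpose B *v x) \<bullet> y" for y
    using dot_lmul_matrix[of x B y] transpose_matrix_vector[of B x] by simp
  then show ?thesis by (simp add: matrix_vector_mul_assoc[symmetric] del: transpose_matrix_vector)
qed

lemma quadratic_sum: "x \<bullet> ((\<Sum>i\<in>I. f i) *v x) = (\<Sum>i\<in>I. x \<bullet> (f i *v x))" for f :: "'i \<Rightarrow> real^'n^'n"
  by (simp add: inner_rank_one[symmetric] inner_sum_left)

lemma jump_op_psd:
  assumes "pos_semidefinite X"
  shows "pos_semidefinite (jump_op N J k X)"
  using assms transpose_jump_op[of N J k X]
  by (auto simp: pos_semidefinite_def symmetric_matrix_def quadratic_sum jump_op_def quadratic_congruence
      simp del: transpose_matrix_vector intro!: sum_nonneg)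

text \<open>The terms \<open>A i X (A i)^T\<close> with \<open>i \<ge> 1\<close> only add
  nonnegative amounts. What remains contains the factor \<open>X *v x\<close> and so vanishes at a
  null vector of \<open>X\<close>, which is the reason why the flow cannot leave the cone.\<close>

lemma quadratic_flow_op_ge:
  assumes "pos_semidefinite X"
  shows "2 * (x \<bullet> (A 0 t *v (X *v x))) + \<mu> t * (x \<bullet> (X *v x)) \<le> x \<bullet> (flow_op N A \<mu> t X *v x)"
proof -
  have "x \<bullet> ((X ** transpose (A 0 t)) *v x) = (X *v x) \<bullet> (transpose (A 0 t) *v x)"
    using inner_symmetric_matrix[OF psdD(1)[OF assms]] by (simp add: matrix_vector_mul_assoc[symmetric])
  also have "\<dots> = x \<bullet> (A 0 t *v (X *v x))"
    using dot_lmul_matrix[of x "A 0 t"] by (simp add: inner_commute)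
  finally have *: "x \<bullet> ((X ** transpose (A 0 t)) *v x) = x \<bullet> (A 0 t *v (X *v x))" .
  have "0 \<le> (\<Sum>i=1..N. x \<bullet> ((A i t ** X ** transpose (A i t)) *v x))"
    using psdD(2)[OF assms] by (intro sum_nonneg) (simp add: quadratic_congruence del: transpose_matrix_vector)
  then show ?thesis
    unfolding flow_op_def quadratic_add quadratic_sum quadratic_scaleR *
    by (simp add: matrix_vector_mul_assoc[symmetric])
qed

section \<open>Fundamental solution of the flow between impulses\<close>

locale linear_flow =
  fixes N :: nat and A :: "nat \<Rightarrow> real \<Rightarrow> real^'n^'n" and \<mu> :: "real \<Rightarrow> real"
  assumes A_pc: "\<forall>i\<le>N. piecewise_continuous (A i)"
    and A_bdd: "\<forall>i\<le>N. bounded (A i ` {0..})"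
    and mu_pc: "piecewise_continuous \<mu>"
    and mu_bdd: "bounded (\<mu> ` {0..})"
begin

abbreviation "L \<equiv> flow_blinfun N A \<mu>"

lemma L_pc: "piecewise_continuous L"
  unfolding flow_blinfun_def
  by (intro piecewise_continuous_add piecewise_continuous_sum
      piecewise_continuous_bilinear[OF bounded_bilinear_blinfun_compose]
      piecewise_continuous_bilinear[OF bounded_bilinear_scaleR]
      piecewise_continuous_linear[OF bounded_linear_mult_left]
      piecewise_continuous_linear[OF bounded_linear_mult_right]
      piecewise_continuous_linear[OF bounded_linear_transpose] mu_pc)
    (use A_pc in \<open>auto simp: piecewise_continuous_on\<close>)

lemma L_continuous:
  assumes "t \<in> continuity_times N A \<mu>"
  shows "continuous (at t within {0..}) L"
  unfolding flow_blinfun_def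
  by (intro continuous_add continuous_sum continuous_const
      bounded_bilinear.continuous[OF bounded_bilinear_blinfun_compose]
      bounded_bilinear.continuous[OF bounded_bilinear_scaleR]
      bounded_linear.continuous[OF bounded_linear_mult_left]
      bounded_linear.continuous[OF bounded_linear_mult_right]
      bounded_linear.continuous[OF bounded_linear_transpose])
    (use assms in \<open>auto simp: continuity_times_def\<close>)

lemma L_bounded: obtains M where "0 < M" "\<And>t. 0 \<le> t \<Longrightarrow> norm (L t) \<le> M"
proof -
  have "bounded (L ` {0..})"
    unfolding flow_blinfun_def
    by (intro bounded_plus_comp bounded_sum_image
        bounded_bilinear_image[OF bounded_bilinear_blinfun_compose]
        bounded_bilinear_image[OF bounded_bilinear_scaleR]
        bounded_linear_image_comp[OF bounded_linear_mult_left]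
        bounded_linear_image_comp[OF bounded_linear_mult_right]
        bounded_linear_image_comp[OF bounded_linear_transpose] mu_bdd)
      (use A_bdd in \<open>auto simp: image_constant_conv\<close>)
  then obtain M where "\<And>t. 0 \<le> t \<Longrightarrow> norm (L t) \<le> M"
    unfolding bounded_iff by auto
  then show ?thesis
    using that[of "max M 1"] by (meson less_max_iff_disj max.coboundedI1 zero_less_one)
qed

lemma flow_op_bounded:
  obtains M where "0 < M" "\<And>t X. 0 \<le> t \<Longrightarrow> norm (flow_op N A \<mu> t X) \<le> M * norm X"
proof -
  obtain M where M: "0 < M" "\<And>t. 0 \<le> t \<Longrightarrow> norm (L t) \<le> M" using L_bounded by blast
  have "norm (flow_op N A \<mu> t X) \<le> M * norm X" if "0 \<le> t" for t X
    using norm_blinfun[of "L t" X] mult_right_mono[OF M(2)[OF that] norm_ge_zero[of X]] by simp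
  then show ?thesis using that M(1) by blast
qed

lemma finite_discontinuities:
  assumes "0 \<le> a"
  shows "finite ({a..b} - continuity_times N A \<mu>)"
proof -
  let ?D = "\<lambda>f. {t \<in> {a..b}. \<not> continuous (at t within {0..}) f}"
  have "finite ((\<Union>i\<in>{..N}. {t \<in> {a..b}. \<not> continuous (at t within {0..}) (A i)}) \<union>
      {t \<in> {a..b}. \<not> continuous (at t within {0..}) \<mu>})"
    using A_pc mu_pc assms unfolding piecewise_continuous_def by (intro finite_UnI finite_UN_I) auto
  then show ?thesis
    by (rule finite_subset[rotated]) (use assms in \<open>auto simp: continuity_times_def\<close>)
qed

definition fundamental_pair where
  "fundamental_pair U V \<longleftrightarrow> continuous_on {0..} U \<and> continuous_on {0..} V \<and>
    (\<forall>t\<in>continuity_times N A \<mu>. (U has_vector_derivative L t o\<^sub>L U t) (at t within {0..})) \<and>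
    (\<forall>t\<in>continuity_times N A \<mu>. (V has_vector_derivative - (V t o\<^sub>L L t)) (at t within {0..})) \<and>
    (\<forall>t\<ge>0. \<forall>X. blinfun_apply (V t) (blinfun_apply (U t) X) = X) \<and>
    (\<forall>t\<ge>0. \<forall>X. blinfun_apply (U t) (blinfun_apply (V t) X) = X) \<and>
    U 0 = id_blinfun \<and> V 0 = id_blinfun"

lemma fundamental_pair_exists: "\<exists>UV. fundamental_pair (fst UV) (snd UV)"
proof -
  obtain M where M: "\<And>t. 0 \<le> t \<Longrightarrow> norm (L t) \<le> M" using L_bounded by blast
  obtain U V where "continuous_on {0..} U" "continuous_on {0..} V"
    "\<And>t. 0 \<le> t \<Longrightarrow> continuous (at t within {0..}) L \<Longrightarrow>
      (U has_vector_derivative L t o\<^sub>L U t) (at t within {0..})"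
    "\<And>t. 0 \<le> t \<Longrightarrow> continuous (at t within {0..}) L \<Longrightarrow>
      (V has_vector_derivative - (V t o\<^sub>L L t)) (at t within {0..})"
    "\<And>t x. 0 \<le> t \<Longrightarrow> V t (U t x) = x" "\<And>t x. 0 \<le> t \<Longrightarrow> U t (V t x) = x"
    "U 0 = id_blinfun" "V 0 = id_blinfun"
    using fundamental_solution_exists[OF L_pc M] by (metis (no_types))
  then have "fundamental_pair U V"
    using L_continuous unfolding fundamental_pair_def by (auto simp: continuity_times_def)
  then show ?thesis by (intro exI[of _ "(U, V)"]) simp
qed

text \<open>Both components come from one choice of a pair, since \<open>U\<close> and
  \<open>V\<close> must be inverse to each other.\<close>

definition U where "U = fst (SOME UV. fundamental_pair (fst UV) (snd UV))"
definition V where "V = snd (SOME UV. fundamental_pair (fst UV) (snd UV))"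

lemma fundamental_pair_UV: "fundamental_pair U V"
  unfolding U_def V_def by (rule someI_ex[OF fundamental_pair_exists])

lemma
  shows U_cont: "continuous_on {0..} U" and V_cont: "continuous_on {0..} V"
    and U_deriv: "t \<in> continuity_times N A \<mu> \<Longrightarrow> (U has_vector_derivative L t o\<^sub>L U t) (at t within {0..})"
    and V_deriv: "t \<in> continuity_times N A \<mu> \<Longrightarrow> (V has_vector_derivative - (V t o\<^sub>L L t)) (at t within {0..})"
    and VU [simp]: "0 \<le> t \<Longrightarrow> blinfun_apply (V t) (blinfun_apply (U t) X) = X"
    and UV [simp]: "0 \<le> t \<Longrightarrow> blinfun_apply (U t) (blinfun_apply (V t) X) = X"
    and U_0 [simp]: "U 0 = id_blinfun" and V_0 [simp]: "V 0 = id_blinfun"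
  using fundamental_pair_UV unfolding fundamental_pair_def by auto

lemma U_apply_cont: "continuous_on {0..} (\<lambda>t. blinfun_apply (U t) X)"
  by (intro bounded_bilinear.continuous_on[OF bounded_bilinear_blinfun_apply] U_cont continuous_on_const)

lemma U_apply_deriv:
  assumes "t \<in> continuity_times N A \<mu>"
  shows "((\<lambda>t. blinfun_apply (U t) X) has_vector_derivative flow_op N A \<mu> t (blinfun_apply (U t) X)) (at t within {0..})"
  using bounded_bilinear.has_vector_derivative[OF bounded_bilinear_blinfun_apply U_deriv[OF assms]
      has_vector_derivative_const[of X]] by simp

section \<open>Uniqueness and positivity of the flow\<close>

definition flow_solution :: "real \<Rightarrow> real \<Rightarrow> (real \<Rightarrow> real^'n^'n) \<Rightarrow> bool" where
  "flow_solution a b X \<longleftrightarrow> 0 \<le> a \<and> a \<le> b \<and> continuous_on {a..b} X \<and>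
    (\<exists>S. finite S \<and> (\<forall>t\<in>{a<..<b} - S. (X has_vector_derivative flow_op N A \<mu> t (X t)) (at t)))"

text \<open>\<open>V t (X t)\<close> is constant: off a finite set the contribution of the
  derivative of \<open>V\<close> cancels that of \<open>X\<close>.\<close>

lemma flow_solution_unique:
  assumes "flow_solution a b X"
  shows "X b = blinfun_apply (U b) (blinfun_apply (V a) (X a))"
proof -
  obtain S where S: "0 \<le> a" "a \<le> b" "continuous_on {a..b} X" "finite S"
    "\<And>t. t \<in> {a<..<b} - S \<Longrightarrow> (X has_vector_derivative flow_op N A \<mu> t (X t)) (at t)"
    using assms by (auto simp: flow_solution_def)
  have "blinfun_apply (V b) (X b) = blinfun_apply (V a) (X a)"
  proof (rule constant_finite_exceptions[OF _ S(2)])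
    show "finite (S \<union> ({a..b} - continuity_times N A \<mu>))"
      using S(4) finite_discontinuities[OF S(1)] by simp
    show "continuous_on {a..b} (\<lambda>t. blinfun_apply (V t) (X t))"
      using S(1) by (intro bounded_bilinear.continuous_on[OF bounded_bilinear_blinfun_apply] S(3)
          continuous_on_subset[OF V_cont]) auto
    fix t assume "t \<in> {a<..<b} - (S \<union> ({a..b} - continuity_times N A \<mu>))"
    then have t: "0 < t" "t \<in> {a<..<b} - S" "t \<in> continuity_times N A \<mu>" using S(1) by auto
    have "((\<lambda>t. blinfun_apply (V t) (X t)) has_vector_derivative
        blinfun_apply (V t) (flow_op N A \<mu> t (X t)) + blinfun_apply (- (V t o\<^sub>L L t)) (X t)) (at t)"
      by (rule bounded_bilinear.has_vector_derivative[OF bounded_bilinear_blinfun_apply])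
        (use V_deriv[OF t(3)] S(5)[OF t(2)] t(1) in \<open>simp_all add: at_within_atLeast\<close>)
    then show "((\<lambda>t. blinfun_apply (V t) (X t)) has_vector_derivative 0) (at t)"
      by (simp add: blinfun.minus_left)
  qed
  then have "blinfun_apply (U b) (blinfun_apply (V b) (X b)) = blinfun_apply (U b) (blinfun_apply (V a) (X a))"
    by simp
  then show ?thesis using S(1,2) by simp
qed

lemma flow_solution_subinterval:
  assumes "flow_solution a b X" "a \<le> a'" "a' \<le> b'" "b' \<le> b"
  shows "flow_solution a' b' X"
  using assms unfolding flow_solution_def
  by (auto elim!: continuous_on_subset intro: exI)

lemma flow_solution_transpose:
  assumes "flow_solution a b X"
  shows "flow_solution a b (\<lambda>t. transpose (X t))"
proof -
  obtain S where S: "0 \<le> a" "a \<le> b" "continuous_on {a..b} X" "finite S"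
    "\<And>t. t \<in> {a<..<b} - S \<Longrightarrow> (X has_vector_derivative flow_op N A \<mu> t (X t)) (at t)"
    using assms by (auto simp: flow_solution_def)
  show ?thesis
    unfolding flow_solution_def
    using S bounded_linear.continuous_on[OF bounded_linear_transpose S(3)]
      bounded_linear.has_vector_derivative[OF bounded_linear_transpose S(5), unfolded transpose_flow_op]
    by blast
qed

text \<open>The transpose solves the same equation with the same initial value.\<close>

lemma flow_solution_symmetric:
  assumes "flow_solution a b X" "symmetric_matrix (X a)"
  shows "symmetric_matrix (X b)"
  using flow_solution_unique[OF flow_solution_transpose[OF assms(1)]] flow_solution_unique[OF assms(1)] assms(2)
  by (simp add: symmetric_matrix_def)

lemma flow_solution_UV:
  assumes "0 \<le> a" "a \<le> b"
  shows "flow_solution a b (\<lambda>t. blinfun_apply (U t) Y)"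
  unfolding flow_solution_def
proof (intro conjI exI[of _ "{a..b} - continuity_times N A \<mu>"] ballI)
  fix t assume "t \<in> {a<..<b} - ({a..b} - continuity_times N A \<mu>)"
  then show "((\<lambda>t. blinfun_apply (U t) Y) has_vector_derivative
      flow_op N A \<mu> t (blinfun_apply (U t) Y)) (at t)"
    using U_apply_deriv[of t Y] assms by (auto simp: at_within_atLeast)
qed (use assms finite_discontinuities in \<open>auto intro: continuous_on_subset[OF U_apply_cont]\<close>)

text \<open>With \<open>c\<close> large, \<open>Z t = X t + \<epsilon> exp (c t) I\<close> stays positive definite: at a first time \<open>t\<close> at
  which \<open>Z t\<close> has a unit null vector \<open>x\<close>, also \<open>Z t x = 0\<close>, so that shortly before \<open>t\<close> the indefinite part
  of the flow operator is dominated by \<open>\<epsilon>\<close> and the quadratic form at \<open>x\<close> increases.\<close>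

lemma flow_solution_perturbed_pos:
  assumes X: "flow_solution a b X" and psd: "pos_semidefinite (X a)"
    and \<epsilon>: "0 < \<epsilon>" and c: "0 < c" "\<And>t. 0 \<le> t \<Longrightarrow> norm (flow_op N A \<mu> t (mat 1)) + 1 \<le> c"
    and t: "t \<in> {a..b}" and x: "norm x = 1"
  shows "0 < x \<bullet> (X t *v x) + \<epsilon> * exp (c * t)"
proof (rule ccontr)
  assume neg: "\<not> 0 < x \<bullet> (X t *v x) + \<epsilon> * exp (c * t)"
  obtain S where S: "0 \<le> a" "a \<le> b" "continuous_on {a..b} X" "finite S"
    "\<And>t. t \<in> {a<..<b} - S \<Longrightarrow> (X has_vector_derivative flow_op N A \<mu> t (X t)) (at t)"
    using X by (auto simp: flow_solution_def)
  define Z where "Z t = X t + (\<epsilon> * exp (c * t)) *\<^sub>R mat 1" for t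
  have Z_quad: "y \<bullet> (Z t *v y) = y \<bullet> (X t *v y) + \<epsilon> * exp (c * t) * (norm y)\<^sup>2" for t y
    by (simp only: Z_def quadratic_add inner_scaled_identity)
  have Z_cont: "continuous_on {a..b} Z"
    unfolding Z_def by (intro continuous_intros S(3))
  have quad_cont: "continuous_on T (\<lambda>z. x z \<bullet> (Y z *v x z))"
    if "continuous_on T Y" "continuous_on T x" for T :: "'z::topological_space set" and x and Y :: "'z \<Rightarrow> real^'n^'n"
    by (intro continuous_on_inner bounded_bilinear.continuous_on[OF bounded_bilinear_matrix_vector_mult] that)
  \<comment> \<open>Pairs of a time and a unit vector at which the form of \<open>Z\<close> is not
    positive. Compactness provides an earliest such time.\<close>
  define B where "B = ({a..b} \<times> sphere 0 1) \<inter> {z \<in> {a..b} \<times> sphere 0 1. snd z \<bullet> (Z (fst z) *v snd z) \<le> 0}"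
  have "compact ({a..b} \<times> sphere (0 :: real^'n) 1)" by (intro compact_Times compact_Icc compact_sphere)
  moreover have "continuous_on ({a..b} \<times> sphere (0 :: real^'n) 1) (\<lambda>z. snd z \<bullet> (Z (fst z) *v snd z))"
    by (intro quad_cont continuous_on_compose2[OF Z_cont] continuous_on_fst continuous_on_snd continuous_on_id) auto
  ultimately have "closed {z \<in> {a..b} \<times> sphere (0 :: real^'n) 1. snd z \<bullet> (Z (fst z) *v snd z) \<le> 0}"
    by (intro continuous_on_closed_Collect_le continuous_on_const compact_imp_closed)
  then have "compact B" unfolding B_def by (intro compact_Int_closed compact_Times compact_Icc compact_sphere)
  moreover have "(t, x) \<in> B" using neg t x by (auto simp: B_def Z_quad)
  ultimately obtain z where z: "z \<in> B" "\<And>w. w \<in> B \<Longrightarrow> fst z \<le> fst w"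
    using continuous_attains_inf[of B fst] continuous_on_fst[OF continuous_on_id, of B] by blast
  define r y where "r = fst z" and "y = snd z"
  have r: "r \<in> {a..b}" and y: "norm y = 1" and ry: "y \<bullet> (Z r *v y) \<le> 0"
    using z(1) by (auto simp: B_def r_def y_def)
  have X_sym: "symmetric_matrix (X s)" if "s \<in> {a..b}" for s
    using flow_solution_symmetric[OF flow_solution_subinterval[OF X order.refl] psdD(1)[OF psd], of s] that by simp
  have Z_sym: "symmetric_matrix (Z s)" if "s \<in> {a..b}" for s
    unfolding Z_def by (intro symmetric_add symmetric_scaleR symmetric_mat X_sym that)
  have pos: "0 < w \<bullet> (Z s *v w)" if "s \<in> {a..<r}" "norm w = 1" for s w
    using z(2)[of "(s, w)"] that r by (force simp: B_def r_def[symmetric])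
  have psd_before: "pos_semidefinite (Z s)" if "s \<in> {a..<r}" for s
    unfolding pos_semidefinite_def
  proof (intro conjI allI)
    show "symmetric_matrix (Z s)" using Z_sym that r by auto
    fix w :: "real^'n"
    show "0 \<le> w \<bullet> (Z s *v w)"
    proof (cases "w = 0")
      case False
      define u where "u = w /\<^sub>R norm w"
      have "w = norm w *\<^sub>R u" using False by (simp add: u_def)
      then have "w \<bullet> (Z s *v w) = (norm w)\<^sup>2 * (u \<bullet> (Z s *v u))"
        by (metis (no_types) inner_scaleR_left inner_scaleR_right matrix_vector_mult_scaleR mult.assoc power2_eq_square)
      then show ?thesis using pos[OF that, of u] False by (simp add: u_def)
    qed simp
  qed
  have "r \<noteq> a"
  proof
    assume "r = a"
    moreover have "0 \<le> y \<bullet> (X a *v y)" by (rule psdD(2)[OF psd])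
    ultimately show False using ry \<epsilon> y by (simp add: Z_quad) (smt (verit) exp_gt_zero mult_pos_pos)
  qed
  then have ar: "a < r" using r by simp
  \<comment> \<open>Semidefiniteness reaches \<open>r\<close> as a limit from the left, and there it
    upgrades the zero of the form at \<open>y\<close> to a null vector.\<close>
  have psd_r: "pos_semidefinite (Z r)"
    unfolding pos_semidefinite_def
  proof (intro conjI allI)
    show "symmetric_matrix (Z r)" using Z_sym r .
    fix w :: "real^'n"
    have "continuous_on {a..r} (\<lambda>s. w \<bullet> (Z s *v w))"
      by (intro quad_cont continuous_on_const continuous_on_subset[OF Z_cont]) (use r in auto)
    then show "0 \<le> w \<bullet> (Z r *v w)"
      using ar psdD(2)[OF psd_before]
      by (intro continuous_ge_on_closure[of "{a..<r}" "\<lambda>s. w \<bullet> (Z s *v w)" r 0]) auto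
  qed
  then have ry0: "y \<bullet> (Z r *v y) = 0" using ry psdD(2)[OF psd_r, of y] by simp
  then have null: "Z r *v y = 0" by (rule psd_null_vector[OF psd_r])
  obtain K where K: "0 < K" "\<And>M w. norm (M *v w :: real^'n) \<le> norm (M :: real^'n^'n) * norm w * K"
    using bounded_bilinear.pos_bounded[OF bounded_bilinear_matrix_vector_mult[where 'm = 'n and 'n = 'n]] by blast
  obtain a0 where a0: "\<And>s. 0 \<le> s \<Longrightarrow> norm (A 0 s) \<le> a0"
    using A_bdd[rule_format, of 0] by (auto simp: bounded_iff)
  obtain m where m: "\<And>s. 0 \<le> s \<Longrightarrow> \<bar>\<mu> s\<bar> \<le> m" using mu_bdd by (auto simp: bounded_iff)
  \<comment> \<open>A bound for what \<open>A 0\<close> and \<mu> contribute to the form at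
    \<open>y\<close>. It is continuous, and it vanishes at \<open>r\<close> because the vector
    \<open>Z r *v y\<close> does.\<close>
  define h where "h s = 2 * (a0 * norm (Z s *v y) * K) + m * \<bar>y \<bullet> (Z s *v y)\<bar>" for s
  have "continuous_on {a..b} h"
    unfolding h_def
    by (intro continuous_on_add continuous_on_mult_left continuous_on_mult_right continuous_on_norm
        continuous_on_rabs quad_cont bounded_bilinear.continuous_on[OF bounded_bilinear_matrix_vector_mult]
        Z_cont continuous_on_const)
  moreover have "h r = 0" by (simp add: h_def null)
  ultimately obtain d where d: "0 < d" "\<And>s. s \<in> {a..b} \<Longrightarrow> \<bar>s - r\<bar> < d \<Longrightarrow> \<bar>h s\<bar> < \<epsilon>"
    using r \<epsilon> unfolding continuous_on_iff by (metis diff_0_right dist_real_def)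
  define s0 where "s0 = max a (r - d / 2)"
  have s0: "a \<le> s0" "s0 < r" using ar d(1) by (auto simp: s0_def)
  have "y \<bullet> (Z s0 *v y) \<le> y \<bullet> (Z r *v y)"
  proof (rule nondecreasing_finite_exceptions[where f = "\<lambda>s. y \<bullet> (Z s *v y)", OF S(4)])
    show "s0 \<le> r" using s0 by simp
    show "continuous_on {s0..r} (\<lambda>s. y \<bullet> (Z s *v y))"
      by (intro quad_cont continuous_on_const continuous_on_subset[OF Z_cont]) (use r s0 in auto)
    fix s assume s: "s \<in> {s0<..<r} - S"
    then have sab: "s \<in> {a<..<b} - S" "s \<in> {a..<r}" "0 \<le> s" and sd: "\<bar>s - r\<bar> < d"
      using s0 r S(1) d(1) by (auto simp: s0_def)
    have "((\<lambda>s. \<epsilon> * exp (c * s)) has_vector_derivative \<epsilon> * exp (c * s) * c) (at s)"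
      by (auto intro!: derivative_eq_intros simp: has_real_derivative_iff_has_vector_derivative[symmetric])
    then have "(Z has_vector_derivative flow_op N A \<mu> s (X s) + (\<epsilon> * exp (c * s) * c) *\<^sub>R mat 1) (at s)"
      unfolding Z_def
      by (intro has_vector_derivative_add S(5) sab
          bounded_linear.has_vector_derivative[OF bounded_linear_scaleR_left])
    then have "((\<lambda>s. Z s \<bullet> rank_one y) has_vector_derivative
        (flow_op N A \<mu> s (X s) + (\<epsilon> * exp (c * s) * c) *\<^sub>R mat 1) \<bullet> rank_one y) (at s)"
      by (rule bounded_linear.has_vector_derivative[OF bounded_linear_inner_left])
    moreover have "0 \<le> (flow_op N A \<mu> s (X s) + (\<epsilon> * exp (c * s) * c) *\<^sub>R mat 1) \<bullet> rank_one y"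
    proof -
      \<comment> \<open>The inequality for the flow operator requires a semidefinite argument, and
        before \<open>r\<close> this is known of \<open>Z s\<close> only. Rewriting
        \<open>X s\<close> costs at most \<open>c - 1\<close> of the growth rate \<open>c\<close> of
        the perturbation; since \<open>exp (c * s) \<ge> 1\<close>, a surplus of at least \<epsilon>
        remains, and it exceeds \<open>h s\<close>.\<close>
      have "X s = Z s - (\<epsilon> * exp (c * s)) *\<^sub>R mat 1" by (simp add: Z_def)
      then have "flow_op N A \<mu> s (X s) = flow_op N A \<mu> s (Z s) - (\<epsilon> * exp (c * s)) *\<^sub>R flow_op N A \<mu> s (mat 1)"
        by (simp add: flow_blinfun_apply[symmetric] blinfun.diff_right blinfun.scaleR_right
            del: flow_blinfun_apply)
      then have "(flow_op N A \<mu> s (X s) + (\<epsilon> * exp (c * s) * c) *\<^sub>R mat 1) \<bullet> rank_one y =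
          y \<bullet> (flow_op N A \<mu> s (Z s) *v y) + \<epsilon> * exp (c * s) * (c - y \<bullet> (flow_op N A \<mu> s (mat 1) *v y))"
        using y by (simp only: inner_rank_one quadratic_add quadratic_diff quadratic_scaleR
            matrix_vector_mul_lid norm_eq_1) (simp add: algebra_simps)
      moreover have "\<epsilon> \<le> \<epsilon> * exp (c * s) * (c - y \<bullet> (flow_op N A \<mu> s (mat 1) *v y))"
      proof -
        have "1 \<le> c - y \<bullet> (flow_op N A \<mu> s (mat 1) *v y)"
          using quadratic_le_norm[of y "flow_op N A \<mu> s (mat 1)"] c(2)[OF sab(3)] y by simp
        moreover have "1 \<le> exp (c * s)" using c(1) sab(3) by simp
        ultimately have "1 * 1 \<le> exp (c * s) * (c - y \<bullet> (flow_op N A \<mu> s (mat 1) *v y))"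
          by (intro mult_mono) auto
        then show ?thesis using mult_left_mono[of 1 _ \<epsilon>] \<epsilon> by (simp add: mult.assoc)
      qed
      moreover have "- h s \<le> y \<bullet> (flow_op N A \<mu> s (Z s) *v y)"
      proof -
        have "\<bar>y \<bullet> (A 0 s *v (Z s *v y))\<bar> \<le> norm (A 0 s *v (Z s *v y))"
          using Cauchy_Schwarz_ineq2[of y "A 0 s *v (Z s *v y)"] y by simp
        also have "\<dots> \<le> norm (A 0 s) * norm (Z s *v y) * K" by (rule K(2))
        also have "\<dots> \<le> a0 * norm (Z s *v y) * K"
          using K(1) by (intro mult_right_mono a0 sab) auto
        finally have "\<bar>y \<bullet> (A 0 s *v (Z s *v y))\<bar> \<le> a0 * norm (Z s *v y) * K" .
        moreover have "\<bar>\<mu> s * (y \<bullet> (Z s *v y))\<bar> \<le> m * \<bar>y \<bullet> (Z s *v y)\<bar>"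
          unfolding abs_mult by (intro mult_right_mono m sab) auto
        ultimately show ?thesis
          using quadratic_flow_op_ge[OF psd_before[OF sab(2)], of y A s \<mu> N] unfolding h_def by linarith
      qed
      ultimately show ?thesis using d(2)[OF _ sd] sab by fastforce
    qed
    ultimately show "\<exists>d\<ge>0. ((\<lambda>s. y \<bullet> (Z s *v y)) has_vector_derivative d) (at s)"
      unfolding inner_rank_one by blast
  qed
  then show False using pos[of s0 y] s0 ry0 y by simp
qed

lemma flow_solution_psd:
  assumes X: "flow_solution a b X" and psd: "pos_semidefinite (X a)"
  shows "pos_semidefinite (X b)"
  unfolding pos_semidefinite_def
proof (intro conjI allI)
  show "symmetric_matrix (X b)" by (rule flow_solution_symmetric[OF X psdD(1)[OF psd]])
  fix x :: "real^'n"
  obtain M where M: "0 < M" "\<And>t X. 0 \<le> t \<Longrightarrow> norm (flow_op N A \<mu> t X) \<le> M * norm X"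
    using flow_op_bounded by blast
  define c where "c = M * norm (mat 1 :: real^'n^'n) + 1"
  have c: "0 < c" "\<And>t. 0 \<le> t \<Longrightarrow> norm (flow_op N A \<mu> t (mat 1)) + 1 \<le> c"
    using M by (auto simp: c_def add_nonneg_pos)
  have b: "b \<in> {a..b}" using X by (simp add: flow_solution_def)
  have unit: "0 \<le> u \<bullet> (X b *v u)" if "norm u = 1" for u
  proof (rule field_le_epsilon)
    fix e :: real assume "0 < e"
    \<comment> \<open>This choice of \<epsilon> makes the perturbation at time \<open>b\<close>
      equal to \<open>e\<close>.\<close>
    then have "0 < e / exp (c * b)" by simp
    from flow_solution_perturbed_pos[OF X psd this c b that]
    show "0 \<le> u \<bullet> (X b *v u) + e" by simp
  qed
  show "0 \<le> x \<bullet> (X b *v x)"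
  proof (cases "x = 0")
    case False
    define u where "u = x /\<^sub>R norm x"
    have "x = norm x *\<^sub>R u" using False by (simp add: u_def)
    then have "x \<bullet> (X b *v x) = (norm x)\<^sup>2 * (u \<bullet> (X b *v u))"
      by (metis (no_types) inner_scaleR_left inner_scaleR_right matrix_vector_mult_scaleR mult.assoc power2_eq_square)
    then show ?thesis using unit[of u] False by (simp add: u_def)
  qed simp
qed

text \<open>The trace changes at a rate of at most a constant times \<open>norm (X t)\<close>, and
  for semidefinite states the norm is at most the trace, so that \<open>exp (c * t)\<close> times
  the trace is nondecreasing. The lower bound on \<open>P\<close> comes from here.\<close>

lemma flow_solution_trace_ge:
  obtains c where "0 < c" "\<And>a b X. flow_solution a b X \<Longrightarrow> pos_semidefinite (X a) \<Longrightarrow>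
    exp (- c * (b - a)) * (mat 1 \<bullet> X a) \<le> mat 1 \<bullet> X b"
proof -
  obtain M where M: "0 < M" "\<And>t X. 0 \<le> t \<Longrightarrow> norm (flow_op N A \<mu> t X) \<le> M * norm X"
    using flow_op_bounded by blast
  define c where "c = norm (mat 1 :: real^'n^'n) * M + 1"
  have "exp (- c * (b - a)) * (mat 1 \<bullet> X a) \<le> mat 1 \<bullet> X b"
    if X: "flow_solution a b X" and psd: "pos_semidefinite (X a)" for a b X
  proof -
    obtain S where S: "0 \<le> a" "a \<le> b" "continuous_on {a..b} X" "finite S"
      "\<And>t. t \<in> {a<..<b} - S \<Longrightarrow> (X has_vector_derivative flow_op N A \<mu> t (X t)) (at t)"
      using X by (auto simp: flow_solution_def)
    have "exp (c * a) * (mat 1 \<bullet> X a) \<le> exp (c * b) * (mat 1 \<bullet> X b)"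
    proof (rule nondecreasing_finite_exceptions[OF S(4,2)])
      show "continuous_on {a..b} (\<lambda>t. exp (c * t) * (mat 1 \<bullet> X t))"
        by (intro continuous_intros S(3))
      fix t assume t: "t \<in> {a<..<b} - S"
      have psd_t: "pos_semidefinite (X t)"
        by (rule flow_solution_psd[of a, OF flow_solution_subinterval[OF X] psd]) (use t in auto)
      have "((\<lambda>t. exp (c * t)) has_vector_derivative exp (c * t) * c) (at t)"
        by (auto intro!: derivative_eq_intros simp: has_real_derivative_iff_has_vector_derivative[symmetric])
      then have "((\<lambda>t. exp (c * t) * (mat 1 \<bullet> X t)) has_vector_derivative
          exp (c * t) * (mat 1 \<bullet> flow_op N A \<mu> t (X t)) + exp (c * t) * c * (mat 1 \<bullet> X t)) (at t)"
        by (intro bounded_bilinear.has_vector_derivative[OF bounded_bilinear_mult]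
            bounded_linear.has_vector_derivative[OF bounded_linear_inner_right] S(5) t)
      moreover have "- (mat 1 \<bullet> flow_op N A \<mu> t (X t)) \<le> c * (mat 1 \<bullet> X t)"
      proof -
        have "\<bar>mat 1 \<bullet> flow_op N A \<mu> t (X t)\<bar> \<le> norm (mat 1 :: real^'n^'n) * norm (flow_op N A \<mu> t (X t))"
          by (rule Cauchy_Schwarz_ineq2)
        also have "\<dots> \<le> norm (mat 1 :: real^'n^'n) * (M * norm (X t))"
          using t S(1) by (intro mult_left_mono M(2)) auto
        also have "\<dots> \<le> c * norm (X t)" by (simp add: c_def algebra_simps)
        also have "\<dots> \<le> c * (mat 1 \<bullet> X t)"
          using M(1) by (intro mult_left_mono psd_norm_le_trace psd_t) (simp add: c_def)
        finally show ?thesis by simp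
      qed
      then have "0 \<le> exp (c * t) * (mat 1 \<bullet> flow_op N A \<mu> t (X t)) + exp (c * t) * c * (mat 1 \<bullet> X t)"
        by (simp add: mult.assoc distrib_left[symmetric])
      ultimately show "\<exists>d\<ge>0. ((\<lambda>t. exp (c * t) * (mat 1 \<bullet> X t)) has_vector_derivative d) (at t)" by blast
    qed
    then have "exp (- c * b) * (exp (c * a) * (mat 1 \<bullet> X a)) \<le> exp (- c * b) * (exp (c * b) * (mat 1 \<bullet> X b))"
      by (intro mult_left_mono) auto
    then show ?thesis by (simp add: mult.assoc[symmetric] exp_add[symmetric] algebra_simps)
  qed
  moreover have "0 < c" using M(1) by (simp add: c_def add_nonneg_pos)
  ultimately show ?thesis using that by blast
qed

end


section \<open>Impulse times\<close>

text \<open>By left-continuity only the left end needs correction, where the limit after the jump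
  replaces the value before it.\<close>

lemma piecewise_differentiable_patch:
  assumes f: "piecewise_differentiable t0 T C f" and ab: "t0 \<le> a" "a < b"
    and T: "T \<inter> {a<..<b} = {}" and l: "(f \<longlongrightarrow> l) (at_right a)"
  shows "continuous_on {a..b} (f(a := l))"
proof -
  have "(f \<longlongrightarrow> f b) (at_left b)" using f ab by (auto simp: piecewise_differentiable_def)
  moreover have "isCont f t" if "a < t" "t < b" for t
  proof -
    have "t \<in> {t0..} - T" "t0 < t" using T ab that by auto
    then have "continuous (at t within {t0..}) f" using f by (auto simp: piecewise_differentiable_def)
    then show ?thesis using at_within_atLeast[OF \<open>t0 < t\<close>] by simp
  qed
  ultimately have "continuous_on {a..b} (f(a := l, b := f b))"
    by (rule continuous_on_Icc_patch[OF ab(2) l])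
  moreover have "f(a := l, b := f b) = f(a := l)" using ab by auto
  ultimately show ?thesis by simp
qed

lemma has_vector_derivative_patch:
  assumes "(f has_vector_derivative d) (at t)" "a < (t :: real)"
  shows "(f(a := l) has_vector_derivative d) (at t)"
  using has_vector_derivative_transform_within_open[OF assms(1), of "{a<..}" "f(a := l)"] assms(2) by auto

locale impulsive_system = linear_flow N A \<mu>
  for N :: nat and A :: "nat \<Rightarrow> real \<Rightarrow> real^'n^'n" and \<mu> :: "real \<Rightarrow> real" +
  fixes J :: "nat \<Rightarrow> nat \<Rightarrow> real^'n^'n" and \<tau> :: "nat \<Rightarrow> real"
  assumes tau_pos: "\<forall>k\<ge>1. 0 < \<tau> k"
    and tau_mono: "strict_mono_on {1..} \<tau>"
    and tau_lim: "filterlim \<tau> at_top sequentially"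
begin

abbreviation "T \<equiv> impulse_instants \<tau>"
abbreviation "C \<equiv> continuity_times N A \<mu>"

text \<open>Because solutions are left-continuous, \<open>nxt t - nxt t0\<close> counts the jumps in
  \<open>[t0, t)\<close>, which are exactly those that have acted on \<open>X t\<close>.\<close>

definition nxt :: "real \<Rightarrow> nat" where
  "nxt t = (LEAST k. 1 \<le> k \<and> t \<le> \<tau> k)"

lemma tau_less_iff: "1 \<le> j \<Longrightarrow> 1 \<le> k \<Longrightarrow> \<tau> j < \<tau> k \<longleftrightarrow> j < k"
  using strict_mono_on_less[OF tau_mono] by simp

lemma tau_le_iff: "1 \<le> j \<Longrightarrow> 1 \<le> k \<Longrightarrow> \<tau> j \<le> \<tau> k \<longleftrightarrow> j \<le> k"
  using strict_mono_on_less_eq[OF tau_mono] by simp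

lemma nxt_ge_1: "1 \<le> nxt t" and le_tau_nxt: "t \<le> \<tau> (nxt t)"
proof -
  have "eventually (\<lambda>k. t \<le> \<tau> k \<and> 1 \<le> k) sequentially"
    using tau_lim by (intro eventually_conj eventually_ge_at_top) (auto simp: filterlim_at_top)
  then have "\<exists>k. 1 \<le> k \<and> t \<le> \<tau> k" by (auto simp: eventually_sequentially)
  from LeastI_ex[OF this] show "1 \<le> nxt t" "t \<le> \<tau> (nxt t)" by (simp_all add: nxt_def)
qed

lemma nxt_le_iff: "1 \<le> k \<Longrightarrow> nxt t \<le> k \<longleftrightarrow> t \<le> \<tau> k"
proof
  assume "1 \<le> k" "nxt t \<le> k"
  then show "t \<le> \<tau> k" using le_tau_nxt[of t] tau_le_iff[OF nxt_ge_1, of k t] by linarith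
next
  assume "1 \<le> k" "t \<le> \<tau> k"
  then show "nxt t \<le> k" unfolding nxt_def by (intro Least_le) simp
qed

lemma less_nxt_iff: "1 \<le> k \<Longrightarrow> k < nxt t \<longleftrightarrow> \<tau> k < t"
  using nxt_le_iff[of k t] by linarith

lemma nxt_mono: "s \<le> t \<Longrightarrow> nxt s \<le> nxt t"
  using nxt_le_iff[OF nxt_ge_1, of s t] le_tau_nxt[of t] by linarith

lemma nxt_tau: "1 \<le> k \<Longrightarrow> nxt (\<tau> k) = k"
  using nxt_le_iff[of k "\<tau> k"] tau_le_iff[of k "nxt (\<tau> k)"] le_tau_nxt[of "\<tau> k"] nxt_ge_1[of "\<tau> k"] by simp

lemma tau_in_T: "1 \<le> k \<Longrightarrow> \<tau> k \<in> T"
  by (auto simp: impulse_instants_def)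

lemma in_T_iff: "t \<in> T \<longleftrightarrow> \<tau> (nxt t) = t"
  using nxt_tau nxt_ge_1[of t] by (auto simp: impulse_instants_def intro!: image_eqI[of _ _ "nxt t"])

lemma T_less_nxt: "t \<notin> T \<Longrightarrow> t < \<tau> (nxt t)"
  using le_tau_nxt[of t] by (auto simp: in_T_iff)

text \<open>A jump at \<open>a\<close> lies between the values at \<open>a\<close> and
  \<open>b\<close>, since the value at \<open>a\<close> is the one before it.\<close>

lemma nxt_between:
  assumes "a < b" "T \<inter> {a<..<b} = {}"
  shows "nxt b = (if a \<in> T then Suc (nxt a) else nxt a)"
proof (rule antisym)
  let ?k = "if a \<in> T then Suc (nxt a) else nxt a"
  have k: "1 \<le> ?k" using nxt_ge_1[of a] by simp
  have "a < \<tau> ?k"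
    using T_less_nxt[of a] tau_less_iff[of "nxt a" "Suc (nxt a)"] nxt_ge_1[of a] le_tau_nxt[of a]
    by (auto split: if_splits)
  then have "b \<le> \<tau> ?k" using assms tau_in_T[OF k] by (meson disjoint_iff greaterThanLessThan_iff not_le_imp_less)
  then show "nxt b \<le> ?k" using nxt_le_iff[OF k] by simp
  show "?k \<le> nxt b"
  proof (cases "a \<in> T")
    case True
    then have "\<tau> (nxt a) < b" using assms(1) by (simp add: in_T_iff)
    then show ?thesis using less_nxt_iff[OF nxt_ge_1, of a b] True by simp
  qed (use nxt_mono[of a b] assms(1) in simp)
qed

lemma nxt_constant: "a < s \<Longrightarrow> s \<le> \<tau> (nxt a) \<Longrightarrow> nxt s = nxt a"
  using nxt_mono[of a s] nxt_le_iff[OF nxt_ge_1, of s a] by simp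

lemma nxt_after_jump:
  assumes "1 \<le> k" "\<tau> k < s" "s \<le> \<tau> (Suc k)"
  shows "nxt s = Suc k"
  using assms nxt_le_iff[of "Suc k" s] less_nxt_iff[of k s] by simp

text \<open>Like a solution, \<open>nxt\<close> is left-continuous and changes only to the right of
  an impulse instant; functions of the form \<open>g (nxt t) t\<close> inherit their regularity from
  this and the next lemmas.\<close>

lemma eventually_nxt_left: "eventually (\<lambda>s. nxt s = nxt t) (at_left t)"
proof -
  \<comment> \<open>The last impulse instant before \<open>t\<close>, or any earlier time if there
    is none.\<close>
  obtain l where l: "l < t" "\<And>k. 1 \<le> k \<Longrightarrow> k < nxt t \<Longrightarrow> \<tau> k \<le> l"
  proof (cases "nxt t = 1")
    case True
    then show ?thesis using that[of "t - 1"] by simp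
  next
    case False
    then have k: "1 \<le> nxt t - 1" "nxt t - 1 < nxt t" using nxt_ge_1[of t] by auto
    then have "\<tau> (nxt t - 1) < t" using less_nxt_iff by blast
    moreover have "\<tau> j \<le> \<tau> (nxt t - 1)" if "1 \<le> j" "j < nxt t" for j
      using tau_le_iff[OF that(1) k(1)] that by simp
    ultimately show ?thesis using that by blast
  qed
  have "nxt s = nxt t" if "l < s" "s < t" for s
  proof (rule antisym)
    show "nxt s \<le> nxt t" using that by (intro nxt_mono) simp
    show "nxt t \<le> nxt s"
    proof (rule ccontr)
      assume "\<not> nxt t \<le> nxt s"
      then have "\<tau> (nxt s) \<le> l" by (intro l nxt_ge_1) simp
      then show False using le_tau_nxt[of s] that by simp
    qed
  qed
  then show ?thesis using l(1) by (auto simp: eventually_at_left)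
qed

lemma eventually_nxt_right: "t \<notin> T \<Longrightarrow> eventually (\<lambda>s. nxt s = nxt t) (at_right t)"
  using T_less_nxt[of t] nxt_constant[of t] by (auto simp: eventually_at_right intro!: exI[of _ "\<tau> (nxt t)"])

lemma eventually_nxt_tau_right: "1 \<le> k \<Longrightarrow> eventually (\<lambda>s. nxt s = Suc k) (at_right (\<tau> k))"
  using tau_less_iff[of k "Suc k"] nxt_after_jump[of k]
  by (auto simp: eventually_at_right intro!: exI[of _ "\<tau> (Suc k)"])

lemma eventually_nxt: "t \<notin> T \<Longrightarrow> eventually (\<lambda>s. nxt s = nxt t) (at t)"
  using eventually_nxt_left[of t] eventually_nxt_right[of t] by (simp add: eventually_at_split)

text \<open>The closed interval also counts a jump at \<open>t\<close>, which has not acted on the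
  value at \<open>t\<close>; hence a discrepancy of at most one.\<close>

lemma num_jumps_bounds:
  assumes "t0 \<le> t"
  shows "nxt t - nxt t0 \<le> num_jumps \<tau> t t0" "num_jumps \<tau> t t0 \<le> Suc (nxt t - nxt t0)"
proof -
  let ?S = "{k. 1 \<le> k \<and> \<tau> k \<in> {t0..t}}"
  have "?S \<subseteq> {nxt t0..nxt t}"
  proof
    fix k assume "k \<in> ?S"
    then have k: "1 \<le> k" "t0 \<le> \<tau> k" "\<tau> k \<le> t" by auto
    then show "k \<in> {nxt t0..nxt t}"
      using nxt_le_iff[OF k(1), of t0] tau_le_iff[OF k(1) nxt_ge_1, of t] le_tau_nxt[of t] by simp
  qed
  then have "card ?S \<le> card {nxt t0..nxt t}" by (intro card_mono) auto
  then show "num_jumps \<tau> t t0 \<le> Suc (nxt t - nxt t0)"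
    using nxt_mono[OF assms] by (simp add: num_jumps_def)
  have "{nxt t0..<nxt t} \<subseteq> ?S"
  proof
    fix k assume k: "k \<in> {nxt t0..<nxt t}"
    then have "1 \<le> k" using nxt_ge_1[of t0] by simp
    then show "k \<in> ?S" using k nxt_le_iff[of k t0] less_nxt_iff[of k t] by simp
  qed
  moreover have "finite ?S" by (rule finite_subset[OF \<open>?S \<subseteq> {nxt t0..nxt t}\<close>]) simp
  ultimately have "card {nxt t0..<nxt t} \<le> card ?S" by (intro card_mono)
  then show "nxt t - nxt t0 \<le> num_jumps \<tau> t t0" by (simp add: num_jumps_def)
qed

text \<open>Finitely many intervals with impulse-free interior lead from \<open>t0\<close> to
  \<open>t\<close>. The left end of a step may be an impulse instant, so that one step covers the
  jump at \<open>a\<close> and the flow up to \<open>b\<close>.\<close>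

lemma jump_induct [consumes 1, case_names start step]:
  assumes "t0 \<le> t" and start: "Q t0"
    and step: "\<And>a b. t0 \<le> a \<Longrightarrow> a < b \<Longrightarrow> T \<inter> {a<..<b} = {} \<Longrightarrow> Q a \<Longrightarrow> Q b"
  shows "Q t"
  using assms(1)
proof (induction "nxt t - nxt t0" arbitrary: t rule: less_induct)
  case less
  show ?case
  proof (cases "T \<inter> {t0<..<t} = {}")
    case True
    then show ?thesis using start step[of t0 t] less.prems by (cases "t0 = t") auto
  next
    case False
    then obtain s where s: "s \<in> T" "t0 < s" "s < t" by auto
    \<comment> \<open>The last impulse before \<open>t\<close>. The instant \<open>s\<close> shows
      that there is one, so that the predecessor is still a valid index.\<close>
    define k where "k = nxt t - 1"
    have "nxt s < nxt t" using s less_nxt_iff[OF nxt_ge_1, of s t] by (simp add: in_T_iff)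
    then have k: "1 \<le> k" "nxt s \<le> k" "k < nxt t" "nxt t = Suc k" using nxt_ge_1[of s] by (auto simp: k_def)
    then have "s \<le> \<tau> k" "\<tau> k < t" using nxt_le_iff[OF k(1), of s] less_nxt_iff[OF k(1), of t] by auto
    moreover have "T \<inter> {\<tau> k<..<t} = {}"
    proof -
      have False if "1 \<le> j" "\<tau> k < \<tau> j" "\<tau> j < t" for j
        using that tau_less_iff[OF k(1) that(1)] less_nxt_iff[OF that(1), of t] k(4) by simp
      then show ?thesis by (auto simp: impulse_instants_def)
    qed
    moreover have "Q (\<tau> k)"
    proof (rule less.hyps)
      have "nxt t0 \<le> nxt s" using s by (intro nxt_mono) simp
      then show "nxt (\<tau> k) - nxt t0 < nxt t - nxt t0" using k nxt_tau[OF k(1)] by simp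
    qed (use s \<open>s \<le> \<tau> k\<close> in simp)
    ultimately show ?thesis using step[of "\<tau> k" t] s by simp
  qed
qed

section \<open>Lyapunov functions imply stability\<close>

lemma solution_right_limit:
  assumes X: "is_solution N A \<mu> J \<tau> t0 X0 X" and "t0 \<le> a"
  shows "(X \<longlongrightarrow> (if a \<in> T then jump_op N J (nxt a) (X a) else X a)) (at_right a)"
proof (cases "a \<in> T")
  case True
  then have "\<tau> (nxt a) = a" by (simp add: in_T_iff)
  then show ?thesis using X nxt_ge_1[of a] True \<open>t0 \<le> a\<close> unfolding is_solution_def by metis
next
  case False
  then have "continuous (at a within {t0..}) X"
    using X \<open>t0 \<le> a\<close> by (auto simp: is_solution_def piecewise_differentiable_def)
  then show ?thesis
    using False \<open>t0 \<le> a\<close> unfolding continuous_within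
    by (auto intro: tendsto_within_subset)
qed

text \<open>With the state after the jump put at \<open>a\<close>, a solution restricted to an
  impulse-free stretch is a continuous flow, to which uniqueness and positivity apply.\<close>

lemma solution_flow:
  assumes X: "is_solution N A \<mu> J \<tau> t0 X0 X" and ab: "0 \<le> t0" "t0 \<le> a" "a < b" "T \<inter> {a<..<b} = {}"
    and l: "(X \<longlongrightarrow> l) (at_right a)"
  shows "flow_solution a b (X(a := l))"
    and "\<And>t. t \<in> {a<..<b} \<inter> C \<Longrightarrow> (X has_vector_derivative flow_op N A \<mu> t (X t)) (at t)"
proof -
  show deriv: "(X has_vector_derivative flow_op N A \<mu> t (X t)) (at t)" if t: "t \<in> {a<..<b} \<inter> C" for t
  proof -
    have "t \<in> ({t0..} \<inter> C) - T" "t0 < t" using t ab by auto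
    then have "(X has_vector_derivative flow_op N A \<mu> t (X t)) (at t within {t0..})"
      using X by (auto simp: is_solution_def)
    then show ?thesis using at_within_atLeast[OF \<open>t0 < t\<close>] by simp
  qed
  show "flow_solution a b (X(a := l))"
    unfolding flow_solution_def
  proof (intro conjI exI[of _ "{a..b} - C"] ballI)
    show "continuous_on {a..b} (X(a := l))"
      using X ab l by (intro piecewise_differentiable_patch) (auto simp: is_solution_def)
    show "finite ({a..b} - C)" using ab by (intro finite_discontinuities) simp
    fix t assume t: "t \<in> {a<..<b} - ({a..b} - C)"
    then show "(X(a := l) has_vector_derivative flow_op N A \<mu> t ((X(a := l)) t)) (at t)"
      using has_vector_derivative_patch[OF deriv[of t], of a l] by auto
  qed (use ab in auto)
qed

lemma solution_psd:
  assumes X: "is_solution N A \<mu> J \<tau> t0 X0 X" and psd: "pos_semidefinite X0" and t: "0 \<le> t0" "t0 \<le> t"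
  shows "pos_semidefinite (X t)"
  using t(2)
proof (induction rule: jump_induct)
  case start
  then show ?case using X psd by (simp add: is_solution_def)
next
  case (step a b)
  let ?l = "if a \<in> T then jump_op N J (nxt a) (X a) else X a"
  have "flow_solution a b (X(a := ?l))"
    by (rule solution_flow(1)[OF X t(1) step(1-3) solution_right_limit[OF X step(1)]])
  moreover have "pos_semidefinite ?l" using step.IH jump_op_psd by auto
  ultimately show ?case using flow_solution_psd[of a b "X(a := ?l)"] step(2) by simp
qed

text \<open>The derivative of \<open>P t \<bullet> X t\<close> is at most \<open>- \<alpha>3\<close>
  times the trace of \<open>X t\<close>, and \<open>P t \<bullet> X t\<close> is at most
  \<open>\<alpha>2\<close> times that trace; hence the rate \<open>\<alpha>3 / \<alpha>2\<close>.
  Both functions may jump at \<open>a\<close>, so that the estimate starts from their right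
  limits.\<close>

lemma lyapunov_step:
  assumes X: "is_solution N A \<mu> J \<tau> t0 X0 X" and psd: "pos_semidefinite X0" and t0: "0 \<le> t0"
    and ab: "t0 \<le> a" "a < b" "T \<inter> {a<..<b} = {}"
    and C': "C' \<subseteq> C" "\<And>u v. 0 \<le> u \<Longrightarrow> finite ({u..v} - C')"
    and P: "piecewise_differentiable 0 T C' P"
    and \<alpha>: "0 < \<alpha>2" "0 < \<alpha>3" "\<And>t. 0 \<le> t \<Longrightarrow> P t \<preceq>\<^sub>L scaled_identity \<alpha>2"
    and P_deriv: "\<And>t. t \<in> C' - T \<Longrightarrow>
      vector_derivative P (at t within {0..}) + flow_adj N A \<mu> t (P t) \<preceq>\<^sub>L scaled_identity (- \<alpha>3)"
    and l: "(X \<longlongrightarrow> l) (at_right a)" "(P \<longlongrightarrow> p) (at_right a)"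
  shows "P b \<bullet> X b \<le> exp (- (\<alpha>3 / \<alpha>2) * (b - a)) * (p \<bullet> l)"
proof -
  define c where "c = \<alpha>3 / \<alpha>2"
  have c: "0 < c" using \<alpha> by (simp add: c_def)
  define X' P' where "X' = X(a := l)" and "P' = P(a := p)"
  have flow: "flow_solution a b X'"
    unfolding X'_def by (rule solution_flow(1)[OF X t0 ab l(1)])
  have "- (exp (c * a) * (P' a \<bullet> X' a)) \<le> - (exp (c * b) * (P' b \<bullet> X' b))"
  proof (rule nondecreasing_finite_exceptions[where f = "\<lambda>t. - (exp (c * t) * (P' t \<bullet> X' t))"])
    show "finite ({a..b} - C')" using t0 ab by (intro C') simp
    show "a \<le> b" using ab by simp
    have "continuous_on {a..b} P'"
      unfolding P'_def using t0 ab by (intro piecewise_differentiable_patch[OF P _ _ _ l(2)]) auto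
    then show "continuous_on {a..b} (\<lambda>t. - (exp (c * t) * (P' t \<bullet> X' t)))"
      using flow by (intro continuous_intros) (auto simp: flow_solution_def)
    fix t assume "t \<in> {a<..<b} - ({a..b} - C')"
    then have t: "a < t" "t < b" "t \<in> C'" "t \<in> C" "t \<notin> T" "0 < t" using C' ab t0 by auto
    let ?X' = "flow_op N A \<mu> t (X t)" and ?P' = "vector_derivative P (at t)"
    have "(X' has_vector_derivative ?X') (at t)"
      unfolding X'_def
      using t by (intro has_vector_derivative_patch solution_flow(2)[OF X t0 ab l(1)]) auto
    moreover have "P differentiable (at t within {0..})"
      using P t by (auto simp: piecewise_differentiable_def)
    then have "(P' has_vector_derivative ?P') (at t)"
      unfolding P'_def using t
      by (intro has_vector_derivative_patch) (auto simp: at_within_atLeast vector_derivative_works)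
    moreover have "((\<lambda>t. exp (c * t)) has_vector_derivative exp (c * t) * c) (at t)"
      by (auto intro!: derivative_eq_intros simp: has_real_derivative_iff_has_vector_derivative[symmetric])
    ultimately have "((\<lambda>t. - (exp (c * t) * (P' t \<bullet> X' t))) has_vector_derivative
        - (exp (c * t) * (P' t \<bullet> ?X' + ?P' \<bullet> X' t) + exp (c * t) * c * (P' t \<bullet> X' t))) (at t)"
      by (intro has_vector_derivative_minus bounded_bilinear.has_vector_derivative[OF bounded_bilinear_mult]
          bounded_bilinear.has_vector_derivative[OF bounded_bilinear_inner])
    moreover have "0 \<le> - (exp (c * t) * (P' t \<bullet> ?X' + ?P' \<bullet> X' t) + exp (c * t) * c * (P' t \<bullet> X' t))"
    proof -
      have psd_t: "pos_semidefinite (X t)" using solution_psd[OF X psd t0, of t] t ab by simp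
      have "(?P' + flow_adj N A \<mu> t (P t)) \<bullet> X t \<le> scaled_identity (- \<alpha>3) \<bullet> X t"
        using loewner_le_inner[OF P_deriv[of t] psd_t] t by (simp add: at_within_atLeast)
      moreover have "P t \<bullet> ?X' = flow_adj N A \<mu> t (P t) \<bullet> X t"
        using inner_flow_op[of N A \<mu> t "X t" "P t"] by (simp add: inner_commute)
      ultimately have "P' t \<bullet> ?X' + ?P' \<bullet> X' t \<le> - \<alpha>3 * (mat 1 \<bullet> X t)"
        using t by (simp add: P'_def X'_def inner_add_left)
      moreover have "c * (P' t \<bullet> X' t) \<le> c * (\<alpha>2 * (mat 1 \<bullet> X t))"
        using loewner_le_inner[OF \<alpha>(3) psd_t] t c by (intro mult_left_mono) (simp_all add: P'_def X'_def)
      moreover have "c * (\<alpha>2 * (mat 1 \<bullet> X t)) = \<alpha>3 * (mat 1 \<bullet> X t)" using \<alpha>(1) by (simp add: c_def)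
      ultimately have "P' t \<bullet> ?X' + ?P' \<bullet> X' t + c * (P' t \<bullet> X' t) \<le> 0" by linarith
      then have "exp (c * t) * (P' t \<bullet> ?X' + ?P' \<bullet> X' t + c * (P' t \<bullet> X' t)) \<le> 0"
        by (simp add: mult_le_0_iff)
      then show ?thesis by (simp add: algebra_simps)
    qed
    ultimately show "\<exists>d\<ge>0. ((\<lambda>t. - (exp (c * t) * (P' t \<bullet> X' t))) has_vector_derivative d) (at t)"
      by blast
  qed
  then have "exp (- c * b) * (exp (c * b) * (P b \<bullet> X b)) \<le> exp (- c * b) * (exp (c * a) * (p \<bullet> l))"
    using ab by (intro mult_left_mono) (simp_all add: P'_def X'_def)
  moreover have "exp (- c * b) * exp (c * b) = 1" by (simp add: exp_add[symmetric])
  moreover have "exp (- c * b) * exp (c * a) = exp (- c * (b - a))"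
    by (simp add: exp_add[symmetric] algebra_simps)
  ultimately show ?thesis by (simp only: mult.assoc[symmetric] c_def mult_1)
qed

text \<open>The common source of both implications towards stability: \<open>C'\<close> is
  \<open>C\<close> for the inequality, while for the equation it also omits the discontinuities of
  \<open>Q\<close>, finitely many on compact intervals.\<close>

lemma lyapunov_imp_stable:
  assumes C': "C' \<subseteq> C" "\<And>u v. 0 \<le> u \<Longrightarrow> finite ({u..v} - C')"
    and P: "piecewise_differentiable 0 T C' P"
    and \<alpha>: "0 < \<alpha>1" "0 < \<alpha>2" "0 < \<alpha>3" "0 < \<alpha>4"
    and P_ge: "\<And>t. 0 \<le> t \<Longrightarrow> scaled_identity \<alpha>1 \<preceq>\<^sub>L P t"
    and P_le: "\<And>t. 0 \<le> t \<Longrightarrow> P t \<preceq>\<^sub>L scaled_identity \<alpha>2"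
    and P_deriv: "\<And>t. t \<in> C' - T \<Longrightarrow>
      vector_derivative P (at t within {0..}) + flow_adj N A \<mu> t (P t) \<preceq>\<^sub>L scaled_identity (- \<alpha>3)"
    and P_jump: "\<And>k. 1 \<le> k \<Longrightarrow>
      jump_adj N J k (Lim (at_right (\<tau> k)) P) - P (\<tau> k) \<preceq>\<^sub>L scaled_identity (- \<alpha>4)"
  shows "\<exists>\<alpha> \<rho>. 0 < \<alpha> \<and> 0 < \<rho> \<and> \<rho> < 1 \<and> gues N A \<mu> J \<tau> \<alpha> \<rho>"
proof -
  \<comment> \<open>A jump multiplies \<open>P \<bullet> X\<close> by at most
    \<open>1 - \<alpha>4 / \<alpha>2\<close>. This factor can be 0 when the jumps annihilate the
    state, and the maximum with 1/2 keeps \<rho> positive.\<close>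
  define c \<rho> where "c = \<alpha>3 / \<alpha>2" and "\<rho> = max (1 / 2) (1 - \<alpha>4 / \<alpha>2)"
  have c: "0 < c" and \<rho>: "0 < \<rho>" "\<rho> < 1" using \<alpha> by (auto simp: c_def \<rho>_def)
  have decay: "P t \<bullet> X t \<le> \<rho> ^ (nxt t - nxt t0) * exp (- c * (t - t0)) * (P t0 \<bullet> X0)"
    if X: "is_solution N A \<mu> J \<tau> t0 X0 X" and psd: "pos_semidefinite X0" and t0: "0 \<le> t0" and t: "t0 \<le> t"
    for X0 X t0 t
    using t
  proof (induction rule: jump_induct)
    case start
    then show ?case using X by (simp add: is_solution_def)
  next
    case (step a b)
    note X_lim = solution_right_limit[OF X step(1)]
    have psd_a: "pos_semidefinite (X a)" by (rule solution_psd[OF X psd t0 step(1)])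
    have a: "0 \<le> a" using t0 step(1) by simp
    have next_b: "nxt b = (if a \<in> T then Suc (nxt a) else nxt a)" by (rule nxt_between[OF step(2,3)])
    have mono: "nxt t0 \<le> nxt a" by (rule nxt_mono[OF step(1)])
    have exp_b: "exp (- c * (b - a)) * exp (- c * (a - t0)) = exp (- c * (b - t0))"
      by (simp add: exp_add[symmetric] algebra_simps)
    show ?case
    proof (cases "a \<in> T")
      case True
      then have tau: "\<tau> (nxt a) = a" by (simp add: in_T_iff)
      obtain p where p: "(P \<longlongrightarrow> p) (at_right a)"
        using P True a unfolding piecewise_differentiable_def by (meson IntI atLeast_iff)
      then have Lim: "Lim (at_right a) P = p" by (intro tendsto_Lim) auto
      have X_lim': "(X \<longlongrightarrow> jump_op N J (nxt a) (X a)) (at_right a)" using X_lim True by simp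
      have "(jump_adj N J (nxt a) p - P a) \<bullet> X a \<le> scaled_identity (- \<alpha>4) \<bullet> X a"
        using loewner_le_inner[OF P_jump[OF nxt_ge_1[of a]] psd_a] by (simp add: tau Lim)
      then have "jump_adj N J (nxt a) p \<bullet> X a \<le> P a \<bullet> X a - \<alpha>4 * (mat 1 \<bullet> X a)"
        by (simp add: inner_diff_left)
      also have "\<dots> \<le> (1 - \<alpha>4 / \<alpha>2) * (P a \<bullet> X a)"
      proof -
        have "P a \<bullet> X a \<le> \<alpha>2 * (mat 1 \<bullet> X a)"
          using loewner_le_inner[OF P_le[OF a] psd_a] by simp
        then have "(\<alpha>4 / \<alpha>2) * (P a \<bullet> X a) \<le> (\<alpha>4 / \<alpha>2) * (\<alpha>2 * (mat 1 \<bullet> X a))"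
          using \<alpha> by (intro mult_left_mono) auto
        then show ?thesis using \<alpha> by (simp add: left_diff_distrib)
      qed
      also have "\<dots> \<le> \<rho> * (P a \<bullet> X a)"
      proof (rule mult_right_mono)
        have "0 \<le> \<alpha>1 * (mat 1 \<bullet> X a)" using \<alpha>(1) psd_trace_nonneg[OF psd_a] by simp
        also have "\<dots> \<le> P a \<bullet> X a" using loewner_le_inner[OF P_ge[OF a] psd_a] by simp
        finally show "0 \<le> P a \<bullet> X a" .
      qed (simp add: \<rho>_def)
      also have "\<dots> \<le> \<rho> * (\<rho> ^ (nxt a - nxt t0) * exp (- c * (a - t0)) * (P t0 \<bullet> X0))"
        using step.IH \<rho> by (intro mult_left_mono) auto
      finally have "p \<bullet> jump_op N J (nxt a) (X a) \<le>
          \<rho> * (\<rho> ^ (nxt a - nxt t0) * exp (- c * (a - t0)) * (P t0 \<bullet> X0))"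
        using inner_jump_op[of N J "nxt a" "X a" p] by (simp add: inner_commute)
      then have "exp (- c * (b - a)) * (p \<bullet> jump_op N J (nxt a) (X a)) \<le>
          exp (- c * (b - a)) * (\<rho> * (\<rho> ^ (nxt a - nxt t0) * exp (- c * (a - t0)) * (P t0 \<bullet> X0)))"
        by (intro mult_left_mono) auto
      also have "\<dots> = \<rho> ^ (nxt b - nxt t0) * (exp (- c * (b - a)) * exp (- c * (a - t0))) * (P t0 \<bullet> X0)"
        using True mono by (simp add: next_b Suc_diff_le)
      finally have bound: "exp (- c * (b - a)) * (p \<bullet> jump_op N J (nxt a) (X a)) \<le>
          \<rho> ^ (nxt b - nxt t0) * exp (- c * (b - t0)) * (P t0 \<bullet> X0)" by (simp only: exp_b)
      show ?thesis
        by (rule order_trans[OF lyapunov_step[OF X psd t0 step(1-3) C' P \<alpha>(2,3) P_le P_deriv X_lim' p,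
              folded c_def] bound])
    next
      case False
      then have "continuous (at a within {0..}) P" using P a by (auto simp: piecewise_differentiable_def)
      then have p: "(P \<longlongrightarrow> P a) (at_right a)"
        using a unfolding continuous_within by (auto intro: tendsto_within_subset)
      have X_lim': "(X \<longlongrightarrow> X a) (at_right a)" using X_lim False by simp
      have "exp (- c * (b - a)) * (P a \<bullet> X a) \<le>
          exp (- c * (b - a)) * (\<rho> ^ (nxt a - nxt t0) * exp (- c * (a - t0)) * (P t0 \<bullet> X0))"
        using step.IH by (intro mult_left_mono) auto
      also have "\<dots> = \<rho> ^ (nxt b - nxt t0) * (exp (- c * (b - a)) * exp (- c * (a - t0))) * (P t0 \<bullet> X0)"
        using False by (simp add: next_b)
      finally have bound: "exp (- c * (b - a)) * (P a \<bullet> X a) \<le>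
          \<rho> ^ (nxt b - nxt t0) * exp (- c * (b - t0)) * (P t0 \<bullet> X0)" by (simp only: exp_b)
      show ?thesis
        by (rule order_trans[OF lyapunov_step[OF X psd t0 step(1-3) C' P \<alpha>(2,3) P_le P_deriv X_lim' p,
              folded c_def] bound])
    qed
  qed
  \<comment> \<open>The constants \<open>\<alpha>1\<close>, \<open>\<alpha>2\<close> and the norm of
    the identity compare \<open>P \<bullet> X\<close> with the norm at both ends;
    \<open>1 / \<rho>\<close> pays for a jump at \<open>t\<close>, which \<open>num_jumps\<close>
    counts although \<open>X t\<close> precedes it.\<close>
  define \<beta> where "\<beta> = max 1 (\<alpha>2 * norm (mat 1 :: real^'n^'n) / (\<alpha>1 * \<rho>))"
  have "gues N A \<mu> J \<tau> c \<rho>"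
    unfolding gues_def
  proof (intro exI[of _ \<beta>] conjI allI impI)
    show "1 \<le> \<beta>" by (simp add: \<beta>_def)
    fix t0 t :: real and X0 :: "real^'n^'n" and X
    assume t0: "0 \<le> t0" and psd: "pos_semidefinite X0" and X: "is_solution N A \<mu> J \<tau> t0 X0 X" and t: "t0 \<le> t"
    have psd_t: "pos_semidefinite (X t)" by (rule solution_psd[OF X psd t0 t])
    let ?e = "exp (- c * (t - t0))"
    have pow: "\<rho> ^ (nxt t - nxt t0) \<le> \<rho> ^ num_jumps \<tau> t t0 / \<rho>"
    proof -
      have "\<rho> * \<rho> ^ (nxt t - nxt t0) \<le> \<rho> ^ num_jumps \<tau> t t0"
        using power_decreasing[OF num_jumps_bounds(2)[OF t], of \<rho>] \<rho> by simp
      then show ?thesis using \<rho> by (simp add: field_simps)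
    qed
    have V0: "P t0 \<bullet> X0 \<le> \<alpha>2 * (norm (mat 1 :: real^'n^'n) * norm X0)"
    proof -
      have "P t0 \<bullet> X0 \<le> \<alpha>2 * (mat 1 \<bullet> X0)" using loewner_le_inner[OF P_le[OF t0] psd] by simp
      also have "\<dots> \<le> \<alpha>2 * (norm (mat 1 :: real^'n^'n) * norm X0)"
        using \<alpha> by (intro mult_left_mono norm_cauchy_schwarz) auto
      finally show ?thesis .
    qed
    have "\<alpha>1 * norm (X t) \<le> \<alpha>1 * (mat 1 \<bullet> X t)"
      using \<alpha> by (intro mult_left_mono psd_norm_le_trace psd_t) auto
    also have "\<dots> \<le> P t \<bullet> X t" using loewner_le_inner[OF P_ge psd_t, of t] t0 t by simp
    also have "\<dots> \<le> \<rho> ^ (nxt t - nxt t0) * ?e * (P t0 \<bullet> X0)"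
      by (rule decay[OF X psd t0 t])
    also have "\<dots> \<le> \<rho> ^ (nxt t - nxt t0) * ?e * (\<alpha>2 * (norm (mat 1 :: real^'n^'n) * norm X0))"
      using \<rho> by (intro mult_left_mono V0) auto
    also have "\<dots> \<le> \<rho> ^ num_jumps \<tau> t t0 / \<rho> * ?e * (\<alpha>2 * (norm (mat 1 :: real^'n^'n) * norm X0))"
      using \<alpha> by (intro mult_right_mono pow) auto
    finally have "norm (X t) \<le>
        \<rho> ^ num_jumps \<tau> t t0 / \<rho> * ?e * (\<alpha>2 * (norm (mat 1 :: real^'n^'n) * norm X0)) / \<alpha>1"
      using \<alpha>(1) by (simp only: pos_le_divide_eq mult.commute[of _ \<alpha>1])
    also have "\<dots> = \<alpha>2 * norm (mat 1 :: real^'n^'n) / (\<alpha>1 * \<rho>) * (\<rho> ^ num_jumps \<tau> t t0 * ?e * norm X0)"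
      by (simp add: ac_simps)
    also have "\<dots> \<le> \<beta> * (\<rho> ^ num_jumps \<tau> t t0 * ?e * norm X0)"
      using \<rho> by (intro mult_right_mono) (auto simp: \<beta>_def)
    finally show "norm (X t) \<le> \<beta> * \<rho> ^ num_jumps \<tau> t t0 * ?e * norm X0" by (simp add: mult.assoc)
  qed
  then show ?thesis using c \<rho> by blast
qed

end


section \<open>Stability yields a Lyapunov function\<close>

definition badj :: "('e::euclidean_space \<Rightarrow>\<^sub>L 'e) \<Rightarrow> 'e \<Rightarrow> 'e" where
  "badj B = adjoint (blinfun_apply B)"

lemma inner_badj: "badj B y \<bullet> x = y \<bullet> blinfun_apply B x"
  unfolding badj_def
  using adjoint_works[OF bounded_linear.linear[OF blinfun.bounded_linear_right], of x B y]
  by (simp add: inner_commute)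

lemma bounded_linear_badj: "bounded_linear (badj B)"
  unfolding badj_def linear_conv_bounded_linear[symmetric]
  by (intro adjoint_linear bounded_linear.linear[OF blinfun.bounded_linear_right])

text \<open>The matrices built below are accessible through their inner products, so that regularity
  is tested against one fixed matrix at a time.\<close>

lemma continuous_on_inner_ext:
  fixes f :: "'a::topological_space \<Rightarrow> 'e::euclidean_space"
  assumes "\<And>x. continuous_on S (\<lambda>t. f t \<bullet> x)"
  shows "continuous_on S f"
  using assms unfolding continuous_on_def by (subst tendsto_componentwise_iff) blast

lemma has_vector_derivative_inner_ext:
  fixes f :: "real \<Rightarrow> 'e::euclidean_space"
  assumes "\<And>x. ((\<lambda>t. f t \<bullet> x) has_vector_derivative d \<bullet> x) (at t within S)"
  shows "(f has_vector_derivative d) (at t within S)"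
  using assms unfolding has_vector_derivative_def
  by (subst has_derivative_componentwise_within) simp

text \<open>The evolution acts on all matrices, whereas \<open>P\<close> has to be symmetric.
  Commuting with transposition is the property that passes to products and makes adjoints preserve
  symmetry.\<close>

definition commutes_transpose :: "((real^'n^'n) \<Rightarrow>\<^sub>L (real^'n^'n)) \<Rightarrow> bool" where
  "commutes_transpose B \<longleftrightarrow> (\<forall>X. blinfun_apply B (transpose X) = transpose (blinfun_apply B X))"

lemma commutes_transpose_id: "commutes_transpose id_blinfun"
  by (simp add: commutes_transpose_def)

lemma commutes_transpose_compose:
  "commutes_transpose B \<Longrightarrow> commutes_transpose D \<Longrightarrow> commutes_transpose (B o\<^sub>L D)"
  by (simp add: commutes_transpose_def)

lemma commutes_transpose_jump: "commutes_transpose (jump_blinfun N J k)"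
  by (simp add: commutes_transpose_def transpose_jump_op)

lemma badj_symmetric:
  assumes "commutes_transpose B" "symmetric_matrix Y"
  shows "symmetric_matrix (badj B Y)"
proof -
  have "transpose (badj B Y) \<bullet> X = badj B Y \<bullet> X" for X
  proof -
    have "transpose (badj B Y) \<bullet> X = badj B Y \<bullet> transpose X"
      using inner_transpose[of "transpose (badj B Y)" X] by simp
    also have "\<dots> = transpose Y \<bullet> transpose (blinfun_apply B X)"
      using assms by (simp add: inner_badj commutes_transpose_def symmetric_matrix_def)
    also have "\<dots> = badj B Y \<bullet> X" by (simp add: inner_transpose inner_badj)
    finally show ?thesis .
  qed
  then show ?thesis using vector_eq_rdot by (auto simp: symmetric_matrix_def)
qed

text \<open>The value at the left endpoint, where a solution is still the one before the jump, is exempt.\<close>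

lemma integral_le_except_left:
  fixes f g :: "real \<Rightarrow> real"
  assumes "continuous_on {a..b} f" "continuous_on {a..b} g" "\<And>s. a < s \<Longrightarrow> s \<le> b \<Longrightarrow> f s \<le> g s"
  shows "integral {a..b} f \<le> integral {a..b} g"
proof -
  have "((\<lambda>s. if s = a then g a else f s) has_integral integral {a..b} f) {a..b}"
    by (rule has_integral_spike_finite[of "{a}" _ _ f])
      (auto intro: integrable_integral integrable_continuous_interval assms(1))
  moreover have "(g has_integral integral {a..b} g) {a..b}"
    by (intro integrable_integral integrable_continuous_interval assms(2))
  ultimately show ?thesis by (rule has_integral_le) (use assms(3) in auto)
qed

lemma integral_abs_le_except_left:
  fixes f g :: "real \<Rightarrow> real"
  assumes "continuous_on {a..b} f" "continuous_on {a..b} g" "\<And>s. a < s \<Longrightarrow> s \<le> b \<Longrightarrow> \<bar>f s\<bar> \<le> g s"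
  shows "\<bar>integral {a..b} f\<bar> \<le> integral {a..b} g"
proof -
  have "integral {a..b} f \<le> integral {a..b} g"
    using assms(3) by (intro integral_le_except_left assms(1,2)) (simp add: abs_le_iff)
  moreover have "integral {a..b} (\<lambda>s. - f s) \<le> integral {a..b} g"
    using assms(3) by (intro integral_le_except_left continuous_on_minus assms(1,2)) (simp add: abs_le_iff)
  ultimately show ?thesis by (simp add: abs_le_iff)
qed

lemma exp_decay_integral:
  fixes c :: real
  assumes "0 < c" "a \<le> b"
  shows "integral {a..b} (\<lambda>s. exp (- c * (s - t))) = (exp (- c * (a - t)) - exp (- c * (b - t))) / c"
proof -
  have "((\<lambda>s. exp (- c * (s - t))) has_integral
      (- exp (- c * (b - t)) / c - (- exp (- c * (a - t)) / c))) {a..b}"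
    using assms
    by (intro fundamental_theorem_of_calculus)
      (auto intro!: derivative_eq_intros simp: has_real_derivative_iff_has_vector_derivative[symmetric])
  from integral_unique[OF this] show ?thesis by (simp add: diff_divide_distrib)
qed

section \<open>Integrated trace of the flow between impulses\<close>

context linear_flow
begin

lemma U_commutes_transpose: "0 \<le> t \<Longrightarrow> commutes_transpose (U t)"
  using flow_solution_unique[OF flow_solution_transpose[OF flow_solution_UV[of 0 t]]]
  by (simp add: commutes_transpose_def)

lemma V_commutes_transpose:
  assumes "0 \<le> t"
  shows "commutes_transpose (V t)"
  unfolding commutes_transpose_def
proof
  fix X
  have "blinfun_apply (U t) (transpose (blinfun_apply (V t) X)) = transpose X"
    using U_commutes_transpose[OF assms] assms by (simp add: commutes_transpose_def)
  then show "blinfun_apply (V t) (transpose X) = transpose (blinfun_apply (V t) X)"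
    using VU[OF assms] by metis
qed

text \<open>In coordinates moved back to time 0, \<open>Z s\<close> represents the trace at time
  \<open>s\<close> of the flow without jumps; differences of its antiderivative \<open>F\<close>
  represent the integrated trace.\<close>

definition Z :: "real \<Rightarrow> real^'n^'n" where
  "Z s = badj (U s) (mat 1)"

definition F :: "real \<Rightarrow> real^'n^'n" where
  "F t = integral {0..t} Z"

lemma inner_Z: "Z s \<bullet> Y = mat 1 \<bullet> blinfun_apply (U s) Y"
  by (simp add: Z_def inner_badj)

lemma Z_cont: "continuous_on {0..} Z"
  by (rule continuous_on_inner_ext) (simp add: inner_Z continuous_intros U_apply_cont)

lemma F_cont: "continuous_on {0..} F"
  unfolding F_def by (intro continuous_on_indefinite_integral piecewise_continuous_on Z_cont)

lemma F_deriv: "0 \<le> t \<Longrightarrow> (F has_vector_derivative Z t) (at t within {0..})"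
  unfolding F_def
  using Z_cont by (intro indefinite_integral_derivative piecewise_continuous_on)
    (auto simp: continuous_on_eq_continuous_within)

lemma F_diff_inner:
  assumes "0 \<le> a" "a \<le> b"
  shows "(F b - F a) \<bullet> Y = integral {a..b} (\<lambda>s. mat 1 \<bullet> blinfun_apply (U s) Y)"
proof -
  have Z: "piecewise_continuous Z" by (intro piecewise_continuous_on Z_cont)
  have "F b - F a = integral {a..b} Z"
    unfolding F_def using integral_from_0[OF Z assms] by simp
  then show ?thesis
    using integral_component_eq[OF piecewise_continuous_integrable[OF Z assms(1)], of b Y] by (simp add: inner_Z)
qed

lemma Z_symmetric: "0 \<le> s \<Longrightarrow> symmetric_matrix (Z s)"
  unfolding Z_def by (intro badj_symmetric U_commutes_transpose symmetric_mat)

lemma F_symmetric: "symmetric_matrix (F t)"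
proof -
  have "transpose (F t) = integral {0..t} (transpose \<circ> Z)"
    unfolding F_def
    by (rule integral_linear[symmetric, OF _ bounded_linear_transpose])
      (intro piecewise_continuous_integrable piecewise_continuous_on Z_cont order.refl)
  also have "\<dots> = F t"
    unfolding F_def using Z_symmetric by (intro integral_cong) (simp add: symmetric_matrix_def)
  finally show ?thesis by (simp add: symmetric_matrix_def)
qed

end

section \<open>Explicit solutions and the cost functional\<close>

context impulsive_system
begin

lemma tau_nonneg: "1 \<le> k \<Longrightarrow> 0 \<le> \<tau> k"
  using tau_pos less_imp_le by blast

lemma tau_mono': "1 \<le> j \<Longrightarrow> j \<le> k \<Longrightarrow> \<tau> j \<le> \<tau> k"
  using tau_le_iff[of j k] by simp

text \<open>Both the explicit solution and \<open>P\<close> have this shape: each \<open>g k\<close>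
  is regular on the whole half-line, and only the change of index at an impulse makes a jump, from
  \<open>g k\<close> to \<open>g (Suc k)\<close>.\<close>

lemma nxt_glue:
  assumes t0: "0 \<le> t0" and f: "f = (\<lambda>t. g (nxt t) t)"
    and g_cont: "\<And>k. continuous_on {0..} (g k)"
    and g_deriv: "\<forall>k. \<forall>t\<in>C. (g k has_vector_derivative g' k t) (at t within {0..})"
  shows "piecewise_differentiable t0 T C f"
    and "\<And>t. t \<in> ({t0..} \<inter> C) - T \<Longrightarrow> (f has_vector_derivative g' (nxt t) t) (at t within {t0..})"
    and "\<And>k. 1 \<le> k \<Longrightarrow> (f \<longlongrightarrow> g (Suc k) (\<tau> k)) (at_right (\<tau> k))"
proof -
  have lim: "(g k \<longlongrightarrow> g k t) (at t within S)" if "S \<subseteq> {0..}" "0 \<le> t" for k t S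
    using g_cont[of k] that by (auto simp: continuous_on_def intro: tendsto_within_subset)
  have glim: "(f \<longlongrightarrow> g k t) F" if "eventually (\<lambda>s. nxt s = k) F" "(g k \<longlongrightarrow> g k t) F" for F k t
    by (rule Lim_transform_eventually[OF that(2)]) (use that(1) in \<open>eventually_elim, simp add: f\<close>)
  show deriv: "(f has_vector_derivative g' (nxt t) t) (at t within {t0..})" if t: "t \<in> ({t0..} \<inter> C) - T" for t
  proof -
    have "eventually (\<lambda>s. f s = g (nxt t) s) (at t)"
      using eventually_nxt[of t] t by (auto simp: f elim: eventually_mono)
    then have "\<exists>d>0. \<forall>s. s \<noteq> t \<and> dist s t < d \<longrightarrow> f s = g (nxt t) s"
      by (simp add: eventually_at)
    then obtain d where d: "0 < d" "\<And>s. s \<noteq> t \<Longrightarrow> dist s t < d \<Longrightarrow> f s = g (nxt t) s" by blast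
    have "(g (nxt t) has_vector_derivative g' (nxt t) t) (at t within {t0..})"
      by (rule has_vector_derivative_within_subset[where S = "{0..}"]) (use g_deriv t t0 in auto)
    then show ?thesis
    proof (rule has_vector_derivative_transform_within[OF _ d(1)])
      show "g (nxt t) s = f s" if "dist s t < d" for s
        using d(2)[OF _ that] fun_cong[OF f, of t] by (cases "s = t") auto
    qed (use t in auto)
  qed
  show right: "(f \<longlongrightarrow> g (Suc k) (\<tau> k)) (at_right (\<tau> k))" if "1 \<le> k" for k
    by (intro glim eventually_nxt_tau_right that lim) (use tau_nonneg[OF that] in auto)
  show "piecewise_differentiable t0 T C f"
    unfolding piecewise_differentiable_def
  proof (intro conjI allI impI ballI)
    fix t assume t: "t0 < t"
    have "(g (nxt t) \<longlongrightarrow> g (nxt t) t) (at t)"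
      using lim[of "{0..}" t "nxt t"] t t0 at_within_atLeast[of 0 t] by simp
    then have "(g (nxt t) \<longlongrightarrow> g (nxt t) t) (at_left t)" by (rule tendsto_within_subset) simp
    then show "(f \<longlongrightarrow> f t) (at_left t)"
      unfolding f[THEN fun_cong, of t] by (intro glim eventually_nxt_left)
  next
    fix t assume t: "t \<in> {t0..} - T"
    have "(f \<longlongrightarrow> g (nxt t) t) (at t within {t0..})"
    proof (rule glim)
      show "eventually (\<lambda>s. nxt s = nxt t) (at t within {t0..})"
        using eventually_nxt[of t] t by (auto intro: filter_leD[OF at_le])
      show "(g (nxt t) \<longlongrightarrow> g (nxt t) t) (at t within {t0..})" using t t0 by (intro lim) auto
    qed
    then show "continuous (at t within {t0..}) f" by (simp add: continuous_within f)
  next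
    fix t assume "t \<in> {t0..} \<inter> T"
    then have "\<tau> (nxt t) = t" by (simp add: in_T_iff)
    then show "\<exists>l. (f \<longlongrightarrow> l) (at_right t)" using right[OF nxt_ge_1[of t]] by metis
  next
    fix t assume "t \<in> {t0..} \<inter> C - T"
    then show "f differentiable at t within {t0..}" using deriv differentiableI_vector by blast
  qed
qed

definition E :: "nat \<Rightarrow> (real^'n^'n) \<Rightarrow>\<^sub>L (real^'n^'n)" where
  "E k = V (\<tau> k) o\<^sub>L jump_blinfun N J k o\<^sub>L U (\<tau> k)"

text \<open>In the coordinates \<open>Y = V t X\<close> a solution is constant between the impulses, where it is
  multiplied by \<open>E k\<close>; \<open>jump_product k m\<close> is the product of \<open>m\<close> such factors, starting with \<open>E k\<close>.\<close>

primrec jump_product :: "nat \<Rightarrow> nat \<Rightarrow> (real^'n^'n) \<Rightarrow>\<^sub>L (real^'n^'n)" where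
  "jump_product k 0 = id_blinfun"
| "jump_product k (Suc m) = E (k + m) o\<^sub>L jump_product k m"

text \<open>The definition splits off the last jump, the recursion for the cost needs the first one
  split off.\<close>

lemma jump_product_Suc: "blinfun_apply (jump_product k (Suc m)) Y = blinfun_apply (jump_product (Suc k) m) (blinfun_apply (E k) Y)"
  by (induction m) simp_all

definition sol :: "real \<Rightarrow> real^'n^'n \<Rightarrow> real \<Rightarrow> real^'n^'n" where
  "sol t0 X0 t = blinfun_apply (U t) (blinfun_apply (jump_product (nxt t0) (nxt t - nxt t0)) (blinfun_apply (V t0) X0))"

text \<open>Stability bounds whatever solutions exist; it says something about the coefficients only
  because this one does. It is moreover linear in the initial value.\<close>

lemma sol_is_solution:
  assumes t0: "0 \<le> t0"
  shows "is_solution N A \<mu> J \<tau> t0 X0 (sol t0 X0)"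
proof -
  define g where "g k t = blinfun_apply (U t)
    (blinfun_apply (jump_product (nxt t0) (k - nxt t0)) (blinfun_apply (V t0) X0))" for k t
  have g_cont: "continuous_on {0..} (g k)" for k unfolding g_def by (rule U_apply_cont)
  have g_deriv: "\<forall>k. \<forall>t\<in>C. (g k has_vector_derivative flow_op N A \<mu> t (g k t)) (at t within {0..})"
    unfolding g_def using U_apply_deriv by blast
  have sol: "sol t0 X0 = (\<lambda>t. g (nxt t) t)" by (rule ext) (simp add: sol_def g_def)
  note glue = nxt_glue[OF t0 sol g_cont g_deriv]
  show ?thesis
    unfolding is_solution_def
  proof (intro conjI ballI allI impI)
    show "sol t0 X0 t0 = X0" using t0 by (simp add: sol_def)
    fix t assume "t \<in> ({t0..} \<inter> C) - T"
    from glue(2)[OF this] show "(sol t0 X0 has_vector_derivative flow_op N A \<mu> t (sol t0 X0 t)) (at t within {t0..})"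
      by (simp add: sol)
  next
    fix k :: nat assume k: "1 \<le> k" "t0 \<le> \<tau> k"
    then have "nxt t0 \<le> k" using nxt_le_iff by blast
    then have "g (Suc k) (\<tau> k) = jump_op N J k (sol t0 X0 (\<tau> k))"
      using k tau_nonneg[OF k(1)] by (simp add: g_def sol_def nxt_tau Suc_diff_le E_def)
    then show "(sol t0 X0 \<longlongrightarrow> jump_op N J k (sol t0 X0 (\<tau> k))) (at_right (\<tau> k))"
      using glue(3)[OF k(1)] by simp
  qed (rule glue(1))
qed

lemma E_commutes_transpose: "1 \<le> k \<Longrightarrow> commutes_transpose (E k)"
  unfolding E_def
  by (intro commutes_transpose_compose V_commutes_transpose U_commutes_transpose commutes_transpose_jump tau_nonneg)

lemma jump_product_commutes_transpose: "1 \<le> k \<Longrightarrow> commutes_transpose (jump_product k m)"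
  by (induction m) (simp_all add: commutes_transpose_compose commutes_transpose_id E_commutes_transpose)

lemma sol_transpose:
  assumes "0 \<le> t0" "t0 \<le> t"
  shows "sol t0 (transpose X) t = transpose (sol t0 X t)"
  using U_commutes_transpose[of t] V_commutes_transpose[of t0] jump_product_commutes_transpose[OF nxt_ge_1] assms
  by (simp add: sol_def commutes_transpose_def)

lemma sol_linear: "linear (\<lambda>X. sol t0 X t)"
  unfolding sol_def by (rule linearI) (simp_all add: blinfun.bilinear_simps)

lemma sol_psd: "0 \<le> t0 \<Longrightarrow> t0 \<le> t \<Longrightarrow> pos_semidefinite X \<Longrightarrow> pos_semidefinite (sol t0 X t)"
  by (rule solution_psd[OF sol_is_solution])

text \<open>The trace only sees the symmetric part of the initial value, which is a difference of
  semidefinite matrices.\<close>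

lemma trace_bound:
  assumes "gues N A \<mu> J \<tau> \<alpha> \<rho>" and \<rho>: "0 < \<rho>" "\<rho> < 1"
  obtains K where "0 < K" "\<forall>t0\<ge>0. \<forall>t\<ge>t0. \<forall>X.
    \<bar>mat 1 \<bullet> sol t0 X t\<bar> \<le> K * \<rho> ^ (nxt t - nxt t0) * exp (- \<alpha> * (t - t0)) * norm X"
proof -
  obtain \<beta> where \<beta>: "1 \<le> \<beta>" and bound: "\<And>t0 X0 X t. 0 \<le> t0 \<Longrightarrow> pos_semidefinite X0 \<Longrightarrow>
      is_solution N A \<mu> J \<tau> t0 X0 X \<Longrightarrow> t0 \<le> t \<Longrightarrow>
      norm (X t) \<le> \<beta> * \<rho> ^ num_jumps \<tau> t t0 * exp (- \<alpha> * (t - t0)) * norm X0"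
    using assms(1) unfolding gues_def by blast
  define n where "n = norm (mat 1 :: real^'n^'n)"
  \<comment> \<open>One factor \<open>n\<close> bounds the trace by the norm. Splitting the
    symmetric part \<open>M\<close> as \<open>norm M *\<^sub>R mat 1\<close> minus a semidefinite
    matrix of norm at most \<open>norm M * (n + 1)\<close> gives \<open>2 * n + 1\<close>; the last
    1 makes \<open>K\<close> positive.\<close>
  define K where "K = n * \<beta> * (2 * n + 1) + 1"
  have n: "0 \<le> n" by (simp add: n_def)
  have "\<bar>mat 1 \<bullet> sol t0 X t\<bar> \<le> K * \<rho> ^ (nxt t - nxt t0) * exp (- \<alpha> * (t - t0)) * norm X"
    if t: "0 \<le> t0" "t0 \<le> t" for t0 t X
  proof -
    define r where "r = \<beta> * \<rho> ^ (nxt t - nxt t0) * exp (- \<alpha> * (t - t0))"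
    have r: "0 \<le> r" using \<beta> \<rho> by (simp add: r_def)
    have psd_bound: "\<bar>mat 1 \<bullet> sol t0 Y t\<bar> \<le> n * (r * norm Y)" if "pos_semidefinite Y" for Y
    proof -
      have "\<bar>mat 1 \<bullet> sol t0 Y t\<bar> \<le> n * norm (sol t0 Y t)"
        unfolding n_def by (rule Cauchy_Schwarz_ineq2)
      also have "norm (sol t0 Y t) \<le> \<beta> * \<rho> ^ num_jumps \<tau> t t0 * exp (- \<alpha> * (t - t0)) * norm Y"
        by (rule bound[OF t(1) that sol_is_solution[OF t(1)] t(2)])
      also have "\<dots> \<le> r * norm Y"
        unfolding r_def using \<beta> \<rho> num_jumps_bounds(1)[OF t(2)]
        by (intro mult_right_mono mult_left_mono power_decreasing) auto
      finally show ?thesis using n by (simp add: mult_left_mono)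
    qed
    define M where "M = (1 / 2) *\<^sub>R (X + transpose X)"
    have M_sym: "symmetric_matrix M"
      by (simp add: M_def symmetric_matrix_def transpose_scalar transpose_add add.commute)
    have M_norm: "norm M \<le> norm X"
      using norm_triangle_ineq[of X "transpose X"] by (simp add: M_def norm_transpose)
    have tr: "mat 1 \<bullet> transpose Y = mat 1 \<bullet> Y" for Y :: "real^'n^'n"
      using inner_transpose[of "mat 1" Y] by simp
    interpret sol: linear "\<lambda>X. sol t0 X t" by (rule sol_linear)
    have "mat 1 \<bullet> sol t0 M t = mat 1 \<bullet> sol t0 X t"
      unfolding M_def by (simp add: sol.scale sol.add sol_transpose[OF t] inner_add_right tr)
    moreover have "sol t0 (norm M *\<^sub>R mat 1 - M) t = norm M *\<^sub>R sol t0 (mat 1) t - sol t0 M t"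
      by (simp add: sol.diff sol.scale)
    ultimately have "mat 1 \<bullet> sol t0 X t =
        norm M * (mat 1 \<bullet> sol t0 (mat 1) t) - mat 1 \<bullet> sol t0 (norm M *\<^sub>R mat 1 - M) t"
      by (simp add: inner_diff_right)
    then have "\<bar>mat 1 \<bullet> sol t0 X t\<bar> \<le>
        \<bar>norm M * (mat 1 \<bullet> sol t0 (mat 1) t)\<bar> + \<bar>mat 1 \<bullet> sol t0 (norm M *\<^sub>R mat 1 - M) t\<bar>"
      by (simp only: abs_triangle_ineq4)
    also have "\<bar>norm M * (mat 1 \<bullet> sol t0 (mat 1) t)\<bar> = norm M * \<bar>mat 1 \<bullet> sol t0 (mat 1) t\<bar>"
      by (simp add: abs_mult)
    also have "norm M * \<bar>mat 1 \<bullet> sol t0 (mat 1) t\<bar> + \<bar>mat 1 \<bullet> sol t0 (norm M *\<^sub>R mat 1 - M) t\<bar>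
        \<le> norm M * (n * (r * n)) + n * (r * (norm M * n + norm M))"
    proof (intro add_mono mult_left_mono)
      show "\<bar>mat 1 \<bullet> sol t0 (mat 1) t\<bar> \<le> n * (r * n)"
        using psd_bound[OF psd_identity] by (simp add: n_def)
      have "\<bar>mat 1 \<bullet> sol t0 (norm M *\<^sub>R mat 1 - M) t\<bar> \<le> n * (r * norm (norm M *\<^sub>R mat 1 - M))"
        by (rule psd_bound[OF psd_norm_diff[OF M_sym]])
      also have "\<dots> \<le> n * (r * (norm M * n + norm M))"
        using norm_triangle_ineq4[of "norm M *\<^sub>R mat 1" M] n r by (intro mult_left_mono) (auto simp: n_def)
      finally show "\<bar>mat 1 \<bullet> sol t0 (norm M *\<^sub>R mat 1 - M) t\<bar> \<le> n * (r * (norm M * n + norm M))" .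
    qed simp
    also have "\<dots> = (n * (2 * n + 1) * r) * norm M" by (simp add: algebra_simps)
    also have "\<dots> \<le> (n * (2 * n + 1) * r) * norm X"
      using n r M_norm by (intro mult_left_mono) auto
    also have "\<dots> = (K - 1) * (\<rho> ^ (nxt t - nxt t0) * exp (- \<alpha> * (t - t0)) * norm X)"
      by (simp add: K_def r_def ac_simps)
    also have "\<dots> \<le> K * (\<rho> ^ (nxt t - nxt t0) * exp (- \<alpha> * (t - t0)) * norm X)"
      using \<rho> by (intro mult_right_mono) auto
    finally show ?thesis by (simp add: mult.assoc)
  qed
  moreover have "0 < K" using n \<beta> by (simp add: K_def add_nonneg_pos)
  ultimately show ?thesis using that by blast
qed

text \<open>\<open>lyapunov_solution t\<close> represents \<open>X \<mapsto> \<integral> tr X(s) ds + \<Sum> tr X(\<tau> k)\<close>, over the times \<open>s \<ge> t\<close>, \<open>\<tau> k \<ge> t\<close>, along the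
  solution starting with \<open>X\<close> at time \<open>t\<close>; \<open>stage_term k m\<close> is the contribution of \<open>[\<tau> (k + m), \<tau> (k + m + 1))\<close>.\<close>

definition stage_cost :: "nat \<Rightarrow> real^'n^'n" where
  "stage_cost k = Z (\<tau> k) + badj (E k) (F (\<tau> (Suc k)) - F (\<tau> k))"

definition stage_term :: "nat \<Rightarrow> nat \<Rightarrow> real^'n^'n" where
  "stage_term k m = badj (jump_product k m) (stage_cost (k + m))"

definition cost_to_go :: "nat \<Rightarrow> real^'n^'n" where
  "cost_to_go k = (\<Sum>m. stage_term k m)"

definition lyapunov_solution :: "real \<Rightarrow> real^'n^'n" where
  "lyapunov_solution t = badj (V t) (cost_to_go (nxt t) + F (\<tau> (nxt t)) - F t)"

text \<open>At the impulse instant \<open>\<tau> (k + m)\<close> only \<open>m\<close> jumps have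
  acted, on the interval after it \<open>m + 1\<close>.\<close>

lemma stage_term_inner:
  assumes "1 \<le> k"
  shows "stage_term k m \<bullet> Y = mat 1 \<bullet> blinfun_apply (U (\<tau> (k + m))) (blinfun_apply (jump_product k m) Y) +
    integral {\<tau> (k + m)..\<tau> (Suc (k + m))} (\<lambda>s. mat 1 \<bullet> blinfun_apply (U s) (blinfun_apply (jump_product k (Suc m)) Y))"
  using assms tau_nonneg[of "k + m"] tau_mono'[of "k + m" "Suc (k + m)"]
  by (simp add: stage_term_def stage_cost_def inner_badj inner_add_left inner_Z F_diff_inner)

lemma stage_term_Suc: "stage_term k (Suc m) = badj (E k) (stage_term (Suc k) m)"
proof -
  have "stage_term k (Suc m) \<bullet> Y = badj (E k) (stage_term (Suc k) m) \<bullet> Y" for Y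
    unfolding stage_term_def inner_badj jump_product_Suc by simp
  then show ?thesis using vector_eq_rdot by blast
qed

lemma stage_term_0: "stage_term k 0 = stage_cost k"
proof -
  have "stage_term k 0 \<bullet> Y = stage_cost k \<bullet> Y" for Y by (simp add: stage_term_def inner_badj)
  then show ?thesis using vector_eq_rdot by blast
qed

lemma stage_term_symmetric:
  assumes "1 \<le> k"
  shows "symmetric_matrix (stage_term k m)"
  unfolding stage_term_def stage_cost_def using assms
  by (intro badj_symmetric symmetric_add symmetric_diff jump_product_commutes_transpose E_commutes_transpose
      Z_symmetric F_symmetric tau_nonneg) auto

text \<open>This and the next two lemmas translate the time-0 coordinates back into values of the
  solution from \<open>t\<close>, where the stability bound applies.\<close>

lemma sol_at_tau:
  assumes "nxt t = k"
  shows "blinfun_apply (U (\<tau> (k + m))) (blinfun_apply (jump_product k m) (blinfun_apply (V t) X)) = sol t X (\<tau> (k + m))"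
  using assms nxt_ge_1[of t] by (auto simp: sol_def nxt_tau)

lemma sol_after_tau:
  assumes "nxt t = k" "\<tau> (k + m) < s" "s \<le> \<tau> (Suc (k + m))"
  shows "blinfun_apply (U s) (blinfun_apply (jump_product k (Suc m)) (blinfun_apply (V t) X)) = sol t X s"
proof -
  have "nxt s = Suc (k + m)" using assms nxt_ge_1[of t] by (intro nxt_after_jump) auto
  then show ?thesis using assms(1) by (auto simp: sol_def Suc_diff_le)
qed

lemma sol_before_tau:
  assumes "t \<le> s" "s \<le> \<tau> (nxt t)"
  shows "blinfun_apply (U s) (blinfun_apply (V t) X) = sol t X s"
  using assms nxt_constant[of t s] by (cases "s = t") (auto simp: sol_def)

lemma trace_U_cont: "0 \<le> a \<Longrightarrow> continuous_on {a..b} (\<lambda>s. mat 1 \<bullet> blinfun_apply (U s) Y)"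
  by (intro continuous_intros continuous_on_subset[OF U_apply_cont]) auto

text \<open>Semidefiniteness of the solution makes every trace nonnegative. The second claim keeps
  just the trace at the next impulse, which is what the lower bound on \<open>P\<close> uses of the
  sum.\<close>

lemma stage_term_nonneg:
  assumes t: "0 \<le> t" and psd: "pos_semidefinite X"
  shows "0 \<le> stage_term (nxt t) m \<bullet> blinfun_apply (V t) X"
    and "mat 1 \<bullet> sol t X (\<tau> (nxt t)) \<le> stage_term (nxt t) 0 \<bullet> blinfun_apply (V t) X"
proof -
  have int: "0 \<le> integral {\<tau> (nxt t + m)..\<tau> (Suc (nxt t + m))}
      (\<lambda>s. mat 1 \<bullet> blinfun_apply (U s) (blinfun_apply (jump_product (nxt t) (Suc m)) (blinfun_apply (V t) X)))" for m
  proof -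
    have t_le: "t \<le> \<tau> (nxt t + m)" using le_tau_nxt[of t] tau_mono'[OF nxt_ge_1[of t], of "nxt t + m"] by simp
    have "integral {\<tau> (nxt t + m)..\<tau> (Suc (nxt t + m))} (\<lambda>s. 0) \<le> integral {\<tau> (nxt t + m)..\<tau> (Suc (nxt t + m))}
      (\<lambda>s. mat 1 \<bullet> blinfun_apply (U s) (blinfun_apply (jump_product (nxt t) (Suc m)) (blinfun_apply (V t) X)))"
    proof (rule integral_le_except_left[OF continuous_on_const trace_U_cont])
      show "0 \<le> \<tau> (nxt t + m)" using t t_le by simp
      fix s assume s: "\<tau> (nxt t + m) < s" "s \<le> \<tau> (Suc (nxt t + m))"
      show "0 \<le> mat 1 \<bullet> blinfun_apply (U s) (blinfun_apply (jump_product (nxt t) (Suc m)) (blinfun_apply (V t) X))"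
        unfolding sol_after_tau[OF refl s]
        using t t_le s by (intro psd_trace_nonneg sol_psd psd) auto
    qed
    then show ?thesis by simp
  qed
  have tr: "0 \<le> mat 1 \<bullet> sol t X (\<tau> (nxt t + m))" for m
    using t le_tau_nxt[of t] tau_mono'[OF nxt_ge_1[of t], of "nxt t + m"]
    by (intro psd_trace_nonneg sol_psd psd) auto
  show "0 \<le> stage_term (nxt t) m \<bullet> blinfun_apply (V t) X"
    unfolding stage_term_inner[OF nxt_ge_1] sol_at_tau[OF refl] using int[of m] tr[of m] by simp
  show "mat 1 \<bullet> sol t X (\<tau> (nxt t)) \<le> stage_term (nxt t) 0 \<bullet> blinfun_apply (V t) X"
    unfolding stage_term_inner[OF nxt_ge_1] sol_at_tau[OF refl] using int[of 0] by simp
qed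

section \<open>Bounds and dynamics of the cost functional under trace decay\<close>

context
  fixes \<alpha> \<rho> K :: real
  assumes \<alpha>: "0 < \<alpha>" and \<rho>: "0 < \<rho>" "\<rho> < 1" and K: "0 < K"
    and trace_decay: "\<forall>t0\<ge>0. \<forall>t\<ge>t0. \<forall>X.
      \<bar>mat 1 \<bullet> sol t0 X t\<bar> \<le> K * \<rho> ^ (nxt t - nxt t0) * exp (- \<alpha> * (t - t0)) * norm X"
begin

lemmas tr_bound = trace_decay[rule_format]

lemma decay_integral_le:
  assumes "t \<le> a" "a \<le> b"
  shows "integral {a..b} (\<lambda>s. exp (- \<alpha> * (s - t))) \<le> 1 / \<alpha>"
proof -
  have "exp (- \<alpha> * (a - t)) \<le> 1" using \<alpha> assms by simp
  moreover have "0 < exp (- \<alpha> * (b - t))" by simp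
  ultimately have "exp (- \<alpha> * (a - t)) - exp (- \<alpha> * (b - t)) \<le> 1" by linarith
  then show ?thesis
    unfolding exp_decay_integral[OF \<alpha> assms(2)] using \<alpha> by (intro divide_right_mono) auto
qed

text \<open>The \<open>m\<close> jumps supply \<open>\<rho> ^ m\<close>, and the exponential keeps
  the integral below \<open>1 / \<alpha>\<close> whatever the length of the gap. The bound is in
  \<open>X\<close> and not in \<open>V t X\<close>: the fundamental solution may grow with
  \<open>t\<close>, and the bounds on \<open>P\<close> must be uniform.\<close>

lemma stage_term_bound:
  assumes t: "0 \<le> t"
  shows "\<bar>stage_term (nxt t) m \<bullet> blinfun_apply (V t) X\<bar> \<le> K * (1 + 1 / \<alpha>) * norm X * \<rho> ^ m"
proof -
  define k where "k = nxt t"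
  have k: "1 \<le> k" "nxt t = k" using nxt_ge_1[of t] by (auto simp: k_def)
  define a b where "a = \<tau> (k + m)" and "b = \<tau> (Suc (k + m))"
  have ta: "t \<le> a" using le_tau_nxt[of t] tau_mono'[OF k(1), of "k + m"] by (simp add: k a_def)
  have ab: "a \<le> b" unfolding a_def b_def using k by (intro tau_mono') auto
  have "\<bar>mat 1 \<bullet> sol t X a\<bar> \<le> K * \<rho> ^ (nxt a - nxt t) * exp (- \<alpha> * (a - t)) * norm X"
    by (rule tr_bound[OF t ta])
  also have "nxt a - nxt t = m" using k by (simp add: a_def nxt_tau)
  also have "K * \<rho> ^ m * exp (- \<alpha> * (a - t)) * norm X \<le> K * \<rho> ^ m * 1 * norm X"
    using K \<rho> \<alpha> ta by (intro mult_right_mono mult_left_mono) auto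
  finally have jump: "\<bar>mat 1 \<bullet> sol t X a\<bar> \<le> K * \<rho> ^ m * norm X" by simp
  have "\<bar>integral {a..b} (\<lambda>s. mat 1 \<bullet> blinfun_apply (U s) (blinfun_apply (jump_product k (Suc m)) (blinfun_apply (V t) X)))\<bar>
      \<le> integral {a..b} (\<lambda>s. K * \<rho> ^ m * norm X * exp (- \<alpha> * (s - t)))"
  proof (rule integral_abs_le_except_left)
    show "continuous_on {a..b} (\<lambda>s. K * \<rho> ^ m * norm X * exp (- \<alpha> * (s - t)))" by (intro continuous_intros)
    fix s assume s: "a < s" "s \<le> b"
    have "nxt s = Suc (k + m)" using s k by (intro nxt_after_jump) (auto simp: a_def b_def)
    then have "\<bar>mat 1 \<bullet> sol t X s\<bar> \<le> K * \<rho> ^ Suc m * exp (- \<alpha> * (s - t)) * norm X"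
      using tr_bound[OF t, of s X] s ta k by (simp add: Suc_diff_le)
    also have "\<dots> \<le> K * \<rho> ^ m * exp (- \<alpha> * (s - t)) * norm X"
      using K \<rho> by (intro mult_right_mono mult_left_mono power_decreasing) auto
    finally have "\<bar>mat 1 \<bullet> sol t X s\<bar> \<le> K * \<rho> ^ m * norm X * exp (- \<alpha> * (s - t))"
      by (simp only: ac_simps)
    then show "\<bar>mat 1 \<bullet> blinfun_apply (U s) (blinfun_apply (jump_product k (Suc m)) (blinfun_apply (V t) X))\<bar> \<le>
        K * \<rho> ^ m * norm X * exp (- \<alpha> * (s - t))"
      using sol_after_tau[OF k(2) s[unfolded a_def b_def], of X] by simp
  qed (use t ta in \<open>intro trace_U_cont, simp\<close>)
  also have "\<dots> = K * \<rho> ^ m * norm X * integral {a..b} (\<lambda>s. exp (- \<alpha> * (s - t)))"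
    by (rule integral_mult_right)
  also have "\<dots> \<le> K * \<rho> ^ m * norm X * (1 / \<alpha>)"
    using K \<rho> by (intro mult_left_mono decay_integral_le ta ab) auto
  finally have "\<bar>stage_term k m \<bullet> blinfun_apply (V t) X\<bar> \<le> K * \<rho> ^ m * norm X + K * \<rho> ^ m * norm X * (1 / \<alpha>)"
    using jump unfolding stage_term_inner[OF k(1)] sol_at_tau[OF k(2)] a_def b_def by linarith
  then show ?thesis by (simp add: k_def algebra_simps)
qed

text \<open>Tested against itself, a term inherits a norm bound from the bound on its functional.
  For a single series the dependence of the constant on \<open>k\<close> through
  \<open>norm (U (\<tau> k))\<close> is harmless.\<close>

lemma stage_term_summable:
  assumes "1 \<le> k"
  shows "summable (stage_term k)"
proof (rule summable_comparison_test')
  define B where "B = K * (1 + 1 / \<alpha>) * norm (U (\<tau> k))"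
  show "summable (\<lambda>m. B * \<rho> ^ m)" using \<rho> by (intro summable_mult summable_geometric) auto
  fix m
  have t: "0 \<le> \<tau> k" "nxt (\<tau> k) = k" using tau_nonneg nxt_tau assms by auto
  have "(norm (stage_term k m))\<^sup>2 = \<bar>stage_term k m \<bullet> blinfun_apply (V (\<tau> k)) (blinfun_apply (U (\<tau> k)) (stage_term k m))\<bar>"
    using t by (simp add: power2_norm_eq_inner)
  also have "\<dots> \<le> K * (1 + 1 / \<alpha>) * norm (blinfun_apply (U (\<tau> k)) (stage_term k m)) * \<rho> ^ m"
    using stage_term_bound[OF t(1), of m "blinfun_apply (U (\<tau> k)) (stage_term k m)"] t by simp
  also have "\<dots> \<le> K * (1 + 1 / \<alpha>) * (norm (U (\<tau> k)) * norm (stage_term k m)) * \<rho> ^ m"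
    using K \<alpha> \<rho> by (intro mult_right_mono mult_left_mono norm_blinfun) auto
  also have "\<dots> = B * \<rho> ^ m * norm (stage_term k m)" by (simp add: B_def ac_simps)
  finally have "norm (stage_term k m) * norm (stage_term k m) \<le> B * \<rho> ^ m * norm (stage_term k m)" by (simp only: power2_eq_square)
  moreover have "0 \<le> B * \<rho> ^ m" using K \<alpha> \<rho> by (simp add: B_def)
  ultimately show "norm (stage_term k m) \<le> B * \<rho> ^ m"
    by (cases "norm (stage_term k m) = 0") (auto simp: mult_le_cancel_right)
qed

text \<open>Dynamic programming: removing the first stage leaves the series of the next index,
  pulled back along \<open>E k\<close>. This is the jump relation for \<open>P\<close> in time-0
  coordinates.\<close>

lemma cost_to_go_rec: "1 \<le> k \<Longrightarrow> cost_to_go k = stage_cost k + badj (E k) (cost_to_go (Suc k))"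
proof -
  assume k: "1 \<le> k"
  have "cost_to_go k = stage_term k 0 + (\<Sum>m. stage_term k (Suc m))"
    unfolding cost_to_go_def using suminf_split_head[OF stage_term_summable[OF k]] by simp
  also have "(\<Sum>m. stage_term k (Suc m)) = badj (E k) (cost_to_go (Suc k))"
    unfolding stage_term_Suc cost_to_go_def
    by (rule bounded_linear.suminf[OF bounded_linear_badj, symmetric]) (intro stage_term_summable, simp)
  finally show ?thesis by (simp add: stage_term_0)
qed

lemma cost_to_go_inner:
  assumes "1 \<le> k"
  shows "summable (\<lambda>m. stage_term k m \<bullet> Y)" "cost_to_go k \<bullet> Y = (\<Sum>m. stage_term k m \<bullet> Y)"
  unfolding cost_to_go_def
  using bounded_linear.summable[OF bounded_linear_inner_left stage_term_summable[OF assms]]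
    bounded_linear.suminf[OF bounded_linear_inner_left stage_term_summable[OF assms]]
  by auto

lemma cost_to_go_symmetric:
  assumes "1 \<le> k"
  shows "symmetric_matrix (cost_to_go k)"
  unfolding symmetric_matrix_def cost_to_go_def
  using bounded_linear.suminf[OF bounded_linear_transpose stage_term_summable[OF assms]] stage_term_symmetric[OF assms]
  by (simp add: symmetric_matrix_def)

lemma lyapunov_solution_symmetric: "0 \<le> t \<Longrightarrow> symmetric_matrix (lyapunov_solution t)"
  unfolding lyapunov_solution_def
  by (intro badj_symmetric V_commutes_transpose symmetric_add symmetric_diff cost_to_go_symmetric F_symmetric nxt_ge_1)

lemma lyapunov_solution_inner:
  assumes "0 \<le> t"
  shows "lyapunov_solution t \<bullet> X = cost_to_go (nxt t) \<bullet> blinfun_apply (V t) X + integral {t..\<tau> (nxt t)} (\<lambda>s. mat 1 \<bullet> sol t X s)"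
proof -
  have "lyapunov_solution t \<bullet> X = cost_to_go (nxt t) \<bullet> blinfun_apply (V t) X + (F (\<tau> (nxt t)) - F t) \<bullet> blinfun_apply (V t) X"
    by (simp add: lyapunov_solution_def inner_badj inner_add_left inner_diff_left)
  also have "(F (\<tau> (nxt t)) - F t) \<bullet> blinfun_apply (V t) X = integral {t..\<tau> (nxt t)} (\<lambda>s. mat 1 \<bullet> sol t X s)"
    unfolding F_diff_inner[OF assms le_tau_nxt] by (intro integral_cong) (simp add: sol_before_tau)
  finally show ?thesis .
qed

lemma sol_trace_cont:
  assumes "0 \<le> t"
  shows "continuous_on {t..\<tau> (nxt t)} (\<lambda>s. mat 1 \<bullet> sol t X s)"
  using trace_U_cont[OF assms, of "\<tau> (nxt t)" "blinfun_apply (V t) X"]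
  by (rule continuous_on_eq) (simp add: sol_before_tau)

text \<open>Applied to the initial value \<open>P t\<close> itself, the functional gives the square
  of \<open>norm (P t)\<close>. The constant adds the geometric series of the stages to the integral
  up to the first impulse.\<close>

lemma lyapunov_solution_bounded: obtains c where "0 < c" "\<And>t. 0 \<le> t \<Longrightarrow> norm (lyapunov_solution t) \<le> c"
proof -
  define c where "c = K * (1 + 1 / \<alpha>) / (1 - \<rho>) + K / \<alpha>"
  have c: "0 < c" using K \<alpha> \<rho> by (simp add: c_def add_pos_pos)
  have "norm (lyapunov_solution t) \<le> c" if t: "0 \<le> t" for t
  proof -
    let ?X = "lyapunov_solution t" and ?Y = "blinfun_apply (V t) (lyapunov_solution t)"
    let ?B = "K * (1 + 1 / \<alpha>) * norm ?X"
    have geo: "(\<lambda>m. ?B * \<rho> ^ m) sums (?B * (1 / (1 - \<rho>)))"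
      using \<rho> by (intro sums_mult geometric_sums) auto
    have "\<bar>cost_to_go (nxt t) \<bullet> ?Y\<bar> \<le> (\<Sum>m. ?B * \<rho> ^ m)"
      unfolding cost_to_go_inner(2)[OF nxt_ge_1]
      using norm_suminf_le[OF _ sums_summable[OF geo], of "\<lambda>m. stage_term (nxt t) m \<bullet> ?Y"] stage_term_bound[OF t, of _ ?X]
      by simp
    then have q: "\<bar>cost_to_go (nxt t) \<bullet> ?Y\<bar> \<le> ?B * (1 / (1 - \<rho>))" using sums_unique[OF geo] by simp
    have "\<bar>integral {t..\<tau> (nxt t)} (\<lambda>s. mat 1 \<bullet> sol t ?X s)\<bar>
        \<le> integral {t..\<tau> (nxt t)} (\<lambda>s. K * norm ?X * exp (- \<alpha> * (s - t)))"
    proof (rule integral_abs_le_except_left[OF sol_trace_cont[OF t]])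
      show "continuous_on {t..\<tau> (nxt t)} (\<lambda>s. K * norm ?X * exp (- \<alpha> * (s - t)))" by (intro continuous_intros)
      fix s assume "t < s" "s \<le> \<tau> (nxt t)"
      then show "\<bar>mat 1 \<bullet> sol t ?X s\<bar> \<le> K * norm ?X * exp (- \<alpha> * (s - t))"
        using tr_bound[OF t, of s ?X] nxt_constant[of t s] by (simp add: ac_simps)
    qed
    also have "\<dots> = K * norm ?X * integral {t..\<tau> (nxt t)} (\<lambda>s. exp (- \<alpha> * (s - t)))"
      by (rule integral_mult_right)
    also have "\<dots> \<le> K * norm ?X * (1 / \<alpha>)"
      using K by (intro mult_left_mono decay_integral_le le_tau_nxt order.refl) auto
    finally have "\<bar>lyapunov_solution t \<bullet> ?X\<bar> \<le> ?B * (1 / (1 - \<rho>)) + K * norm ?X * (1 / \<alpha>)"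
      using q unfolding lyapunov_solution_inner[OF t] by linarith
    also have "\<dots> = c * norm ?X" by (simp add: c_def distrib_right)
    finally have "norm ?X * norm ?X \<le> c * norm ?X" by (simp add: power2_norm_eq_inner[symmetric] power2_eq_square)
    then show ?thesis using c by (cases "norm ?X = 0") (auto simp: mult_le_cancel_right)
  qed
  then show ?thesis using that c by blast
qed

text \<open>The next impulse may be arbitrarily near or far. With \<open>e\<close> the guaranteed
  decay factor of the trace until then, the integral contributes \<open>(1 - e) / a\<close> and the
  first summand \<open>e\<close>; the total is a convex combination of \<open>1 / a\<close> and 1,
  hence at least their minimum.\<close>

lemma lyapunov_solution_lower: obtains c where "0 < c" "\<And>t x. 0 \<le> t \<Longrightarrow> c * (norm x)\<^sup>2 \<le> x \<bullet> (lyapunov_solution t *v x)"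
proof -
  obtain a where a: "0 < a" "\<And>u v X. flow_solution u v X \<Longrightarrow> pos_semidefinite (X u) \<Longrightarrow>
    exp (- a * (v - u)) * (mat 1 \<bullet> X u) \<le> mat 1 \<bullet> X v"
    using flow_solution_trace_ge by blast
  define c where "c = min 1 (1 / a)"
  have c: "0 < c" using a(1) by (simp add: c_def)
  have "c * (norm x)\<^sup>2 \<le> x \<bullet> (lyapunov_solution t *v x)" if t: "0 \<le> t" for t x
  proof -
    let ?X = "rank_one x" and ?b = "\<tau> (nxt t)"
    have tb: "t \<le> ?b" by (rule le_tau_nxt)
    have tr: "exp (- a * (s - t)) * (norm x)\<^sup>2 \<le> mat 1 \<bullet> sol t ?X s" if s: "t \<le> s" "s \<le> ?b" for s
    proof -
      have "exp (- a * (s - t)) * (mat 1 \<bullet> blinfun_apply (U t) (blinfun_apply (V t) ?X)) \<le>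
          mat 1 \<bullet> blinfun_apply (U s) (blinfun_apply (V t) ?X)"
        by (rule a(2)[OF flow_solution_UV[OF t s(1)]]) (simp add: t psd_rank_one)
      then show ?thesis using sol_before_tau[OF s] t by (simp add: identity_inner_rank_one)
    qed
    define e where "e = exp (- a * (?b - t))"
    have e: "0 < e" "e \<le> 1" using a(1) tb by (simp_all add: e_def)
    have "integral {t..?b} (\<lambda>s. exp (- a * (s - t)) * (norm x)\<^sup>2) \<le> integral {t..?b} (\<lambda>s. mat 1 \<bullet> sol t ?X s)"
      by (rule integral_le_except_left[OF _ sol_trace_cont[OF t] tr]) (auto intro!: continuous_intros)
    then have int: "(1 - e) / a * (norm x)\<^sup>2 \<le> integral {t..?b} (\<lambda>s. mat 1 \<bullet> sol t ?X s)"
      using exp_decay_integral[OF a(1) tb, of t] by (simp add: e_def)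
    have "e * (norm x)\<^sup>2 \<le> stage_term (nxt t) 0 \<bullet> blinfun_apply (V t) ?X"
      using tr[OF tb order.refl] stage_term_nonneg(2)[OF t psd_rank_one[of x]] by (simp add: e_def)
    also have "\<dots> \<le> cost_to_go (nxt t) \<bullet> blinfun_apply (V t) ?X"
      unfolding cost_to_go_inner(2)[OF nxt_ge_1]
      using sum_le_suminf[OF cost_to_go_inner(1)[OF nxt_ge_1], of "{0}" t "blinfun_apply (V t) ?X"]
        stage_term_nonneg(1)[OF t psd_rank_one[of x]] by simp
    finally have "(e + (1 - e) / a) * (norm x)\<^sup>2 \<le> lyapunov_solution t \<bullet> ?X"
      using int unfolding lyapunov_solution_inner[OF t] by (simp add: distrib_right)
    moreover have "c \<le> e + (1 - e) / a"
    proof -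
      have "c * e + c * (1 - e) \<le> 1 * e + 1 / a * (1 - e)"
        using e by (intro add_mono mult_right_mono) (auto simp: c_def)
      then show ?thesis by (simp add: algebra_simps)
    qed
    then have "c * (norm x)\<^sup>2 \<le> (e + (1 - e) / a) * (norm x)\<^sup>2" by (rule mult_right_mono) simp
    ultimately show ?thesis by (simp add: inner_rank_one)
  qed
  then show ?thesis using that c by blast
qed

text \<open>For a fixed index the derivative of \<open>V\<close> produces the adjoint flow operator,
  and that of \<open>F\<close> the identity, because \<open>Z t \<bullet> V t X\<close> is the trace
  of \<open>X\<close>. The jump relation is the recursion of \<open>cost_to_go\<close>, where the
  summand \<open>Z (\<tau> k)\<close> yields the identity.\<close>

lemma lyapunov_solution_dynamics:
  shows lyapunov_solution_differentiable: "piecewise_differentiable 0 T C lyapunov_solution"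
    and lyapunov_solution_deriv: "\<And>t. t \<in> C - T \<Longrightarrow> vector_derivative lyapunov_solution (at t within {0..}) + flow_adj N A \<mu> t (lyapunov_solution t) = - mat 1"
    and lyapunov_solution_jump: "\<And>k. 1 \<le> k \<Longrightarrow> jump_adj N J k (Lim (at_right (\<tau> k)) lyapunov_solution) - lyapunov_solution (\<tau> k) = - mat 1"
proof -
  define g where "g k t = badj (V t) (cost_to_go k + F (\<tau> k) - F t)" for k t
  have g_inner: "g k t \<bullet> X = (cost_to_go k + F (\<tau> k) - F t) \<bullet> blinfun_apply (V t) X" for k t X
    by (simp add: g_def inner_badj)
  have g_cont: "continuous_on {0..} (g k)" for k
    by (rule continuous_on_inner_ext)
      (simp only: g_inner, intro continuous_intros F_cont V_cont
        bounded_bilinear.continuous_on[OF bounded_bilinear_blinfun_apply])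
  define g' where "g' k t = - flow_adj N A \<mu> t (g k t) - mat 1" for k t
  have g_deriv: "\<forall>k. \<forall>t\<in>C. (g k has_vector_derivative g' k t) (at t within {0..})"
  proof (intro allI ballI, rule has_vector_derivative_inner_ext)
    fix k t X assume t: "t \<in> C"
    have t0: "0 \<le> t" using t by (simp add: continuity_times_def)
    have "((\<lambda>t. cost_to_go k + F (\<tau> k) - F t) has_vector_derivative 0 - Z t) (at t within {0..})"
      by (intro has_vector_derivative_diff has_vector_derivative_const F_deriv t0)
    moreover have "((\<lambda>t. blinfun_apply (V t) X) has_vector_derivative - blinfun_apply (V t) (flow_op N A \<mu> t X)) (at t within {0..})"
      using bounded_bilinear.has_vector_derivative[OF bounded_bilinear_blinfun_apply V_deriv[OF t]
          has_vector_derivative_const[of X]] by (simp add: blinfun.minus_left)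
    ultimately have "((\<lambda>t. (cost_to_go k + F (\<tau> k) - F t) \<bullet> blinfun_apply (V t) X) has_vector_derivative
        (cost_to_go k + F (\<tau> k) - F t) \<bullet> (- blinfun_apply (V t) (flow_op N A \<mu> t X)) + (0 - Z t) \<bullet> blinfun_apply (V t) X)
        (at t within {0..})"
      by (rule bounded_bilinear.has_vector_derivative[OF bounded_bilinear_inner])
    moreover have "(cost_to_go k + F (\<tau> k) - F t) \<bullet> (- blinfun_apply (V t) (flow_op N A \<mu> t X)) + (0 - Z t) \<bullet> blinfun_apply (V t) X
        = g' k t \<bullet> X"
    proof -
      have "(cost_to_go k + F (\<tau> k) - F t) \<bullet> blinfun_apply (V t) (flow_op N A \<mu> t X) = flow_adj N A \<mu> t (g k t) \<bullet> X"
        unfolding g_inner[symmetric] using inner_flow_op[of N A \<mu> t X "g k t"] by (simp add: inner_commute)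
      moreover have "Z t \<bullet> blinfun_apply (V t) X = mat 1 \<bullet> X" using t0 by (simp add: inner_Z)
      ultimately show ?thesis by (simp add: g'_def inner_diff_left)
    qed
    ultimately show "((\<lambda>t. g k t \<bullet> X) has_vector_derivative g' k t \<bullet> X) (at t within {0..})"
      by (simp only: g_inner)
  qed
  have lyapunov_solution: "lyapunov_solution = (\<lambda>t. g (nxt t) t)" by (rule ext) (simp add: lyapunov_solution_def g_def)
  note glue = nxt_glue[OF order.refl lyapunov_solution g_cont g_deriv]
  show "piecewise_differentiable 0 T C lyapunov_solution" by (rule glue(1))
  show "vector_derivative lyapunov_solution (at t within {0..}) + flow_adj N A \<mu> t (lyapunov_solution t) = - mat 1" if t: "t \<in> C - T" for t
  proof -
    have t0: "0 \<le> t" using t by (simp add: continuity_times_def)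
    \<comment> \<open>The one-sided filter at the left endpoint 0 must be nontrivial for the
      derivative to be unique.\<close>
    have "at_right t \<le> at t within {0..}" using t0 by (intro at_le) auto
    then have "at t within {0..} \<noteq> bot" using trivial_limit_at_right_real[of t] by (auto simp: bot_unique)
    then have "vector_derivative lyapunov_solution (at t within {0..}) = g' (nxt t) t"
      using t t0 by (intro vector_derivative_within glue(2)) auto
    then show ?thesis by (simp add: g'_def lyapunov_solution)
  qed
  show "jump_adj N J k (Lim (at_right (\<tau> k)) lyapunov_solution) - lyapunov_solution (\<tau> k) = - mat 1" if k: "1 \<le> k" for k
  proof -
    have "Lim (at_right (\<tau> k)) lyapunov_solution = g (Suc k) (\<tau> k)"
      by (intro tendsto_Lim glue(3) k) simp
    moreover have "jump_adj N J k (g (Suc k) (\<tau> k)) \<bullet> X = (lyapunov_solution (\<tau> k) - mat 1) \<bullet> X" for X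
    proof -
      \<comment> \<open>In the coordinates of \<open>Y\<close> the jump becomes \<open>E k\<close>,
        to which the recursion applies.\<close>
      define Y where "Y = blinfun_apply (V (\<tau> k)) X"
      have X: "X = blinfun_apply (U (\<tau> k)) Y" using tau_nonneg[OF k] by (simp add: Y_def)
      have "jump_adj N J k (g (Suc k) (\<tau> k)) \<bullet> X = g (Suc k) (\<tau> k) \<bullet> jump_op N J k X"
        using inner_jump_op[of N J k X "g (Suc k) (\<tau> k)"] by (simp add: inner_commute)
      also have "\<dots> = (cost_to_go (Suc k) + (F (\<tau> (Suc k)) - F (\<tau> k))) \<bullet> blinfun_apply (E k) Y"
        unfolding g_inner by (simp add: E_def X[symmetric] add_diff_eq)
      also have "\<dots> = (cost_to_go k - Z (\<tau> k)) \<bullet> Y"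
        unfolding cost_to_go_rec[OF k] stage_cost_def by (simp add: inner_badj inner_add_left inner_diff_left)
      also have "\<dots> = (lyapunov_solution (\<tau> k) - mat 1) \<bullet> X"
        using tau_nonneg[OF k] by (simp add: inner_diff_left lyapunov_solution g_inner nxt_tau[OF k] inner_Z Y_def)
      finally show ?thesis .
    qed
    ultimately have "jump_adj N J k (Lim (at_right (\<tau> k)) lyapunov_solution) = lyapunov_solution (\<tau> k) - mat 1"
      using vector_eq_rdot by metis
    then show ?thesis by simp
  qed
qed

end

section \<open>Assembly of the equivalences\<close>

lemma stable_imp_lyapunov:
  assumes "0 < \<alpha>" "0 < \<rho>" "\<rho> < 1" "gues N A \<mu> J \<tau> \<alpha> \<rho>"
  shows "lyapunov_equation_solvable N A \<mu> J \<tau>" "lyapunov_inequality_solvable N A \<mu> J \<tau>"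
proof -
  obtain K where K: "0 < K" "\<forall>t0\<ge>0. \<forall>t\<ge>t0. \<forall>X.
    \<bar>mat 1 \<bullet> sol t0 X t\<bar> \<le> K * \<rho> ^ (nxt t - nxt t0) * exp (- \<alpha> * (t - t0)) * norm X"
    using trace_bound[OF assms(4,2,3)] by blast
  note ctx = assms(1-3) K
  obtain a where a: "0 < a" "\<And>t x. 0 \<le> t \<Longrightarrow> a * (norm x)\<^sup>2 \<le> x \<bullet> (lyapunov_solution t *v x)"
    using lyapunov_solution_lower[OF ctx] by blast
  obtain b where b: "0 < b" "\<And>t. 0 \<le> t \<Longrightarrow> norm (lyapunov_solution t) \<le> b"
    using lyapunov_solution_bounded[OF ctx] by blast
  note sym = lyapunov_solution_symmetric[OF ctx]
  have pd: "\<forall>t\<ge>0. pos_definite (lyapunov_solution t)"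
  proof (intro allI impI)
    fix t :: real assume t: "0 \<le> t"
    have "0 < x \<bullet> (lyapunov_solution t *v x)" if "x \<noteq> 0" for x
    proof -
      have "0 < a * (norm x)\<^sup>2" using a(1) that by simp
      then show ?thesis using a(2)[OF t, of x] by linarith
    qed
    then show "pos_definite (lyapunov_solution t)" using sym[OF t] by (simp add: pos_definite_def)
  qed
  have bounds: "\<forall>t\<ge>0. scaled_identity a \<preceq>\<^sub>L lyapunov_solution t \<and> lyapunov_solution t \<preceq>\<^sub>L scaled_identity b"
    using a(2) b(2) sym by (simp add: scaled_identity_loewner_le_iff loewner_le_norm)
  have refl: "(M :: real^'n^'n) \<preceq>\<^sub>L M" for M
    by (simp add: loewner_le_def pos_semidefinite_def symmetric_matrix_def transpose_def vec_eq_iff)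
  have pd1: "pos_definite (mat 1 :: real^'n^'n)"
    by (simp add: pos_definite_def symmetric_mat)
  show "lyapunov_equation_solvable N A \<mu> J \<tau>"
    unfolding lyapunov_equation_solvable_def
    by (intro exI[of _ lyapunov_solution] exI[of _ "\<lambda>_. mat 1"] exI[of _ a] exI[of _ b] exI[of _ "1 :: real"])
      (use a(1) b(1) pd pd1 bounds refl[of "mat 1"] lyapunov_solution_differentiable[OF ctx] lyapunov_solution_deriv[OF ctx]
        lyapunov_solution_jump[OF ctx] in \<open>simp add: piecewise_continuous_on\<close>)
  show "lyapunov_inequality_solvable N A \<mu> J \<tau>"
    unfolding lyapunov_inequality_solvable_def
    by (intro exI[of _ lyapunov_solution] exI[of _ a] exI[of _ b] exI[of _ "1 :: real"])
      (use a(1) b(1) pd bounds refl[of "- mat 1"] lyapunov_solution_differentiable[OF ctx] lyapunov_solution_deriv[OF ctx]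
        lyapunov_solution_jump[OF ctx] in simp)
qed

end

theorem theorem5p2:
  fixes N :: nat
    and A :: "nat \<Rightarrow> real \<Rightarrow> real^'n^'n"
    and \<mu> :: "real \<Rightarrow> real"
    and J :: "nat \<Rightarrow> nat \<Rightarrow> real^'n^'n"
    and \<tau> :: "nat \<Rightarrow> real"
  assumes A_pc: "\<forall>i\<le>N. piecewise_continuous (A i)"
    and A_bdd: "\<forall>i\<le>N. bounded (A i ` {0..})"
    and mu_pc: "piecewise_continuous \<mu>"
    and mu_bdd: "bounded (\<mu> ` {0..})"
    and J_bdd: "\<forall>i\<le>N. bounded (range (J i))"
    and tau_pos: "\<forall>k\<ge>1. 0 < \<tau> k"
    and tau_mono: "strict_mono_on {1..} \<tau>"
    and tau_lim: "filterlim \<tau> at_top sequentially"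
  shows "((\<exists>\<alpha> \<rho>. 0 < \<alpha> \<and> 0 < \<rho> \<and> \<rho> < 1 \<and> gues N A \<mu> J \<tau> \<alpha> \<rho>)
            \<longleftrightarrow> lyapunov_equation_solvable N A \<mu> J \<tau>) \<and>
         (lyapunov_equation_solvable N A \<mu> J \<tau>
            \<longleftrightarrow> lyapunov_inequality_solvable N A \<mu> J \<tau>)"
proof -
  interpret impulsive_system N A \<mu> J \<tau>
    using A_pc A_bdd mu_pc mu_bdd tau_pos tau_mono tau_lim
    by (intro impulsive_system.intro linear_flow.intro impulsive_system_axioms.intro)
  let ?a = "\<exists>\<alpha> \<rho>. 0 < \<alpha> \<and> 0 < \<rho> \<and> \<rho> < 1 \<and> gues N A \<mu> J \<tau> \<alpha> \<rho>"
  have ba: ?a if eqn: "lyapunov_equation_solvable N A \<mu> J \<tau>"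
  proof -
    obtain P Q :: "real \<Rightarrow> real^'n^'n" and R :: "nat \<Rightarrow> real^'n^'n" and \<alpha>1 \<alpha>2 \<beta>1 \<beta>2 \<gamma>1 \<gamma>2
      where P: "piecewise_differentiable 0 T (C \<inter> {t. continuous (at t within {0..}) Q}) P"
        and Q: "piecewise_continuous Q"
        and P_bounds: "\<forall>t\<ge>0. scaled_identity \<alpha>1 \<preceq>\<^sub>L P t \<and> P t \<preceq>\<^sub>L scaled_identity \<alpha>2"
        and Q_bounds: "\<forall>t\<ge>0. scaled_identity \<beta>1 \<preceq>\<^sub>L Q t \<and> Q t \<preceq>\<^sub>L scaled_identity \<beta>2"
        and R_bounds: "\<forall>k. scaled_identity \<gamma>1 \<preceq>\<^sub>L R k \<and> R k \<preceq>\<^sub>L scaled_identity \<gamma>2"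
        and pos: "0 < \<alpha>1" "0 < \<alpha>2" "0 < \<beta>1" "0 < \<gamma>1"
        and deriv: "\<forall>t\<in>(C \<inter> {t. continuous (at t within {0..}) Q}) - T.
          vector_derivative P (at t within {0..}) + flow_adj N A \<mu> t (P t) = - Q t"
        and jump: "\<forall>k\<ge>1. jump_adj N J k (Lim (at_right (\<tau> k)) P) - P (\<tau> k) = - R k"
      using eqn unfolding lyapunov_equation_solvable_def by - (elim exE conjE, rule that, assumption+)
    \<comment> \<open>The lower bounds on \<open>Q\<close> and \<open>R\<close> turn the two
      equations into inequalities, with \<open>\<beta>1\<close> and \<open>\<gamma>1\<close> in the
      roles of \<open>\<alpha>3\<close> and \<open>\<alpha>4\<close>.\<close>
    have neg_le: "- M \<preceq>\<^sub>L scaled_identity (- c)" if "scaled_identity c \<preceq>\<^sub>L M" for c and M :: "real^'n^'n"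
      using that by (simp add: loewner_le_def)
    show ?a
    proof (rule lyapunov_imp_stable[OF _ _ P pos])
      fix u v :: real assume u: "0 \<le> u"
      have "finite (({u..v} - C) \<union> {t \<in> {u..v}. \<not> continuous (at t within {0..}) Q})"
        using finite_discontinuities[OF u] Q u by (auto simp: piecewise_continuous_def)
      then show "finite ({u..v} - C \<inter> {t. continuous (at t within {0..}) Q})"
        by (rule finite_subset[rotated]) auto
    next
      fix t assume t: "t \<in> C \<inter> {t. continuous (at t within {0..}) Q} - T"
      then have "0 \<le> t" by (auto simp: continuity_times_def)
      then show "vector_derivative P (at t within {0..}) + flow_adj N A \<mu> t (P t) \<preceq>\<^sub>L scaled_identity (- \<beta>1)"
        using deriv t Q_bounds neg_le by simp
    next
      fix k :: nat assume "1 \<le> k"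
      then show "jump_adj N J k (Lim (at_right (\<tau> k)) P) - P (\<tau> k) \<preceq>\<^sub>L scaled_identity (- \<gamma>1)"
        using jump R_bounds neg_le by simp
    qed (use P_bounds in auto)
  qed
  have ca: ?a if ineq: "lyapunov_inequality_solvable N A \<mu> J \<tau>"
  proof -
    obtain P :: "real \<Rightarrow> real^'n^'n" and \<alpha>1 \<alpha>2 \<alpha>3 \<alpha>4
      where P: "piecewise_differentiable 0 T C P"
        and P_bounds: "\<forall>t\<ge>0. scaled_identity \<alpha>1 \<preceq>\<^sub>L P t \<and> P t \<preceq>\<^sub>L scaled_identity \<alpha>2"
        and deriv: "\<forall>t\<in>C - T. vector_derivative P (at t within {0..}) + flow_adj N A \<mu> t (P t)
          \<preceq>\<^sub>L scaled_identity (- \<alpha>3)"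
        and jump: "\<forall>k\<ge>1. jump_adj N J k (Lim (at_right (\<tau> k)) P) - P (\<tau> k) \<preceq>\<^sub>L scaled_identity (- \<alpha>4)"
        and pos: "0 < \<alpha>1" "0 < \<alpha>2" "0 < \<alpha>3" "0 < \<alpha>4"
      using ineq unfolding lyapunov_inequality_solvable_def by - (elim exE conjE, rule that, assumption+)
    show ?a
      by (rule lyapunov_imp_stable[OF order.refl finite_discontinuities P pos])
        (use P_bounds deriv jump in auto)
  qed
  show ?thesis using stable_imp_lyapunov ba ca by blast
qed

end
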